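(* Let $p\in(1,\infty)$ and let $(\mathcal{E}_p,\mathcal{F}_p)$ be the $p$-resistance form on the Sierpiński gasket $K$ constructed in the context, with scaling constant $\rho_p$. Let $(\tilde{\mathcal{E}}_p,\tilde{\mathcal{F}}_p)$ be a $p$-resistance form on $K$ satisfying (SSE1) $\tilde{\mathcal{F}}_p=\{u\in C(K)\mid u\circ F_i\in\tilde{\mathcal{F}}_p\text{ for any }i\in S\}$, and (SSE2) $\tilde{\mathcal{E}}_p(u)=\sum_{i\in S}\rho_p\,\tilde{\mathcal{E}}_p(u\circ F_i)$ for any $u\in\tilde{\mathcal{F}}_p$. Then $\tilde{\mathcal{F}}_p=\mathcal{F}_p$ and $\tilde{\mathcal{E}}_p=c\,\mathcal{E}_p$ for some $c\in(0,\infty)$.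
   Context: $\|x\|_{\ell^s}=(\sum_k|x_k|^s)^{1/s}$ for $s\in(0,\infty)$, $\|x\|_{\ell^\infty}=\max_k|x_k|$; $\mathbf 1_X$ is the constant function $1$ on $X$; $\sup\emptyset:=0$. $p$-resistance forms. A $p$-resistance form on a non-empty set $X$ is a pair $(\mathcal{E},\mathcal{F})$ of a linear subspace $\mathcal{F}\subset\mathbb{R}^X$ and $\mathcal{E}:\mathcal{F}\to[0,\infty)$ such that: (RF1) $\mathcal{E}^{1/p}$ is a seminorm and $\{\mathcal{E}=0\}=\mathbb{R}\mathbf 1_X$; (RF2) $(\mathcal{F}/\mathbb{R}\mathbf 1_X,\mathcal{E}^{1/p})$ is a Banach space; (RF3) $\mathcal{F}$ separates points of $X$; (RF4) $\sup\{|u(x)-u(y)|^p/\mathcal{E}(u)\mid u\in\mathcal{F}\setminus\mathbb{R}\mathbf 1_X\}<\infty$ for all $x,y\in X$; (RF5) if $q\in(0,p]$, $r\in[p,\infty]$, $m,n\in\mathbb{N}$ and $T:\mathbb{R}^m\to\mathbb{R}^n$ satisfies $T(0)=0$ and $\|T(x)-T(y)\|_{\ell^r}\le\|x-y\|_{\ell^q}$ for all $x,y$, then for $u\in\mathcal{F}^m$, $T(u)\in\mathcal{F}^n$ and $\|(\mathcal{E}(T_k(u))^{1/p})_k\|_{\ell^r}\le\|(\mathcal{E}(u_j)^{1/p})_j\|_{\ell^q}$. On a finite set $X$ one necessarily has $\mathcal{F}=\mathbb{R}^X$ and only $\mathcal{E}$ is mentioned. Trace: for $\emptyset\neq B\subset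 X$ and $u\in\mathcal{F}|_B$, $\mathcal{E}|_B(u):=\inf\{\mathcal{E}(v)\mid v\in\mathcal{F},v|_B=u\}$. Sierpiński gasket. $S=\{1,2,3\}$; $V_0=\{q_1,q_2,q_3\}\subset\mathbb{R}^2$ is the vertex set of an equilateral triangle; $f_i(x)=q_i+\frac12(x-q_i)$; $K$ is the unique non-empty compact subset of $\mathbb{R}^2$ with $K=\bigcup_{i\in S}f_i(K)$, with the Euclidean metric; $F_i:=f_i|_K$. $W_n=S^n$ ($W_0=\{\emptyset\}$), $F_w=F_{w_1}\circ\cdots\circ F_{w_n}$ ($F_\emptyset=\mathrm{id}_K$), $V_n=\bigcup_{w\in W_n}F_w(V_0)$. $\mathcal{G}_{\mathrm{sym}}$ is the isometry group of $K$. Construction of $(\mathcal{E}_p,\mathcal{F}_p)$. For a $p$-resistance form $\mathcal{E}$ on $V_0$, $\rho>0$, $n\ge0$, put $\mathcal{R}_{\rho,n}(\mathcal{E})(u)=\sum_{w\in W_n}\rho^n\mathcal{E}(u\circ F_w|_{V_0})$, $u\in\mathbb{R}^{V_n}$. There is a unique $\rho_p\in(0,\infty)$ for which some $p$-resistance form $\mathcal{E}$ on $V_0$ satisfies $\mathcal{R}_{\rho_p,1}(\mathcal{E})|_{V_0}=\mathcal{E}$; fix such a form $\mathcal{E}_p^{(0)}$ that is also $\mathcal{G}_{\mathrm{sym}}$-invariant ($\mathcal{E}_p^{(0)}(u\circ g|_{V_0})=\mathcal{E}_p^{(0)}(u)$ for $g\in\mathcal{G}_{\mathrm{sym}}$),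 which exists. Put $\mathcal{E}_p^{(n)}=\mathcal{R}_{\rho_p,n}(\mathcal{E}_p^{(0)})$; for $u\in C(K)$ the sequence $\mathcal{E}_p^{(n)}(u|_{V_n})$ is non-decreasing in $n$. Define $\mathcal{F}_p=\{u\in C(K)\mid\lim_n\mathcal{E}_p^{(n)}(u|_{V_n})<\infty\}$ and $\mathcal{E}_p(u)=\lim_n\mathcal{E}_p^{(n)}(u|_{V_n})$. Then $(\mathcal{E}_p,\mathcal{F}_p)$ is a $p$-resistance form on $K$ which itself satisfies (SSE1) and (SSE2). *)

theory Defs
  imports "HOL-Analysis.Analysis"
begin

section \<open>Real functions on a set\<close>

text \<open>
  A function in \<open>\<real>\<^sup>X\<close> is represented by a HOL function that is \<open>undefined\<close> outside \<open>X\<close>, so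
  that equality of representatives is equality on \<open>X\<close>. In particular, \<open>\<real>\<^sup>m\<close> is
  \<open>real_funs {..<m}\<close>.
\<close>

abbreviation real_funs :: "'a set \<Rightarrow> ('a \<Rightarrow> real) set" where
  "real_funs X \<equiv> extensional X"

definition const_funs :: "'a set \<Rightarrow> ('a \<Rightarrow> real) set" where
  "const_funs X = {\<lambda>x\<in>X. c | c. True}"

definition cont_funs :: "'a::topological_space set \<Rightarrow> ('a \<Rightarrow> real) set" where
  "cont_funs X = {u \<in> real_funs X. continuous_on X u}"

definition lnorm :: "ereal \<Rightarrow> nat \<Rightarrow> (nat \<Rightarrow> real) \<Rightarrow> real" where
  "lnorm s n x =
     (if s = \<infinity> then Max ((\<lambda>k. \<bar>x k\<bar>) ` {..<n})
      else (\<Sum>k<n. \<bar>x k\<bar> powr real_of_ereal s) powr (1 / real_of_ereal s))"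


section \<open>Resistance forms\<close>

definition mod_consts :: "'a set \<Rightarrow> ('a \<Rightarrow> real) set \<Rightarrow> (('a \<Rightarrow> real) \<times> ('a \<Rightarrow> real)) set" where
  "mod_consts X F = {(u, v). u \<in> F \<and> v \<in> F \<and> (\<lambda>x\<in>X. u x - v x) \<in> const_funs X}"

text \<open>
  The metric of the quotient norm that \<open>E\<^sup>1\<^sup>/\<^sup>p\<close> induces on \<open>F // mod_consts X F\<close>. The library's
  \<open>Metric_space\<close> requires symmetry and nonnegativity also off the carrier, whence the value \<open>0\<close>.
\<close>

definition quot_dist ::
  "real \<Rightarrow> 'a set \<Rightarrow> (('a \<Rightarrow> real) \<Rightarrow> real) \<Rightarrow> ('a \<Rightarrow> real) set
     \<Rightarrow> ('a \<Rightarrow> real) set \<Rightarrow> ('a \<Rightarrow> real) set \<Rightarrow> real" where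
  "quot_dist p X E F A B =
     (if A \<in> F // mod_consts X F \<and> B \<in> F // mod_consts X F
      then INF (u, v) \<in> A \<times> B. E (\<lambda>x\<in>X. u x - v x) powr (1 / p) else 0)"

text \<open>
  Only the values of \<open>E\<close> on \<open>F\<close> are relevant. In \<open>RF5\<close>, \<open>r\<close> may be \<open>\<infinity>\<close>.
\<close>

locale resistance_form =
  fixes p :: real and X :: "'a set"
    and E :: "('a \<Rightarrow> real) \<Rightarrow> real" and F :: "('a \<Rightarrow> real) set"
  assumes nonempty: "X \<noteq> {}"
    and funs: "F \<subseteq> real_funs X"
    and zero_mem: "(\<lambda>x\<in>X. 0) \<in> F"
    and add_mem: "\<And>u v. u \<in> F \<Longrightarrow> v \<in> F \<Longrightarrow> (\<lambda>x\<in>X. u x + v x) \<in> F"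
    and scale_mem: "\<And>a u. u \<in> F \<Longrightarrow> (\<lambda>x\<in>X. a * u x) \<in> F"
    and nonneg: "\<And>u. u \<in> F \<Longrightarrow> E u \<ge> 0"
    and RF1_scale: "\<And>a u. u \<in> F \<Longrightarrow>
          E (\<lambda>x\<in>X. a * u x) powr (1 / p) = \<bar>a\<bar> * E u powr (1 / p)"
    and RF1_triangle: "\<And>u v. u \<in> F \<Longrightarrow> v \<in> F \<Longrightarrow>
          E (\<lambda>x\<in>X. u x + v x) powr (1 / p) \<le> E u powr (1 / p) + E v powr (1 / p)"
    and RF1_kernel: "{u \<in> F. E u = 0} = const_funs X"
    and RF2_metric: "Metric_space (F // mod_consts X F) (quot_dist p X E F)"
    and RF2_complete: "Metric_space.mcomplete (F // mod_consts X F) (quot_dist p X E F)"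
    and RF3: "\<And>x y. x \<in> X \<Longrightarrow> y \<in> X \<Longrightarrow> x \<noteq> y \<Longrightarrow> \<exists>u\<in>F. u x \<noteq> u y"
    and RF4: "\<And>x y. x \<in> X \<Longrightarrow> y \<in> X \<Longrightarrow>
          bdd_above ((\<lambda>u. \<bar>u x - u y\<bar> powr p / E u) ` (F - const_funs X))"
    and RF5: "\<And>(q::real) (r::ereal) m n (T :: (nat \<Rightarrow> real) \<Rightarrow> (nat \<Rightarrow> real)) u.
          0 < q \<Longrightarrow> q \<le> p \<Longrightarrow> ereal p \<le> r \<Longrightarrow> 0 < m \<Longrightarrow> 0 < n \<Longrightarrow>
          T \<in> real_funs {..<m} \<rightarrow> real_funs {..<n} \<Longrightarrow>
          T (\<lambda>j\<in>{..<m}. 0) = (\<lambda>k\<in>{..<n}. 0) \<Longrightarrow>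
          (\<forall>x\<in>real_funs {..<m}. \<forall>y\<in>real_funs {..<m}.
             lnorm r n (\<lambda>k. T x k - T y k) \<le> lnorm (ereal q) m (\<lambda>j. x j - y j)) \<Longrightarrow>
          (\<forall>j<m. u j \<in> F) \<Longrightarrow>
          (\<forall>k<n. (\<lambda>x\<in>X. T (\<lambda>j\<in>{..<m}. u j x) k) \<in> F) \<and>
          lnorm r n (\<lambda>k. E (\<lambda>x\<in>X. T (\<lambda>j\<in>{..<m}. u j x) k) powr (1 / p))
            \<le> lnorm (ereal q) m (\<lambda>j. E (u j) powr (1 / p))"

definition trace_form ::
  "(('a \<Rightarrow> real) \<Rightarrow> real) \<Rightarrow> ('a \<Rightarrow> real) set \<Rightarrow> 'a set \<Rightarrow> ('a \<Rightarrow> real) \<Rightarrow> real" where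
  "trace_form E F B u = Inf {E v | v. v \<in> F \<and> restrict v B = u}"


section \<open>The Sierpinski gasket\<close>

text \<open>The parameter \<open>q\<close> gives the vertices of the triangle; its values off \<open>S\<close> are irrelevant.\<close>

definition S :: "nat set" where
  "S = {1, 2, 3}"

definition equilateral :: "(nat \<Rightarrow> real ^ 2) \<Rightarrow> bool" where
  "equilateral q \<longleftrightarrow> (\<exists>d>0. \<forall>i\<in>S. \<forall>j\<in>S. i \<noteq> j \<longrightarrow> dist (q i) (q j) = d)"

definition sg_map :: "(nat \<Rightarrow> real ^ 2) \<Rightarrow> nat \<Rightarrow> real ^ 2 \<Rightarrow> real ^ 2" where
  "sg_map q i x = q i + (1 / 2) *\<^sub>R (x - q i)"

definition is_gasket :: "(nat \<Rightarrow> real ^ 2) \<Rightarrow> (real ^ 2) set \<Rightarrow> bool" where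
  "is_gasket q K \<longleftrightarrow> K \<noteq> {} \<and> compact K \<and> K = (\<Union>i\<in>S. sg_map q i ` K)"

definition words :: "nat \<Rightarrow> nat list set" where
  "words n = {w. length w = n \<and> set w \<subseteq> S}"

text \<open>
  \<open>F\<^sub>w\<close>, as a map on the whole plane; it maps the gasket into itself and is only used there.
\<close>

definition word_map :: "(nat \<Rightarrow> real ^ 2) \<Rightarrow> nat list \<Rightarrow> real ^ 2 \<Rightarrow> real ^ 2" where
  "word_map q w = foldr (\<lambda>i g. sg_map q i \<circ> g) w id"

definition V0 :: "(nat \<Rightarrow> real ^ 2) \<Rightarrow> (real ^ 2) set" where
  "V0 q = q ` S"

definition V :: "(nat \<Rightarrow> real ^ 2) \<Rightarrow> nat \<Rightarrow> (real ^ 2) set" where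
  "V q n = (\<Union>w\<in>words n. word_map q w ` V0 q)"

definition isometries :: "'a::metric_space set \<Rightarrow> ('a \<Rightarrow> 'a) set" where
  "isometries K = {g. bij_betw g K K \<and> (\<forall>x\<in>K. \<forall>y\<in>K. dist (g x) (g y) = dist x y)}"


section \<open>Self-similar energies\<close>

definition renorm ::
  "(nat \<Rightarrow> real ^ 2) \<Rightarrow> real \<Rightarrow> nat \<Rightarrow> ((real ^ 2 \<Rightarrow> real) \<Rightarrow> real) \<Rightarrow> (real ^ 2 \<Rightarrow> real) \<Rightarrow> real" where
  "renorm q \<rho> n E u = (\<Sum>w\<in>words n. \<rho> ^ n * E (restrict (u \<circ> word_map q w) (V0 q)))"

text \<open>
  \<open>E0\<close> is a form as chosen in the construction, with scaling constant \<open>\<rho>\<close>. A resistance form on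
  a finite set has all functions as its domain.
\<close>

definition sym_eigenform ::
  "real \<Rightarrow> (nat \<Rightarrow> real ^ 2) \<Rightarrow> (real ^ 2) set \<Rightarrow> real \<Rightarrow> ((real ^ 2 \<Rightarrow> real) \<Rightarrow> real) \<Rightarrow> bool" where
  "sym_eigenform p q K \<rho> E0 \<longleftrightarrow>
     resistance_form p (V0 q) E0 (real_funs (V0 q)) \<and>
     (\<forall>u\<in>real_funs (V0 q).
        trace_form (renorm q \<rho> 1 E0) (real_funs (V q 1)) (V0 q) u = E0 u) \<and>
     (\<forall>g\<in>isometries K. \<forall>u\<in>real_funs (V0 q). E0 (restrict (u \<circ> g) (V0 q)) = E0 u)"

text \<open>The limit is taken in the extended reals, where it exists by monotonicity in \<open>n\<close>.\<close>

definition energy_lim ::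
  "(nat \<Rightarrow> real ^ 2) \<Rightarrow> real \<Rightarrow> ((real ^ 2 \<Rightarrow> real) \<Rightarrow> real) \<Rightarrow> (real ^ 2 \<Rightarrow> real) \<Rightarrow> ereal" where
  "energy_lim q \<rho> E0 u = lim (\<lambda>n. ereal (renorm q \<rho> n E0 (restrict u (V q n))))"

definition sg_domain ::
  "(nat \<Rightarrow> real ^ 2) \<Rightarrow> (real ^ 2) set \<Rightarrow> real \<Rightarrow> ((real ^ 2 \<Rightarrow> real) \<Rightarrow> real) \<Rightarrow> (real ^ 2 \<Rightarrow> real) set"
  where
  "sg_domain q K \<rho> E0 = {u \<in> cont_funs K. energy_lim q \<rho> E0 u < \<infinity>}"

definition sg_energy ::
  "(nat \<Rightarrow> real ^ 2) \<Rightarrow> real \<Rightarrow> ((real ^ 2 \<Rightarrow> real) \<Rightarrow> real) \<Rightarrow> (real ^ 2 \<Rightarrow> real) \<Rightarrow> real" where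
  "sg_energy q \<rho> E0 u = real_of_ereal (energy_lim q \<rho> E0 u)"

end

theory Submission
  imports Defs
begin

text \<open>
  Restricting to the three vertices turns \<open>E0\<close> and the trace of \<open>E'\<close> into functions \<open>e\<close> and
  \<open>d\<close> of three real variables that both reproduce themselves under minimization over the values at
  the three midpoints. Let \<open>L\<close> be the maximum of \<open>d / e\<close>. If \<open>d = L * e\<close> holds for boundary
  values \<open>a, b, c\<close>, it also holds for the values of the \<open>e\<close>-minimizer on each of the three cells, and
  the same is true of the minimum of \<open>d / e\<close>. Zooming in at a vertex where the boundary values are
  extremal makes the other two values equal in the limit, so the maximum is attained at the
  indicators of at least two vertices, and so is the minimum. The two pairs have a vertex in common,
  whence \<open>d = c * e\<close>.

  Gluing functions on cells then yields, for \<open>u\<close> of finite energy, functions in \<open>F'\<close> that agree with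
  \<open>u\<close> on the level-\<open>n\<close> vertices and have \<open>E'\<close>-energy close to \<open>c\<close> times the level-\<open>n\<close> energy
  of \<open>u\<close>. The Clarkson-type inequalities contained in \<open>RF5\<close> make them a Cauchy sequence, and
  completeness gives \<open>u\<close> itself as its limit.
\<close>

section \<open>Inequalities for real powers\<close>

lemma powr_le_tangent:
  fixes z q :: real
  assumes "0 \<le> z" "0 < q" "q \<le> 1"
  shows "z powr q \<le> 1 + q * (z - 1)"
proof (cases "z = 0 \<or> q = 1")
  case False
  then show ?thesis
    using Youngs_inequality_0[of q "1 - q" z 1] assms by (simp add: algebra_simps)
qed (use assms in auto)

lemma powr_ge_tangent:
  fixes z q :: real
  assumes "0 \<le> z" "1 \<le> q"
  shows "1 + q * (z - 1) \<le> z powr q"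
proof -
  have "z = (z powr q) powr (1 / q)"
    using assms by (simp add: powr_powr)
  also have "\<dots> \<le> 1 + (1 / q) * (z powr q - 1)"
    using assms by (intro powr_le_tangent) auto
  finally have "q * z \<le> q * (1 + (1 / q) * (z powr q - 1))"
    using assms by (intro mult_left_mono) auto
  also have "\<dots> = q + (z powr q - 1)"
    using assms by (simp add: field_simps)
  finally show ?thesis by (simp add: algebra_simps)
qed

lemma convex_abs_powr:
  fixes q :: real
  assumes q: "1 \<le> q"
  shows "convex_on UNIV (\<lambda>x::real. \<bar>x\<bar> powr q)"
proof
  fix t x y :: real
  assume t: "0 < t" "t < 1"
  define m where "m = (1 - t) * \<bar>x\<bar> + t * \<bar>y\<bar>"
  have m0: "0 \<le> m" using t by (simp add: m_def)
  have "\<bar>(1 - t) *\<^sub>R x + t *\<^sub>R y\<bar> \<le> \<bar>(1 - t) * x\<bar> + \<bar>t * y\<bar>"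
    by simp
  also have "\<dots> = m" using t by (simp add: m_def abs_mult)
  finally have 1: "\<bar>(1 - t) *\<^sub>R x + t *\<^sub>R y\<bar> powr q \<le> m powr q"
    using q by (intro powr_mono2) auto
  have "m powr q \<le> (1 - t) * \<bar>x\<bar> powr q + t * \<bar>y\<bar> powr q"
  proof (cases "m = 0")
    case True
    then show ?thesis using t q by simp
  next
    case False
    then have m: "0 < m" using m0 by simp
    have tan: "m powr q * (1 + q * (z / m - 1)) \<le> z powr q" if "0 \<le> z" for z
    proof -
      have "m powr q * (1 + q * (z / m - 1)) \<le> m powr q * (z / m) powr q"
        using that m q by (intro mult_left_mono powr_ge_tangent) auto
      also have "\<dots> = z powr q"
        using that m by (simp add: powr_divide)
      finally show ?thesis .
    qed
    have "(1 - t) * (\<bar>x\<bar> / m) + t * (\<bar>y\<bar> / m) = m / m"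
      by (simp only: m_def add_divide_distrib times_divide_eq_right)
    then have e: "(1 - t) * (\<bar>x\<bar> / m) + t * (\<bar>y\<bar> / m) = 1"
      using m by simp
    have "m powr q = m powr q * (1 + q * (((1 - t) * (\<bar>x\<bar> / m) + t * (\<bar>y\<bar> / m)) - 1))"
      unfolding e by simp
    also have "\<dots> = (1 - t) * (m powr q * (1 + q * (\<bar>x\<bar> / m - 1))) + t * (m powr q * (1 + q * (\<bar>y\<bar> / m - 1)))"
      by algebra
    also have "\<dots> \<le> (1 - t) * \<bar>x\<bar> powr q + t * \<bar>y\<bar> powr q"
      using t by (intro add_mono mult_left_mono tan) auto
    finally show ?thesis .
  qed
  with 1 show "\<bar>(1 - t) *\<^sub>R x + t *\<^sub>R y\<bar> powr q \<le> (1 - t) * \<bar>x\<bar> powr q + t * \<bar>y\<bar> powr q"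
    by simp
qed simp

lemma convex_on_same_sum_le:
  fixes f :: "real \<Rightarrow> real"
  assumes "convex_on UNIV f" "a + b = c + d" "c \<le> a" "a \<le> d"
  shows "f a + f b \<le> f c + f d"
proof (cases "c = d")
  case False
  define t where "t = (a - c) / (d - c)"
  have t: "0 \<le> t" "t \<le> 1" using assms False by (auto simp: t_def divide_simps)
  have td: "t * (d - c) = a - c" using False by (simp add: t_def)
  have a: "a = (1 - t) * c + t * d" using td by (simp add: algebra_simps)
  have b: "b = t * c + (1 - t) * d" using td assms(2) by (simp add: algebra_simps)
  have "f a \<le> (1 - t) * f c + t * f d"
    using convex_onD[OF assms(1) t, of c d] a by simp
  moreover have "f b \<le> t * f c + (1 - t) * f d"
    using convex_onD[OF assms(1), of "1 - t" c d] t b by simp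
  ultimately show ?thesis by (simp add: algebra_simps)
next
  case True
  then have "a = c" "b = d" using assms by auto
  then show ?thesis by simp
qed

lemma min_max_powr_le:
  fixes x y x' y' q :: real
  assumes q: "1 \<le> q"
  shows "\<bar>min x y - min x' y'\<bar> powr q + \<bar>max x y - max x' y'\<bar> powr q
    \<le> \<bar>x - x'\<bar> powr q + \<bar>y - y'\<bar> powr q"
proof -
  have *: "\<bar>x - y'\<bar> powr q + \<bar>y - x'\<bar> powr q \<le> \<bar>x - x'\<bar> powr q + \<bar>y - y'\<bar> powr q"
    if "x \<le> y" "y' \<le> x'" for x y x' y'
    using that by (intro convex_on_same_sum_le[OF convex_abs_powr[OF q]]) auto
  show ?thesis
  proof (cases "x \<le> y")
    case True
    then show ?thesis using *[of x y y' x'] by (cases "x' \<le> y'") (auto simp: min_def max_def)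
  next
    case False
    then show ?thesis using *[of y x x' y'] by (cases "x' \<le> y'") (auto simp: min_def max_def)
  qed
qed

lemma powr_superadditive:
  fixes a b q :: real
  assumes "0 \<le> a" "0 \<le> b" "1 \<le> q"
  shows "a powr q + b powr q \<le> (a + b) powr q"
proof -
  have *: "z powr q = z * z powr (q - 1)" if "0 \<le> z" for z :: real
    using that by (cases "z = 0") (auto simp: powr_diff)
  have "a powr q + b powr q = a * a powr (q - 1) + b * b powr (q - 1)"
    using assms * by simp
  also have "\<dots> \<le> a * (a + b) powr (q - 1) + b * (a + b) powr (q - 1)"
    using assms by (intro add_mono mult_left_mono powr_mono2) auto
  also have "\<dots> = (a + b) powr q"
    using assms *[of "a + b"] by (simp add: algebra_simps)
  finally show ?thesis .
qed

lemma clarkson_scalar: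
  fixes x y p :: real
  assumes p: "2 \<le> p"
  shows "\<bar>(x + y) / 2\<bar> powr p + \<bar>(x - y) / 2\<bar> powr p \<le> (\<bar>x\<bar> powr p + \<bar>y\<bar> powr p) / 2"
proof -
  have sq: "(z\<^sup>2) powr (p / 2) = \<bar>z\<bar> powr p" for z :: real
  proof (cases "z = 0")
    case False
    then have "z\<^sup>2 = \<bar>z\<bar> powr 2" by simp
    then have "(z\<^sup>2) powr (p / 2) = (\<bar>z\<bar> powr 2) powr (p / 2)" by (rule arg_cong)
    then show ?thesis by (simp only: powr_powr) simp
  qed simp
  have "\<bar>(x + y) / 2\<bar> powr p + \<bar>(x - y) / 2\<bar> powr p
      = (((x + y) / 2)\<^sup>2) powr (p / 2) + (((x - y) / 2)\<^sup>2) powr (p / 2)"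
    by (simp only: sq)
  also have "\<dots> \<le> (((x + y) / 2)\<^sup>2 + ((x - y) / 2)\<^sup>2) powr (p / 2)"
    using p by (intro powr_superadditive) auto
  also have "((x + y) / 2)\<^sup>2 + ((x - y) / 2)\<^sup>2 = (1 - 1/2) *\<^sub>R x\<^sup>2 + (1/2) *\<^sub>R y\<^sup>2"
    by (simp add: power2_eq_square field_simps)
  also have "((1 - 1/2) *\<^sub>R x\<^sup>2 + (1/2) *\<^sub>R y\<^sup>2) powr (p / 2)
      \<le> (1 - 1/2) * (x\<^sup>2) powr (p / 2) + (1/2) * (y\<^sup>2) powr (p / 2)"
    using convex_onD[OF convex_abs_powr[of "p/2"], of "1/2" "x\<^sup>2" "y\<^sup>2"] p by simp
  finally show ?thesis by (simp only: sq) simp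
qed

lemma two_point_powr_ge:
  fixes t p :: real
  assumes t: "0 \<le> t" "t \<le> 1" and p: "1 < p" "p < 2"
  shows "2 + p * (p - 1) * t\<^sup>2 \<le> (1 + t) powr p + (1 - t) powr p"
proof -
  define g where "g = (\<lambda>t::real. (1 + t) powr (p - 1) - (1 - t) powr (p - 1) - 2 * (p - 1) * t)"
  have g: "0 \<le> g s" if s: "0 \<le> s" "s < 1" for s
  proof -
    have "g 0 \<le> g s"
    proof (rule DERIV_nonneg_imp_nondecreasing[OF s(1)])
      fix x assume x: "0 \<le> x" "x \<le> s"
      let ?u = "(1 + x) powr (p - 2)" and ?v = "(1 - x) powr (p - 2)"
      have "(g has_real_derivative (p - 1) * ?u + (p - 1) * ?v - 2 * (p - 1)) (at x)"
        unfolding g_def using x s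
        by (auto intro!: derivative_eq_intros simp: algebra_simps)
      moreover have "0 \<le> (p - 1) * ?u + (p - 1) * ?v - 2 * (p - 1)"
      proof -
        have "1 = 1 powr (p - 2)" by simp
        also have "\<dots> \<le> ((1 + x) * (1 - x)) powr (p - 2)"
        proof (rule powr_mono2')
          show "0 < (1 + x) * (1 - x)" using x s by (intro mult_pos_pos) auto
        qed (use p x in \<open>auto simp: algebra_simps\<close>)
        also have "\<dots> = ?u * ?v"
          using x s by (simp add: powr_mult)
        finally have "1 \<le> ?u * ?v" .
        moreover have "0 \<le> (?u - ?v)\<^sup>2" by simp
        ultimately have "2\<^sup>2 \<le> (?u + ?v)\<^sup>2" by (simp add: power2_eq_square algebra_simps)
        then have "2 \<le> ?u + ?v" by (rule power2_le_imp_le) simp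
        then have "0 \<le> (p - 1) * (?u + ?v - 2)" using p by simp
        then show ?thesis by (simp add: algebra_simps)
      qed
      ultimately show "\<exists>y. (g has_real_derivative y) (at x) \<and> 0 \<le> y" by blast
    qed
    then show ?thesis by (simp add: g_def)
  qed
  define f where "f = (\<lambda>t::real. (1 + t) powr p + (1 - t) powr p - p * (p - 1) * t\<^sup>2)"
  have "f 0 \<le> f t"
  proof (rule DERIV_nonneg_imp_increasing_open[OF t(1)])
    fix x assume x: "0 < x" "x < t"
    have "(f has_real_derivative p * (1 + x) powr (p - 1) - p * (1 - x) powr (p - 1) - p * (p - 1) * (2 * x)) (at x)"
      unfolding f_def using x t by (auto intro!: derivative_eq_intros)
    then have "(f has_real_derivative p * g x) (at x)"
      by (simp add: g_def algebra_simps)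
    moreover have "0 \<le> p * g x" using g[of x] x t p by simp
    ultimately show "\<exists>y. (f has_real_derivative y) (at x) \<and> 0 \<le> y" by blast
  next
    show "continuous_on {0..t} f"
      unfolding f_def using p t by (intro continuous_intros continuous_on_powr') auto
  qed
  then show ?thesis by (simp add: f_def)
qed

lemma bonami_scalar:
  fixes x y p :: real
  assumes p: "1 < p" "p < 2"
  shows "((x + y) / 2)\<^sup>2 + (p - 1) * ((x - y) / 2)\<^sup>2 \<le> ((\<bar>x\<bar> powr p + \<bar>y\<bar> powr p) / 2) powr (2 / p)"
proof -
  have one: "1 + (p - 1) * t\<^sup>2 \<le> ((\<bar>1 + t\<bar> powr p + \<bar>1 - t\<bar> powr p) / 2) powr (2 / p)"
    if t: "0 \<le> t" "t \<le> 1" for t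
  proof -
    have pos: "0 < 1 + (p - 1) * t\<^sup>2" using p by (simp add: add_pos_nonneg)
    have "(1 + (p - 1) * t\<^sup>2) powr (p / 2) \<le> 1 + (p / 2) * ((1 + (p - 1) * t\<^sup>2) - 1)"
      using p pos by (intro powr_le_tangent) auto
    also have "\<dots> \<le> (\<bar>1 + t\<bar> powr p + \<bar>1 - t\<bar> powr p) / 2"
      using two_point_powr_ge[OF t p] t by (simp add: algebra_simps)
    finally have "((1 + (p - 1) * t\<^sup>2) powr (p / 2)) powr (2 / p)
        \<le> ((\<bar>1 + t\<bar> powr p + \<bar>1 - t\<bar> powr p) / 2) powr (2 / p)"
      using p by (intro powr_mono2) auto
    then show ?thesis using p pos by (simp add: powr_powr)
  qed
  have two: "s\<^sup>2 + (p - 1) * d\<^sup>2 \<le> ((\<bar>s + d\<bar> powr p + \<bar>s - d\<bar> powr p) / 2) powr (2 / p)"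
    if d: "0 \<le> d" "d \<le> s" for s d
  proof (cases "s = 0")
    case False
    then have s: "0 < s" using d by simp
    have "s\<^sup>2 + (p - 1) * d\<^sup>2 = s\<^sup>2 * (1 + (p - 1) * (d / s)\<^sup>2)"
      using s by (simp add: field_simps power2_eq_square)
    also have "\<dots> \<le> s\<^sup>2 * ((\<bar>1 + d / s\<bar> powr p + \<bar>1 - d / s\<bar> powr p) / 2) powr (2 / p)"
      using s d by (intro mult_left_mono one) auto
    also have "\<dots> = (s powr p) powr (2 / p) * ((\<bar>1 + d / s\<bar> powr p + \<bar>1 - d / s\<bar> powr p) / 2) powr (2 / p)"
      using s p by (simp add: powr_powr)
    also have "(s powr p) powr (2 / p) * ((\<bar>1 + d / s\<bar> powr p + \<bar>1 - d / s\<bar> powr p) / 2) powr (2 / p)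
      = (s powr p * ((\<bar>1 + d / s\<bar> powr p + \<bar>1 - d / s\<bar> powr p) / 2)) powr (2 / p)"
      by (rule powr_mult[symmetric])
    also have "s powr p * ((\<bar>1 + d / s\<bar> powr p + \<bar>1 - d / s\<bar> powr p) / 2)
      = ((s * \<bar>1 + d / s\<bar>) powr p + (s * \<bar>1 - d / s\<bar>) powr p) / 2"
      using s by (simp add: powr_mult algebra_simps)
    also have "s * \<bar>1 + d / s\<bar> = \<bar>s + d\<bar>" using s d by (simp add: field_simps)
    also have "s * \<bar>1 - d / s\<bar> = \<bar>s - d\<bar>" using s d by (simp add: field_simps)
    finally show ?thesis .
  qed (use d in auto)
  have three: "s\<^sup>2 + (p - 1) * d\<^sup>2 \<le> ((\<bar>s + d\<bar> powr p + \<bar>s - d\<bar> powr p) / 2) powr (2 / p)"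
    if d: "\<bar>d\<bar> \<le> \<bar>s\<bar>" for s d
  proof -
    have "\<bar>s + d\<bar> powr p + \<bar>s - d\<bar> powr p = \<bar>\<bar>s\<bar> + \<bar>d\<bar>\<bar> powr p + \<bar>\<bar>s\<bar> - \<bar>d\<bar>\<bar> powr p"
    proof -
      have "(\<bar>s + d\<bar> = \<bar>\<bar>s\<bar> + \<bar>d\<bar>\<bar> \<and> \<bar>s - d\<bar> = \<bar>\<bar>s\<bar> - \<bar>d\<bar>\<bar>) \<or>
        (\<bar>s - d\<bar> = \<bar>\<bar>s\<bar> + \<bar>d\<bar>\<bar> \<and> \<bar>s + d\<bar> = \<bar>\<bar>s\<bar> - \<bar>d\<bar>\<bar>)" by arith
      then show ?thesis by auto
    qed
    then show ?thesis using two[of "\<bar>d\<bar>" "\<bar>s\<bar>"] d by simp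
  qed
  define s d where "s = (x + y) / 2" and "d = (x - y) / 2"
  have xy: "x = s + d" "y = s - d" by (simp_all add: s_def d_def field_simps)
  show ?thesis
  proof (cases "\<bar>d\<bar> \<le> \<bar>s\<bar>")
    case True
    show ?thesis using three[OF True] unfolding s_def[symmetric] d_def[symmetric] by (simp add: xy)
  next
    case False
    have "s\<^sup>2 \<le> d\<^sup>2" using False by (simp add: abs_le_square_iff[symmetric])
    then have "0 \<le> (2 - p) * (d\<^sup>2 - s\<^sup>2)" using p by simp
    then have "s\<^sup>2 + (p - 1) * d\<^sup>2 \<le> d\<^sup>2 + (p - 1) * s\<^sup>2" by (simp add: algebra_simps)
    also have "\<dots> \<le> ((\<bar>d + s\<bar> powr p + \<bar>d - s\<bar> powr p) / 2) powr (2 / p)"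
      using three[of s d] False by simp
    finally show ?thesis unfolding s_def[symmetric] d_def[symmetric]
      by (simp add: xy add.commute abs_minus_commute)
  qed
qed

section \<open>Resistance forms with exponent greater than one\<close>

lemma lnorm_two:
  "lnorm (ereal s) 2 x = (\<bar>x 0\<bar> powr s + \<bar>x 1\<bar> powr s) powr (1 / s)"
  by (simp add: lnorm_def numeral_2_eq_2)

locale resistance_form_gt_1 = resistance_form +
  assumes p_gt_1: "1 < p"
begin

lemma p_pos: "0 < p" using p_gt_1 by simp

lemma const_mem: "(\<lambda>x\<in>X. c) \<in> F" and E_const: "E (\<lambda>x\<in>X. c) = 0"
proof -
  have "(\<lambda>x\<in>X. c) \<in> const_funs X" by (auto simp: const_funs_def)
  then show "(\<lambda>x\<in>X. c) \<in> F" "E (\<lambda>x\<in>X. c) = 0" using RF1_kernel by auto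
qed

lemma E_zero_iff: "u \<in> F \<Longrightarrow> E u = 0 \<longleftrightarrow> u \<in> const_funs X"
  using RF1_kernel by auto

lemma E_zero_const:
  assumes "u \<in> F" "E u = 0" "x \<in> X" "y \<in> X"
  shows "u x = u y"
  using E_zero_iff[OF assms(1)] assms by (auto simp: const_funs_def)

lemma mem_extensional: "u \<in> F \<Longrightarrow> u \<in> extensional X"
  using funs by auto

lemma lincomb_mem:
  assumes "u \<in> F" "v \<in> F"
  shows "(\<lambda>x\<in>X. a * u x + b * v x + c) \<in> F"
proof -
  have "(\<lambda>x\<in>X. (\<lambda>x\<in>X. (\<lambda>x\<in>X. a * u x) x + (\<lambda>x\<in>X. b * v x) x) x + (\<lambda>x\<in>X. c) x) \<in> F"
    using assms by (intro add_mem scale_mem const_mem)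
  moreover have "(\<lambda>x\<in>X. (\<lambda>x\<in>X. (\<lambda>x\<in>X. a * u x) x + (\<lambda>x\<in>X. b * v x) x) x + (\<lambda>x\<in>X. c) x)
    = (\<lambda>x\<in>X. a * u x + b * v x + c)" by auto
  ultimately show ?thesis by simp
qed

lemma diff_mem: "u \<in> F \<Longrightarrow> v \<in> F \<Longrightarrow> (\<lambda>x\<in>X. u x - v x) \<in> F"
  using lincomb_mem[of u v 1 "-1" 0] by simp

lemma affine_mem: "u \<in> F \<Longrightarrow> (\<lambda>x\<in>X. a * u x + c) \<in> F"
  using lincomb_mem[of u u a 0 c] by simp

lemma powr_p_inverse: "0 \<le> z \<Longrightarrow> (z powr (1 / p)) powr p = z"
  using p_pos by (simp add: powr_powr)

lemma E_scale:
  assumes "u \<in> F"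
  shows "E (\<lambda>x\<in>X. a * u x) = \<bar>a\<bar> powr p * E u"
proof -
  have "E (\<lambda>x\<in>X. a * u x) = (E (\<lambda>x\<in>X. a * u x) powr (1 / p)) powr p"
    using assms nonneg scale_mem powr_p_inverse by simp
  also have "\<dots> = \<bar>a\<bar> powr p * E u"
    using assms by (simp add: RF1_scale powr_mult powr_p_inverse nonneg)
  finally show ?thesis .
qed

lemma E_add_const:
  assumes u: "u \<in> F"
  shows "E (\<lambda>x\<in>X. u x + c) = E u"
proof -
  have le: "E (\<lambda>x\<in>X. v x + c) \<le> E v" if v: "v \<in> F" for v c
  proof -
    have m: "(\<lambda>x\<in>X. v x + c) \<in> F" using affine_mem[OF v, of 1] by simp
    have "(\<lambda>x\<in>X. v x + (\<lambda>x\<in>X. c) x) = (\<lambda>x\<in>X. v x + c)" by auto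
    with RF1_triangle[OF v const_mem[of c]]
    have "E (\<lambda>x\<in>X. v x + c) powr (1 / p) \<le> E v powr (1 / p)"
      by (simp add: E_const)
    then have "(E (\<lambda>x\<in>X. v x + c) powr (1 / p)) powr p \<le> (E v powr (1 / p)) powr p"
      using p_pos by - (rule powr_mono2, auto)
    then show ?thesis unfolding powr_p_inverse[OF nonneg[OF m]] powr_p_inverse[OF nonneg[OF v]] .
  qed
  have m: "(\<lambda>x\<in>X. u x + c) \<in> F" using affine_mem[OF u, of 1] by simp
  have "(\<lambda>x\<in>X. (\<lambda>x\<in>X. u x + c) x + (- c)) = restrict u X" by auto
  also have "\<dots> = u" using mem_extensional[OF u] by (rule extensional_restrict)
  finally have "E u \<le> E (\<lambda>x\<in>X. u x + c)" using le[OF m, of "- c"] by simp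
  with le[OF u] show ?thesis by (simp add: antisym)
qed

lemma E_affine: "u \<in> F \<Longrightarrow> E (\<lambda>x\<in>X. a * u x + c) = \<bar>a\<bar> powr p * E u"
proof -
  assume u: "u \<in> F"
  have "(\<lambda>x\<in>X. a * u x + c) = (\<lambda>x\<in>X. (\<lambda>x\<in>X. a * u x) x + c)" by auto
  then show ?thesis using E_add_const[OF scale_mem[OF u]] E_scale[OF u] by simp
qed

lemma E_diff_commute:
  assumes "u \<in> F" "v \<in> F"
  shows "E (\<lambda>x\<in>X. u x - v x) = E (\<lambda>x\<in>X. v x - u x)"
proof -
  have "(\<lambda>x\<in>X. u x - v x) = (\<lambda>x\<in>X. (-1) * (\<lambda>x\<in>X. v x - u x) x)" by auto
  then show ?thesis using E_scale[OF diff_mem[OF assms(2,1)], of "-1"] by simp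
qed

lemma RF5_pair:
  fixes r :: real and g h :: "real \<Rightarrow> real \<Rightarrow> real"
  assumes r: "p \<le> r" and z: "g 0 0 = 0" "h 0 0 = 0"
    and L: "\<And>x y x' y'. \<bar>g x y - g x' y'\<bar> powr r + \<bar>h x y - h x' y'\<bar> powr r
      \<le> (\<bar>x - x'\<bar> powr p + \<bar>y - y'\<bar> powr p) powr (r / p)"
    and u: "u \<in> F" and v: "v \<in> F"
  shows "(\<lambda>x\<in>X. g (u x) (v x)) \<in> F" "(\<lambda>x\<in>X. h (u x) (v x)) \<in> F"
    "E (\<lambda>x\<in>X. g (u x) (v x)) powr (r / p) + E (\<lambda>x\<in>X. h (u x) (v x)) powr (r / p)
      \<le> (E u + E v) powr (r / p)"
proof -
  define T where "T = (\<lambda>x::nat \<Rightarrow> real. \<lambda>k\<in>{..<2::nat}. if k = 0 then g (x 0) (x 1) else h (x 0) (x 1))"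
  define w where "w = (\<lambda>j::nat. if j = 0 then u else v)"
  have r0: "0 < r" using r p_pos by simp
  have 1: "T \<in> extensional {..<2} \<rightarrow> extensional {..<2}"
    by (auto simp: T_def)
  have 2: "T (\<lambda>j\<in>{..<2}. 0) = (\<lambda>k\<in>{..<2}. 0)"
    using z by (auto simp: T_def)
  have 3: "lnorm (ereal r) 2 (\<lambda>k. T x k - T y k) \<le> lnorm (ereal p) 2 (\<lambda>j. x j - y j)" for x y
  proof -
    have "(\<bar>g (x 0) (x 1) - g (y 0) (y 1)\<bar> powr r + \<bar>h (x 0) (x 1) - h (y 0) (y 1)\<bar> powr r) powr (1 / r)
      \<le> ((\<bar>x 0 - y 0\<bar> powr p + \<bar>x 1 - y 1\<bar> powr p) powr (r / p)) powr (1 / r)"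
      using r0 by (intro powr_mono2 L) auto
    then show ?thesis using r0 by (simp add: lnorm_two T_def powr_powr)
  qed
  have 4: "\<forall>j<2. w j \<in> F" using u v by (auto simp: w_def)
  note R = RF5[of p "ereal r" 2 2 T w, OF p_pos order_refl _ _ _ 1 2 _ 4]
  have g: "(\<lambda>x\<in>X. T (\<lambda>j\<in>{..<2}. w j x) 0) = (\<lambda>x\<in>X. g (u x) (v x))"
    by (auto simp: T_def w_def)
  have h: "(\<lambda>x\<in>X. T (\<lambda>j\<in>{..<2}. w j x) 1) = (\<lambda>x\<in>X. h (u x) (v x))"
    by (auto simp: T_def w_def)
  have M: "\<And>k. k < 2 \<Longrightarrow> (\<lambda>x\<in>X. T (\<lambda>j\<in>{..<2}. w j x) k) \<in> F"
    and N: "lnorm (ereal r) 2 (\<lambda>k. E (\<lambda>x\<in>X. T (\<lambda>j\<in>{..<2}. w j x) k) powr (1 / p))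
            \<le> lnorm (ereal p) 2 (\<lambda>j. E (w j) powr (1 / p))"
    using R r 3 by auto
  show gF: "(\<lambda>x\<in>X. g (u x) (v x)) \<in> F" using M[of 0] g by simp
  show hF: "(\<lambda>x\<in>X. h (u x) (v x)) \<in> F" using M[of 1] h by simp
  have "(E (\<lambda>x\<in>X. g (u x) (v x)) powr (r / p) + E (\<lambda>x\<in>X. h (u x) (v x)) powr (r / p)) powr (1 / r)
    \<le> (E u + E v) powr (1 / p)"
    using N nonneg[OF u] nonneg[OF v] p_pos
    by (simp only: lnorm_two g h) (simp add: w_def powr_powr)
  then have "((E (\<lambda>x\<in>X. g (u x) (v x)) powr (r / p) + E (\<lambda>x\<in>X. h (u x) (v x)) powr (r / p)) powr (1 / r)) powr r
    \<le> ((E u + E v) powr (1 / p)) powr r"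
    using r0 by (intro powr_mono2) auto
  then show "E (\<lambda>x\<in>X. g (u x) (v x)) powr (r / p) + E (\<lambda>x\<in>X. h (u x) (v x)) powr (r / p)
      \<le> (E u + E v) powr (r / p)"
    using r0 by (simp add: powr_powr)
qed

lemma min_max:
  assumes "u \<in> F" "v \<in> F"
  shows min_mem: "(\<lambda>x\<in>X. min (u x) (v x)) \<in> F" and max_mem: "(\<lambda>x\<in>X. max (u x) (v x)) \<in> F"
    and E_submodular: "E (\<lambda>x\<in>X. min (u x) (v x)) + E (\<lambda>x\<in>X. max (u x) (v x)) \<le> E u + E v"
proof -
  have L: "\<bar>min x y - min x' y'\<bar> powr p + \<bar>max x y - max x' y'\<bar> powr p
      \<le> (\<bar>x - x'\<bar> powr p + \<bar>y - y'\<bar> powr p) powr (p / p)" for x y x' y' :: real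
    using min_max_powr_le[of p x y x' y'] p_gt_1 by simp
  note R = RF5_pair[of p min max, OF order_refl _ _ L assms]
  show m: "(\<lambda>x\<in>X. min (u x) (v x)) \<in> F" "(\<lambda>x\<in>X. max (u x) (v x)) \<in> F"
    using R(1,2) by simp_all
  show "E (\<lambda>x\<in>X. min (u x) (v x)) + E (\<lambda>x\<in>X. max (u x) (v x)) \<le> E u + E v"
    using R(3) m assms nonneg p_pos by simp
qed

lemma clip:
  assumes u: "u \<in> F" and lh: "l \<le> h"
  shows clip_mem: "(\<lambda>x\<in>X. max l (min h (u x))) \<in> F"
    and E_clip: "E (\<lambda>x\<in>X. max l (min h (u x))) \<le> E u"
proof -
  define v where "v = (\<lambda>x\<in>X. u x + (- l))"
  have v: "v \<in> F" using affine_mem[OF u, of 1 "- l"] by (simp add: v_def)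
  define w where "w = (\<lambda>x\<in>X. max 0 (min (h - l) (v x)))"
  have L: "\<bar>max 0 (min (h - l) x) - max 0 (min (h - l) x')\<bar> powr p + \<bar>0 - 0\<bar> powr p
      \<le> (\<bar>x - x'\<bar> powr p + \<bar>y - y'\<bar> powr p) powr (p / p)" for x y x' y' :: real
  proof -
    have "\<bar>max 0 (min (h - l) x) - max 0 (min (h - l) x')\<bar> powr p \<le> \<bar>x - x'\<bar> powr p"
      using p_pos by (intro powr_mono2) auto
    then show ?thesis using p_pos by (simp add: add_increasing2)
  qed
  note R = RF5_pair[of p "\<lambda>x y. max 0 (min (h - l) x)" "\<lambda>x y. 0", OF order_refl _ _ L v const_mem[of 0]]
  have wF: "w \<in> F" using R(1) lh by (simp add: w_def)
  have "E w \<le> E v" using R(3) lh p_pos nonneg[OF wF] nonneg[OF v] by (simp add: w_def E_const)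
  also have "E v = E u" unfolding v_def by (rule E_add_const[OF u])
  finally have "E (\<lambda>x\<in>X. w x + l) \<le> E u" using E_add_const[OF wF] by simp
  moreover have "(\<lambda>x\<in>X. w x + l) = (\<lambda>x\<in>X. max l (min h (u x)))"
    by (auto simp: w_def v_def max_def min_def)
  moreover have "(\<lambda>x\<in>X. w x + l) \<in> F" using affine_mem[OF wF, of 1 l] by simp
  ultimately show "(\<lambda>x\<in>X. max l (min h (u x))) \<in> F" "E (\<lambda>x\<in>X. max l (min h (u x))) \<le> E u" by simp_all
qed

lemma E_clarkson:
  assumes p2: "2 \<le> p" and u: "u \<in> F" and v: "v \<in> F"
  shows "E (\<lambda>x\<in>X. (u x + v x) / 2) + E (\<lambda>x\<in>X. (u x - v x) / 2) \<le> (E u + E v) / 2"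
proof -
  define k where "k = 2 powr (1 / p)"
  have k: "k powr p = 2" "0 < k" using p_pos by (auto simp: k_def powr_powr)
  let ?g = "\<lambda>x y::real. k * ((x + y) / 2)" and ?h = "\<lambda>x y::real. k * ((x - y) / 2)"
  have L: "\<bar>?g x y - ?g x' y'\<bar> powr p + \<bar>?h x y - ?h x' y'\<bar> powr p
      \<le> (\<bar>x - x'\<bar> powr p + \<bar>y - y'\<bar> powr p) powr (p / p)" for x y x' y' :: real
  proof -
    have e: "?g x y - ?g x' y' = k * (((x - x') + (y - y')) / 2)"
      "?h x y - ?h x' y' = k * (((x - x') - (y - y')) / 2)" by (simp_all add: field_simps)
    have m: "\<bar>k * z\<bar> powr p = 2 * \<bar>z\<bar> powr p" for z using k by (simp add: abs_mult powr_mult)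
    show ?thesis
      unfolding e m using clarkson_scalar[OF p2, of "x - x'" "y - y'"] p_pos
      by (simp del: abs_divide)
  qed
  note R = RF5_pair[of p ?g ?h, OF order_refl _ _ L u v]
  have m: "(\<lambda>x\<in>X. (u x + v x) / 2) \<in> F" "(\<lambda>x\<in>X. (u x - v x) / 2) \<in> F"
    using lincomb_mem[OF u v, of "1/2" "1/2" 0] lincomb_mem[OF u v, of "1/2" "-1/2" 0]
    by (simp_all add: field_simps cong: restrict_cong)
  have e: "(\<lambda>x\<in>X. ?g (u x) (v x)) = (\<lambda>x\<in>X. k * (\<lambda>x\<in>X. (u x + v x) / 2) x)"
    "(\<lambda>x\<in>X. ?h (u x) (v x)) = (\<lambda>x\<in>X. k * (\<lambda>x\<in>X. (u x - v x) / 2) x)" by auto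
  have "E (\<lambda>x\<in>X. ?g (u x) (v x)) + E (\<lambda>x\<in>X. ?h (u x) (v x)) \<le> E u + E v"
    using R u v nonneg p_pos by simp
  then show ?thesis
    unfolding e E_scale[OF m(1)] E_scale[OF m(2)] using k by simp
qed

lemma E_bonami:
  assumes p2: "p < 2" and u: "u \<in> F" and v: "v \<in> F"
  shows "E (\<lambda>x\<in>X. (u x + v x) / 2) powr (2 / p) + (p - 1) * E (\<lambda>x\<in>X. (u x - v x) / 2) powr (2 / p)
    \<le> ((E u + E v) / 2) powr (2 / p)"
proof -
  define k where "k = 2 powr (1 / p)"
  have k0: "0 < k" by (simp add: k_def)
  have k2: "k\<^sup>2 = 2 powr (2 / p)"
    using k0 by (simp add: k_def powr_powr flip: powr_numeral)
  define c where "c = sqrt (p - 1)"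
  have c: "c\<^sup>2 = p - 1" "0 \<le> c" using p_gt_1 by (simp_all add: c_def)
  let ?g = "\<lambda>x y::real. k * ((x + y) / 2)" and ?h = "\<lambda>x y::real. (k * c) * ((x - y) / 2)"
  have sq: "\<bar>z\<bar> powr 2 = z\<^sup>2" for z :: real
    by (cases "z = 0") (auto simp: powr_numeral)
  have L: "\<bar>?g x y - ?g x' y'\<bar> powr 2 + \<bar>?h x y - ?h x' y'\<bar> powr 2
      \<le> (\<bar>x - x'\<bar> powr p + \<bar>y - y'\<bar> powr p) powr (2 / p)" for x y x' y' :: real
  proof -
    define a b where "a = x - x'" and "b = y - y'"
    have e: "?g x y - ?g x' y' = k * ((a + b) / 2)"
      "?h x y - ?h x' y' = (k * c) * ((a - b) / 2)" by (simp_all add: a_def b_def field_simps)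
    have "\<bar>?g x y - ?g x' y'\<bar> powr 2 + \<bar>?h x y - ?h x' y'\<bar> powr 2
      = k\<^sup>2 * (((a + b) / 2)\<^sup>2 + (p - 1) * ((a - b) / 2)\<^sup>2)"
      unfolding e sq c(1)[symmetric] by (simp only: power_mult_distrib distrib_left ac_simps)
    also have "\<dots> \<le> k\<^sup>2 * ((\<bar>a\<bar> powr p + \<bar>b\<bar> powr p) / 2) powr (2 / p)"
      by (intro mult_left_mono bonami_scalar p_gt_1 p2) auto
    also have "\<dots> = (\<bar>a\<bar> powr p + \<bar>b\<bar> powr p) powr (2 / p)"
      unfolding k2 powr_mult[symmetric] by (simp add: add_divide_distrib)
    finally show ?thesis by (simp add: a_def b_def)
  qed
  have "p \<le> 2" using p2 by simp
  note R = RF5_pair[of 2 ?g ?h, OF this _ _ L u v]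
  have m: "(\<lambda>x\<in>X. (u x + v x) / 2) \<in> F" "(\<lambda>x\<in>X. (u x - v x) / 2) \<in> F"
    using lincomb_mem[OF u v, of "1/2" "1/2" 0] lincomb_mem[OF u v, of "1/2" "-1/2" 0]
    by (simp_all add: field_simps cong: restrict_cong)
  have e: "(\<lambda>x\<in>X. ?g (u x) (v x)) = (\<lambda>x\<in>X. k * (\<lambda>x\<in>X. (u x + v x) / 2) x)"
    "(\<lambda>x\<in>X. ?h (u x) (v x)) = (\<lambda>x\<in>X. (k * c) * (\<lambda>x\<in>X. (u x - v x) / 2) x)" by auto
  have pw: "(\<bar>z\<bar> powr p * w) powr (2 / p) = z\<^sup>2 * w powr (2 / p)" for z w
    using p_pos by (simp add: powr_mult powr_powr sq)
  have "k\<^sup>2 * E (\<lambda>x\<in>X. (u x + v x) / 2) powr (2 / p)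
      + (k * c)\<^sup>2 * E (\<lambda>x\<in>X. (u x - v x) / 2) powr (2 / p) \<le> (E u + E v) powr (2 / p)"
    using R(3) unfolding e E_scale[OF m(1)] E_scale[OF m(2)] pw by simp
  also have "(E u + E v) powr (2 / p) = k\<^sup>2 * ((E u + E v) / 2) powr (2 / p)"
    unfolding k2 powr_mult[symmetric] by (simp add: add_divide_distrib)
  finally have "k\<^sup>2 * (E (\<lambda>x\<in>X. (u x + v x) / 2) powr (2 / p)
      + (p - 1) * E (\<lambda>x\<in>X. (u x - v x) / 2) powr (2 / p)) \<le> k\<^sup>2 * ((E u + E v) / 2) powr (2 / p)"
    by (simp add: power_mult_distrib c algebra_simps)
  then show ?thesis using k0 by simp
qed

lemma E_uniformly_convex:
  assumes M: "0 \<le> M" and \<epsilon>: "0 < \<epsilon>"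
  shows "\<exists>\<delta>>0. \<forall>u\<in>F. \<forall>v\<in>F. (E u + E v) / 2 \<le> M + \<delta> \<longrightarrow> M - \<delta> \<le> E (\<lambda>x\<in>X. (u x + v x) / 2)
    \<longrightarrow> E (\<lambda>x\<in>X. (u x - v x) / 2) \<le> \<epsilon>"
proof (cases "2 \<le> p")
  case True
  show ?thesis
  proof (intro exI[of _ "\<epsilon> / 2"] conjI ballI impI)
    fix u v assume "u \<in> F" "v \<in> F" "(E u + E v) / 2 \<le> M + \<epsilon> / 2" "M - \<epsilon> / 2 \<le> E (\<lambda>x\<in>X. (u x + v x) / 2)"
    then show "E (\<lambda>x\<in>X. (u x - v x) / 2) \<le> \<epsilon>" using E_clarkson[OF True, of u v] by linarith
  qed (use \<epsilon> in simp)
next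
  case False
  then have p2: "p < 2" by simp
  define h where "h = (\<lambda>\<delta>. (M + \<delta>) powr (2 / p) - (max 0 (M - \<delta>)) powr (2 / p))"
  have "(h \<longlongrightarrow> (M + 0) powr (2 / p) - (max 0 (M - 0)) powr (2 / p)) (at_right 0)"
    unfolding h_def
  proof (intro tendsto_diff)
    show "((\<lambda>\<delta>. (M + \<delta>) powr (2 / p)) \<longlongrightarrow> (M + 0) powr (2 / p)) (at_right 0)"
      using M p_pos by (intro tendsto_intros tendsto_powr') (auto simp: eventually_at_right_less eventually_at_filter)
    show "((\<lambda>\<delta>. max 0 (M - \<delta>) powr (2 / p)) \<longlongrightarrow> max 0 (M - 0) powr (2 / p)) (at_right 0)"
      using M p_pos by (intro tendsto_powr' tendsto_max tendsto_diff tendsto_const tendsto_ident_at) auto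
  qed
  then have "(h \<longlongrightarrow> 0) (at_right 0)" using M by simp
  moreover have "0 < (p - 1) * \<epsilon> powr (2 / p)" using p_gt_1 \<epsilon> by simp
  ultimately have "eventually (\<lambda>\<delta>. h \<delta> < (p - 1) * \<epsilon> powr (2 / p)) (at_right 0)"
    by (rule order_tendstoD(2))
  then obtain \<delta>' where d': "0 < \<delta>'" "\<And>\<delta>. 0 < \<delta> \<Longrightarrow> \<delta> < \<delta>' \<Longrightarrow> h \<delta> < (p - 1) * \<epsilon> powr (2 / p)"
    unfolding eventually_at_right_field by auto
  define \<delta> where "\<delta> = \<delta>' / 2"
  have d: "0 < \<delta>" "h \<delta> < (p - 1) * \<epsilon> powr (2 / p)"
    using d' by (auto simp: \<delta>_def)
  show ?thesis
  proof (intro exI[of _ \<delta>] conjI ballI impI d)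
    fix u v assume uv: "u \<in> F" "v \<in> F" and le: "(E u + E v) / 2 \<le> M + \<delta>"
      and ge: "M - \<delta> \<le> E (\<lambda>x\<in>X. (u x + v x) / 2)"
    have m: "(\<lambda>x\<in>X. (u x + v x) / 2) \<in> F"
      using lincomb_mem[OF uv, of "1/2" "1/2" 0] by (simp add: field_simps cong: restrict_cong)
    have "(max 0 (M - \<delta>)) powr (2 / p) \<le> E (\<lambda>x\<in>X. (u x + v x) / 2) powr (2 / p)"
      using ge nonneg[OF m] p_pos by (intro powr_mono2) auto
    moreover have "((E u + E v) / 2) powr (2 / p) \<le> (M + \<delta>) powr (2 / p)"
      using le nonneg uv p_pos by (intro powr_mono2) auto
    ultimately have "(p - 1) * E (\<lambda>x\<in>X. (u x - v x) / 2) powr (2 / p) \<le> (p - 1) * \<epsilon> powr (2 / p)"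
      using E_bonami[OF p2 uv] d(2) unfolding h_def by linarith
    then have le2: "E (\<lambda>x\<in>X. (u x - v x) / 2) powr (2 / p) \<le> \<epsilon> powr (2 / p)"
      using p_gt_1 by simp
    show "E (\<lambda>x\<in>X. (u x - v x) / 2) \<le> \<epsilon>"
    proof (rule ccontr)
      assume "\<not> ?thesis"
      then have "\<epsilon> powr (2 / p) < E (\<lambda>x\<in>X. (u x - v x) / 2) powr (2 / p)"
        using \<epsilon> p_pos by (intro powr_less_mono2) auto
      with le2 show False by simp
    qed
  qed
qed

lemma E_midpoint_strict:
  assumes uv: "u \<in> F" "v \<in> F" and mid: "(E u + E v) / 2 \<le> E (\<lambda>x\<in>X. (u x + v x) / 2)"
  shows "E (\<lambda>x\<in>X. (u x - v x) / 2) = 0"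
proof -
  have m: "(\<lambda>x\<in>X. (u x - v x) / 2) \<in> F"
    using lincomb_mem[OF uv, of "1/2" "-1/2" 0] by (simp add: field_simps cong: restrict_cong)
  have M: "0 \<le> (E u + E v) / 2" using nonneg uv by simp
  have "E (\<lambda>x\<in>X. (u x - v x) / 2) \<le> \<epsilon>" if \<epsilon>: "0 < \<epsilon>" for \<epsilon>
  proof -
    obtain \<delta> where \<delta>: "0 < \<delta>" "\<forall>u'\<in>F. \<forall>v'\<in>F. (E u' + E v') / 2 \<le> (E u + E v) / 2 + \<delta>
      \<longrightarrow> (E u + E v) / 2 - \<delta> \<le> E (\<lambda>x\<in>X. (u' x + v' x) / 2) \<longrightarrow> E (\<lambda>x\<in>X. (u' x - v' x) / 2) \<le> \<epsilon>"
      using E_uniformly_convex[OF M \<epsilon>] by blast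
    show ?thesis using \<delta>(2)[rule_format, OF uv] \<delta>(1) mid by simp
  qed
  then have "E (\<lambda>x\<in>X. (u x - v x) / 2) \<le> 0" by (rule field_le_epsilon[of _ 0, simplified])
  then show ?thesis using nonneg[OF m] by simp
qed

lemma mod_consts_refl: "u \<in> F \<Longrightarrow> (u, u) \<in> mod_consts X F"
  by (auto simp: mod_consts_def const_funs_def)

lemma mod_constsD:
  assumes "(u, v) \<in> mod_consts X F"
  shows "u \<in> F" "v \<in> F" "\<exists>c. \<forall>x\<in>X. v x = u x + c"
proof -
  have uv: "u \<in> F" "v \<in> F" and "(\<lambda>x\<in>X. u x - v x) \<in> const_funs X"
    using assms by (auto simp: mod_consts_def)
  then obtain c where "(\<lambda>x\<in>X. u x - v x) = (\<lambda>x\<in>X. c)" by (auto simp: const_funs_def)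
  then have "u x - v x = c" if "x \<in> X" for x
    using that by (metis restrict_apply')
  then have "\<forall>x\<in>X. v x = u x + (- c)" by (simp add: algebra_simps)
  then show "\<exists>c. \<forall>x\<in>X. v x = u x + c" by blast
qed (use assms in \<open>auto simp: mod_consts_def\<close>)

lemma quot_dist_classes:
  assumes u: "u \<in> F" and v: "v \<in> F"
  shows "quot_dist p X E F (mod_consts X F `` {u}) (mod_consts X F `` {v})
    = E (\<lambda>x\<in>X. u x - v x) powr (1 / p)"
proof -
  let ?A = "mod_consts X F `` {u}" and ?B = "mod_consts X F `` {v}"
  have mem: "?A \<in> F // mod_consts X F" "?B \<in> F // mod_consts X F"
    using u v by (auto intro: quotientI)
  have eq: "E (\<lambda>x\<in>X. u' x - v' x) powr (1 / p) = E (\<lambda>x\<in>X. u x - v x) powr (1 / p)"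
    if "u' \<in> ?A" "v' \<in> ?B" for u' v'
  proof -
    obtain c where c: "\<forall>x\<in>X. u' x = u x + c" using mod_constsD(3)[of u u'] \<open>u' \<in> ?A\<close> by auto
    obtain c' where c': "\<forall>x\<in>X. v' x = v x + c'" using mod_constsD(3)[of v v'] \<open>v' \<in> ?B\<close> by auto
    have "(\<lambda>x\<in>X. u' x - v' x) = (\<lambda>x\<in>X. (\<lambda>x\<in>X. u x - v x) x + (c - c'))"
      using c c' by auto
    then show ?thesis using E_add_const[OF diff_mem[OF u v]] by simp
  qed
  have "(u, v) \<in> ?A \<times> ?B" using u v mod_consts_refl by auto
  then have ne: "?A \<times> ?B \<noteq> {}" by blast
  have "(INF (u, v) \<in> ?A \<times> ?B. E (\<lambda>x\<in>X. u x - v x) powr (1 / p))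
      = (INF z \<in> ?A \<times> ?B. E (\<lambda>x\<in>X. u x - v x) powr (1 / p))"
    using eq by (intro INF_cong refl) auto
  also have "\<dots> = E (\<lambda>x\<in>X. u x - v x) powr (1 / p)" by (rule cINF_const[OF ne])
  finally show ?thesis using mem by (simp add: quot_dist_def)
qed

lemma E_complete:
  assumes w: "\<And>n. w n \<in> F"
    and cauchy: "\<And>\<epsilon>. 0 < \<epsilon> \<Longrightarrow> \<exists>N::nat. \<forall>m\<ge>N. \<forall>n\<ge>N. E (\<lambda>x\<in>X. w m x - w n x) < \<epsilon>"
  shows "\<exists>v\<in>F. (\<lambda>n. E (\<lambda>x\<in>X. w n x - v x)) \<longlonglongrightarrow> 0"
proof -
  let ?R = "mod_consts X F"
  interpret Q: Metric_space "F // ?R" "quot_dist p X E F" by (rule RF2_metric)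
  define \<sigma> where "\<sigma> = (\<lambda>n. ?R `` {w n})"
  have \<sigma>: "\<sigma> n \<in> F // ?R" for n unfolding \<sigma>_def by (rule quotientI[OF w])
  have root: "z powr (1 / p) < \<epsilon> \<longleftrightarrow> z < \<epsilon> powr p" if "0 \<le> z" "0 < \<epsilon>" for z \<epsilon>
  proof -
    have "z powr (1 / p) < \<epsilon> \<longleftrightarrow> (z powr (1 / p)) powr p < \<epsilon> powr p"
      using that p_pos by (metis powr_ge_zero less_eq_real_def linorder_not_le powr_less_mono2 powr_mono2)
    then show ?thesis using that by (simp only: powr_p_inverse)
  qed
  have "Q.MCauchy \<sigma>"
    unfolding Q.MCauchy_def
  proof (intro conjI allI impI)
    fix \<epsilon> :: real assume \<epsilon>: "0 < \<epsilon>"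
    then have "0 < \<epsilon> powr p" by simp
    then obtain N where N: "\<forall>m\<ge>N. \<forall>n\<ge>N. E (\<lambda>x\<in>X. w m x - w n x) < \<epsilon> powr p"
      using cauchy by blast
    have "quot_dist p X E F (\<sigma> m) (\<sigma> n) < \<epsilon>" if "N \<le> m" "N \<le> n" for m n
      unfolding \<sigma>_def quot_dist_classes[OF w w] root[OF nonneg[OF diff_mem[OF w w]] \<epsilon>]
      using N that by blast
    then show "\<exists>N. \<forall>m n. N \<le> m \<longrightarrow> N \<le> n \<longrightarrow> quot_dist p X E F (\<sigma> m) (\<sigma> n) < \<epsilon>" by blast
  qed (use \<sigma> in auto)
  then obtain l where l: "limitin Q.mtopology \<sigma> l sequentially"
    using RF2_complete unfolding Q.mcomplete_def by blast
  then have lF: "l \<in> F // ?R" and lim: "\<And>\<epsilon>. 0 < \<epsilon> \<Longrightarrow> \<exists>N. \<forall>n\<ge>N. quot_dist p X E F (\<sigma> n) l < \<epsilon>"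
    unfolding Q.limit_metric_sequentially by blast+
  obtain v where v: "v \<in> F" "l = ?R `` {v}" using lF by (rule quotientE)
  have "(\<lambda>n. E (\<lambda>x\<in>X. w n x - v x)) \<longlonglongrightarrow> 0"
  proof (rule LIMSEQ_I)
    fix \<epsilon> :: real assume \<epsilon>: "0 < \<epsilon>"
    then obtain N where N: "\<forall>n\<ge>N. quot_dist p X E F (\<sigma> n) l < \<epsilon> powr (1 / p)"
      using lim[of "\<epsilon> powr (1 / p)"] by auto
    have "E (\<lambda>x\<in>X. w n x - v x) < \<epsilon>" if "N \<le> n" for n
    proof -
      have "E (\<lambda>x\<in>X. w n x - v x) powr (1 / p) < \<epsilon> powr (1 / p)"
        using N that unfolding \<sigma>_def v(2) quot_dist_classes[OF w v(1)] by blast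
      then have "E (\<lambda>x\<in>X. w n x - v x) < (\<epsilon> powr (1 / p)) powr p"
        using root[OF nonneg[OF diff_mem[OF w v(1)]], of "\<epsilon> powr (1 / p)"] \<epsilon> by simp
      then show ?thesis using \<epsilon> powr_p_inverse by simp
    qed
    then show "\<exists>N. \<forall>n\<ge>N. norm (E (\<lambda>x\<in>X. w n x - v x) - 0) < \<epsilon>"
      using nonneg[OF diff_mem[OF w v(1)]] by auto
  qed
  with v show ?thesis by blast
qed

end

section \<open>Forms on three points\<close>

locale three_point_form =
  fixes p :: real and e :: "real \<Rightarrow> real \<Rightarrow> real \<Rightarrow> real"
  assumes p_gt_1: "1 < p"
    and nonneg: "0 \<le> e a b c"
    and affine: "e (s * a + r) (s * b + r) (s * c + r) = \<bar>s\<bar> powr p * e a b c"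
    and definite: "e a b c = 0 \<Longrightarrow> a = b \<and> b = c"
    and triangle: "e (a + a') (b + b') (c + c') powr (1 / p)
      \<le> e a b c powr (1 / p) + e a' b' c' powr (1 / p)"
    and clip: "l \<le> h \<Longrightarrow> e (max l (min h a)) (max l (min h b)) (max l (min h c)) \<le> e a b c"
begin

lemma p_pos: "0 < p" using p_gt_1 by simp

lemma scale: "e (s * a) (s * b) (s * c) = \<bar>s\<bar> powr p * e a b c"
  using affine[of s a 0 b c] by simp

lemma translate: "e (a + r) (b + r) (c + r) = e a b c"
  using affine[of 1 a r b c] by simp

lemma const [simp]: "e a a a = 0"
  using affine[of 0 0 a 0 0] by simp

lemma pos: "\<not> (a = b \<and> b = c) \<Longrightarrow> 0 < e a b c"
  using nonneg[of a b c] definite[of a b c] by fastforce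

lemma powr_root: "(e a b c powr (1 / p)) powr p = e a b c"
  using p_pos nonneg by (simp add: powr_powr)

lemma convex:
  assumes t: "0 \<le> t" "t \<le> 1"
  shows "e ((1 - t) * a + t * a') ((1 - t) * b + t * b') ((1 - t) * c + t * c')
    \<le> (1 - t) * e a b c + t * e a' b' c'"
proof -
  let ?N = "\<lambda>a b c. e a b c powr (1 / p)"
  have sc: "?N (s * a) (s * b) (s * c) = s * ?N a b c" if "0 \<le> s" for s a b c
    using that p_pos nonneg by (simp add: scale powr_mult powr_powr)
  have "?N ((1 - t) * a + t * a') ((1 - t) * b + t * b') ((1 - t) * c + t * c')
    \<le> (1 - t) * ?N a b c + t * ?N a' b' c'"
    using triangle[of "(1 - t) * a" "t * a'" "(1 - t) * b" "t * b'" "(1 - t) * c" "t * c'"] t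
    by (simp add: sc)
  then have "?N ((1 - t) * a + t * a') ((1 - t) * b + t * b') ((1 - t) * c + t * c') powr p
    \<le> ((1 - t) * ?N a b c + t * ?N a' b' c') powr p"
    using p_pos by - (rule powr_mono2, auto)
  also have "\<dots> \<le> (1 - t) * ?N a b c powr p + t * ?N a' b' c' powr p"
    using convex_onD[OF convex_abs_powr[of p] t, of "?N a b c" "?N a' b' c'"] p_gt_1 t by simp
  finally show ?thesis by (simp add: powr_root)
qed

lemma midpoint_convex:
  "e ((a + a') / 2) ((b + b') / 2) ((c + c') / 2) \<le> (e a b c + e a' b' c') / 2"
  using convex[of "1/2" a a' b b' c c'] by (simp add: add_divide_distrib)

lemma root_lipschitz:
  "\<bar>e a b c powr (1 / p) - e a' b' c' powr (1 / p)\<bar>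
    \<le> \<bar>a - a'\<bar> * e 1 0 0 powr (1/p) + \<bar>b - b'\<bar> * e 0 1 0 powr (1/p) + \<bar>c - c'\<bar> * e 0 0 1 powr (1/p)"
proof -
  let ?N = "\<lambda>a b c. e a b c powr (1 / p)"
  have sc: "?N (s * a) (s * b) (s * c) = \<bar>s\<bar> * ?N a b c" for s a b c
    using p_pos nonneg by (simp add: scale powr_mult powr_powr)
  have small: "?N x y z \<le> \<bar>x\<bar> * ?N 1 0 0 + \<bar>y\<bar> * ?N 0 1 0 + \<bar>z\<bar> * ?N 0 0 1" for x y z
  proof -
    have "?N x y z \<le> ?N x y 0 + ?N 0 0 z" using triangle[of x 0 y 0 0 z] by simp
    moreover have "?N x y 0 \<le> ?N x 0 0 + ?N 0 y 0" using triangle[of x 0 0 y 0 0] by simp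
    moreover have "?N x 0 0 = \<bar>x\<bar> * ?N 1 0 0" "?N 0 y 0 = \<bar>y\<bar> * ?N 0 1 0" "?N 0 0 z = \<bar>z\<bar> * ?N 0 0 1"
      using sc[of x 1 0 0] sc[of y 0 1 0] sc[of z 0 0 1] by simp_all
    ultimately show ?thesis by linarith
  qed
  have half: "?N a b c - ?N a' b' c' \<le> \<bar>a - a'\<bar> * ?N 1 0 0 + \<bar>b - b'\<bar> * ?N 0 1 0 + \<bar>c - c'\<bar> * ?N 0 0 1"
    for a b c a' b' c'
    using triangle[of "a - a'" a' "b - b'" b' "c - c'" c'] small[of "a - a'" "b - b'" "c - c'"] by simp
  show ?thesis
    using half[of a b c a' b' c'] half[of a' b' c' a b c] by (simp add: abs_minus_commute abs_le_iff)
qed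

lemma tendsto:
  assumes "(f \<longlongrightarrow> a) G" "(g \<longlongrightarrow> b) G" "(h \<longlongrightarrow> c) G"
  shows "((\<lambda>x. e (f x) (g x) (h x)) \<longlongrightarrow> e a b c) G"
proof -
  let ?N = "\<lambda>a b c. e a b c powr (1 / p)"
  have "((\<lambda>x. \<bar>f x - a\<bar> * ?N 1 0 0 + \<bar>g x - b\<bar> * ?N 0 1 0 + \<bar>h x - c\<bar> * ?N 0 0 1)
      \<longlongrightarrow> \<bar>a - a\<bar> * ?N 1 0 0 + \<bar>b - b\<bar> * ?N 0 1 0 + \<bar>c - c\<bar> * ?N 0 0 1) G"
    by (intro tendsto_intros assms)
  moreover have "\<forall>\<^sub>F x in G. norm (?N (f x) (g x) (h x) - ?N a b c)
      \<le> \<bar>f x - a\<bar> * ?N 1 0 0 + \<bar>g x - b\<bar> * ?N 0 1 0 + \<bar>h x - c\<bar> * ?N 0 0 1"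
    unfolding real_norm_def by (rule always_eventually) (rule allI, rule root_lipschitz)
  ultimately have "((\<lambda>x. ?N (f x) (g x) (h x) - ?N a b c) \<longlongrightarrow> 0) G"
    by - (rule Lim_null_comparison, assumption, simp)
  then have "((\<lambda>x. ?N (f x) (g x) (h x)) \<longlongrightarrow> ?N a b c) G"
    by (simp add: LIM_zero_iff)
  then have "((\<lambda>x. ?N (f x) (g x) (h x) powr p) \<longlongrightarrow> ?N a b c powr p) G"
    using p_pos by - (rule tendsto_powr', assumption, rule tendsto_const, simp)
  then show ?thesis by (simp add: powr_root)
qed

lemma continuous [continuous_intros]:
  "continuous_on A f \<Longrightarrow> continuous_on A g \<Longrightarrow> continuous_on A h
    \<Longrightarrow> continuous_on A (\<lambda>x. e (f x) (g x) (h x))"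
  unfolding continuous_on_def by (blast intro: tendsto)

end

text \<open>
  The values at the midpoints opposite the third, the second and the first vertex are \<open>x\<close>,
  \<open>y\<close> and \<open>t\<close>.
\<close>

definition refined :: "real \<Rightarrow> (real \<Rightarrow> real \<Rightarrow> real \<Rightarrow> real) \<Rightarrow>
    real \<Rightarrow> real \<Rightarrow> real \<Rightarrow> real \<Rightarrow> real \<Rightarrow> real \<Rightarrow> real" where
  "refined \<rho> e a b c x y t = \<rho> * (e a x y + e x b t + e y t c)"

locale eigen_form = three_point_form +
  fixes \<rho> :: real
  assumes rho_pos: "0 < \<rho>"
    and refined_ge: "e a b c \<le> refined \<rho> e a b c x y t"
    and refined_approx: "0 < \<epsilon> \<Longrightarrow> \<exists>x y t. refined \<rho> e a b c x y t < e a b c + \<epsilon>"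
begin

abbreviation minimizer :: "real \<Rightarrow> real \<Rightarrow> real \<Rightarrow> real \<Rightarrow> real \<Rightarrow> real \<Rightarrow> bool" where
  "minimizer a b c x y t \<equiv> refined \<rho> e a b c x y t = e a b c"

lemma minimizer_exists: "\<exists>x y t. minimizer a b c x y t"
proof -
  define l h where "l = min a (min b c)" and "h = max a (max b c)"
  define clp where "clp = (\<lambda>z. max l (min h z))"
  have lh: "l \<le> h" and abc: "clp a = a" "clp b = b" "clp c = c"
    by (auto simp: l_def h_def clp_def min_def max_def)
  have clp: "e (clp x) (clp y) (clp t) \<le> e x y t" for x y t
    unfolding clp_def by (rule clip[OF lh])
  have cr: "refined \<rho> e a b c (clp x) (clp y) (clp t) \<le> refined \<rho> e a b c x y t" for x y t
    using clp[of a x y] clp[of x b t] clp[of y t c] rho_pos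
    unfolding refined_def abc by (intro mult_left_mono) auto
  have "compact ({l..h} \<times> {l..h} \<times> {l..h})" by (intro compact_Times compact_Icc)
  moreover have "{l..h} \<times> {l..h} \<times> {l..h} \<noteq> {}" using lh by auto
  moreover have "continuous_on ({l..h} \<times> {l..h} \<times> {l..h})
      (\<lambda>z. refined \<rho> e a b c (fst z) (fst (snd z)) (snd (snd z)))"
    unfolding refined_def by (intro continuous_intros)
  ultimately obtain z where z: "\<forall>w\<in>{l..h} \<times> {l..h} \<times> {l..h}.
      refined \<rho> e a b c (fst z) (fst (snd z)) (snd (snd z))
      \<le> refined \<rho> e a b c (fst w) (fst (snd w)) (snd (snd w))"
    using continuous_attains_inf by blast
  have "refined \<rho> e a b c (fst z) (fst (snd z)) (snd (snd z)) \<le> e a b c"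
  proof (rule field_le_epsilon)
    fix \<epsilon> :: real assume "0 < \<epsilon>"
    then obtain x y t where "refined \<rho> e a b c x y t < e a b c + \<epsilon>" using refined_approx by blast
    moreover have "(clp x, clp y, clp t) \<in> {l..h} \<times> {l..h} \<times> {l..h}"
      using lh by (auto simp: clp_def)
    ultimately show "refined \<rho> e a b c (fst z) (fst (snd z)) (snd (snd z)) \<le> e a b c + \<epsilon>"
      using bspec[OF z, of "(clp x, clp y, clp t)"] cr[of x y t] by simp
  qed
  then show ?thesis using refined_ge by (blast intro: antisym)
qed

lemma minimizer_affine:
  assumes "minimizer a b c x y t"
  shows "minimizer (s * a + r) (s * b + r) (s * c + r) (s * x + r) (s * y + r) (s * t + r)"
proof -
  have "refined \<rho> e (s * a + r) (s * b + r) (s * c + r) (s * x + r) (s * y + r) (s * t + r)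
    = \<bar>s\<bar> powr p * refined \<rho> e a b c x y t"
    unfolding refined_def affine by (simp add: algebra_simps)
  then show ?thesis using assms affine by simp
qed

end

lemma convex_slope_min_pos:
  fixes f g :: "real \<Rightarrow> real"
  assumes f: "convex_on UNIV f" and g: "convex_on UNIV g" and r: "0 < r" "r \<le> 1" and \<rho>: "0 < \<rho>"
    and le: "\<And>\<epsilon>. f \<epsilon> - f 0 \<le> r * (f (\<epsilon> / r) - f 0) + \<rho> * (g \<epsilon> - g 0)"
    and pos: "0 < \<epsilon>\<^sub>1"
  shows "g 0 \<le> g \<epsilon>\<^sub>1"
proof (rule ccontr)
  assume "\<not> ?thesis"
  define \<delta> where "\<delta> = (g 0 - g \<epsilon>\<^sub>1) / \<epsilon>\<^sub>1"
  have \<delta>: "0 < \<delta>" using \<open>\<not> _\<close> pos by (simp add: \<delta>_def)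
  define \<phi> where "\<phi> = (\<lambda>\<epsilon>. (f \<epsilon> - f 0) / \<epsilon>)"
  have step: "\<phi> \<epsilon> \<le> \<phi> (\<epsilon> / r) - \<rho> * \<delta>" if \<epsilon>: "0 < \<epsilon>" "\<epsilon> \<le> \<epsilon>\<^sub>1" for \<epsilon>
  proof -
    have "g \<epsilon> \<le> (1 - \<epsilon> / \<epsilon>\<^sub>1) * g 0 + (\<epsilon> / \<epsilon>\<^sub>1) * g \<epsilon>\<^sub>1"
      using convex_onD[OF g, of "\<epsilon> / \<epsilon>\<^sub>1" 0 \<epsilon>\<^sub>1] \<epsilon> pos by simp
    also have "\<dots> = g 0 - \<delta> * \<epsilon>" using pos by (simp add: \<delta>_def field_simps)
    finally have "\<rho> * (g \<epsilon> - g 0) \<le> \<rho> * (- (\<delta> * \<epsilon>))" using \<rho> by (intro mult_left_mono) auto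
    with le[of \<epsilon>] have "f \<epsilon> - f 0 \<le> r * (f (\<epsilon> / r) - f 0) - \<rho> * \<delta> * \<epsilon>" by simp
    then have "(f \<epsilon> - f 0) / \<epsilon> \<le> (r * (f (\<epsilon> / r) - f 0) - \<rho> * \<delta> * \<epsilon>) / \<epsilon>"
      using \<epsilon> by (intro divide_right_mono) auto
    also have "\<dots> = \<phi> (\<epsilon> / r) - \<rho> * \<delta>"
      using \<epsilon> r by (simp add: \<phi>_def diff_divide_distrib) (simp add: field_simps)
    finally show ?thesis by (simp add: \<phi>_def)
  qed
  have iter: "\<phi> (\<epsilon>\<^sub>1 * r ^ k) \<le> \<phi> \<epsilon>\<^sub>1 - of_nat k * (\<rho> * \<delta>)" for k
  proof (induction k)
    case (Suc k)
    have "\<epsilon>\<^sub>1 * r ^ Suc k \<le> \<epsilon>\<^sub>1" using pos r by (simp add: power_le_one mult_le_one)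
    then have "\<phi> (\<epsilon>\<^sub>1 * r ^ Suc k) \<le> \<phi> (\<epsilon>\<^sub>1 * r ^ Suc k / r) - \<rho> * \<delta>"
      using pos r by (intro step) auto
    also have "\<epsilon>\<^sub>1 * r ^ Suc k / r = \<epsilon>\<^sub>1 * r ^ k" using r by simp
    finally show ?case using Suc by (simp add: algebra_simps)
  qed simp
  have lower: "f 0 - f (-1) \<le> \<phi> \<epsilon>" if \<epsilon>: "0 < \<epsilon>" for \<epsilon>
  proof -
    have "(1 - 1 / (1 + \<epsilon>)) * (-1) + 1 / (1 + \<epsilon>) * \<epsilon> = 0" using \<epsilon> by (simp add: field_simps)
    then have "f 0 \<le> (1 - 1 / (1 + \<epsilon>)) * f (-1) + 1 / (1 + \<epsilon>) * f \<epsilon>"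
      using convex_onD[OF f, of "1 / (1 + \<epsilon>)" "-1" \<epsilon>] \<epsilon> by simp
    then have "(1 + \<epsilon>) * f 0 \<le> (1 + \<epsilon>) * ((1 - 1 / (1 + \<epsilon>)) * f (-1) + 1 / (1 + \<epsilon>) * f \<epsilon>)"
      using \<epsilon> by (intro mult_left_mono) auto
    also have "\<dots> = ((1 + \<epsilon>) * (1 - 1 / (1 + \<epsilon>))) * f (-1) + ((1 + \<epsilon>) * (1 / (1 + \<epsilon>))) * f \<epsilon>"
      by (simp only: distrib_left mult.assoc)
    also have "(1 + \<epsilon>) * (1 - 1 / (1 + \<epsilon>)) = \<epsilon>" using \<epsilon> by (simp add: field_simps)
    also have "(1 + \<epsilon>) * (1 / (1 + \<epsilon>)) = 1" using \<epsilon> by simp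
    finally have "\<epsilon> * (f 0 - f (-1)) \<le> f \<epsilon> - f 0" by (simp add: algebra_simps)
    then show ?thesis using \<epsilon> by (simp add: \<phi>_def field_simps)
  qed
  obtain k where "(\<phi> \<epsilon>\<^sub>1 - (f 0 - f (-1))) < of_nat k * (\<rho> * \<delta>)"
    using ex_less_of_nat_mult[of "\<rho> * \<delta>"] \<rho> \<delta> by auto
  moreover have "0 < \<epsilon>\<^sub>1 * r ^ k" using pos r by simp
  ultimately show False using iter[of k] lower[of "\<epsilon>\<^sub>1 * r ^ k"] by linarith
qed

lemma convex_slope_min:
  fixes f g :: "real \<Rightarrow> real"
  assumes f: "convex_on UNIV f" and g: "convex_on UNIV g" and r: "0 < r" "r \<le> 1" and \<rho>: "0 < \<rho>"
    and le: "\<And>\<epsilon>. f \<epsilon> - f 0 \<le> r * (f (\<epsilon> / r) - f 0) + \<rho> * (g \<epsilon> - g 0)"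
  shows "g 0 \<le> g \<epsilon>"
proof -
  have refl: "convex_on UNIV (\<lambda>x. k (- x))" if "convex_on UNIV k" for k :: "real \<Rightarrow> real"
  proof
    fix t x y :: real assume "0 < t" "t < 1"
    then show "k (- ((1 - t) *\<^sub>R x + t *\<^sub>R y)) \<le> (1 - t) * k (- x) + t * k (- y)"
      using convex_onD[OF that, of t "- x" "- y"] by simp
  qed simp
  consider "0 < \<epsilon>" | "\<epsilon> = 0" | "0 < - \<epsilon>" by linarith
  then show ?thesis
  proof cases
    case 1
    then show ?thesis by (rule convex_slope_min_pos[OF f g r \<rho> le])
  next
    case 3
    show ?thesis
      using convex_slope_min_pos[OF refl[OF f] refl[OF g] r \<rho> _ 3] le[of "- _"] by simp
  qed simp
qed

section \<open>Symmetric eigenforms on three points\<close>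

locale symmetric_eigen_form = eigen_form +
  assumes swap12: "e a b c = e b a c"
    and swap23: "e a b c = e a c b"
    and submodular: "e (min a a') (min b b') (min c c') + e (max a a') (max b b') (max c c')
      \<le> e a b c + e a' b' c'"
    and strict: "(e a b c + e a' b' c') / 2 \<le> e ((a + a') / 2) ((b + b') / 2) ((c + c') / 2)
      \<Longrightarrow> e ((a - a') / 2) ((b - b') / 2) ((c - c') / 2) = 0"
begin

lemma swap13: "e a b c = e c b a"
  by (metis swap12 swap23)

lemma minimizer_unique:
  assumes m: "minimizer a b c x y t" and m': "minimizer a b c x' y' t'"
  shows "x = x' \<and> y = y' \<and> t = t'"
proof -
  define X Y T where "X = (x + x') / 2" and "Y = (y + y') / 2" and "T = (t + t') / 2"
  have c1: "e a X Y \<le> (e a x y + e a x' y') / 2"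
    using midpoint_convex[of a a x x' y y'] by (simp add: X_def Y_def)
  have c2: "e X b T \<le> (e x b t + e x' b t') / 2"
    using midpoint_convex[of x x' b b t t'] by (simp add: X_def T_def)
  have c3: "e Y T c \<le> (e y t c + e y' t' c) / 2"
    using midpoint_convex[of y y' t t' c c] by (simp add: Y_def T_def)
  have "(refined \<rho> e a b c x y t + refined \<rho> e a b c x' y' t') / 2 \<le> refined \<rho> e a b c X Y T"
    using m m' refined_ge[of a b c X Y T] by simp
  then have "\<rho> * ((e a x y + e a x' y') / 2 + (e x b t + e x' b t') / 2 + (e y t c + e y' t' c) / 2)
      \<le> \<rho> * (e a X Y + e X b T + e Y T c)"
    unfolding refined_def by (simp add: field_simps)
  then have "(e a x y + e a x' y') / 2 + (e x b t + e x' b t') / 2 + (e y t c + e y' t' c) / 2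
      \<le> e a X Y + e X b T + e Y T c"
    using rho_pos by simp
  then have "(e a x y + e a x' y') / 2 \<le> e a X Y" "(e x b t + e x' b t') / 2 \<le> e X b T"
    using c1 c2 c3 by linarith+
  then have "e 0 ((x - x') / 2) ((y - y') / 2) = 0" "e ((x - x') / 2) 0 ((t - t') / 2) = 0"
    using strict[of a x y a x' y'] strict[of x b t x' b t'] by (simp_all add: X_def Y_def T_def)
  then show ?thesis
    using definite[of 0 "(x - x') / 2" "(y - y') / 2"] definite[of "(x - x') / 2" 0 "(t - t') / 2"] by auto
qed

lemma minimizer_mono:
  assumes m: "minimizer a b c x y t" and m': "minimizer a' b' c' x' y' t'"
    and le: "a \<le> a'" "b \<le> b'" "c \<le> c'"
  shows "x \<le> x' \<and> y \<le> y' \<and> t \<le> t'"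
proof -
  let ?l = "refined \<rho> e a b c (min x x') (min y y') (min t t')"
    and ?u = "refined \<rho> e a' b' c' (max x x') (max y y') (max t t')"
  have mn: "min a a' = a" "min b b' = b" "min c c' = c" "max a a' = a'" "max b b' = b'" "max c c' = c'"
    using le by auto
  have "(e a (min x x') (min y y') + e a' (max x x') (max y y'))
      + (e (min x x') b (min t t') + e (max x x') b' (max t t'))
      + (e (min y y') (min t t') c + e (max y y') (max t t') c')
      \<le> (e a x y + e a' x' y') + (e x b t + e x' b' t') + (e y t c + e y' t' c')"
    using submodular[of a a' x x' y y'] submodular[of x x' b b' t t'] submodular[of y y' t t' c c']
    unfolding mn by linarith
  then have "\<rho> * ((e a (min x x') (min y y') + e a' (max x x') (max y y'))
      + (e (min x x') b (min t t') + e (max x x') b' (max t t'))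
      + (e (min y y') (min t t') c + e (max y y') (max t t') c'))
      \<le> \<rho> * ((e a x y + e a' x' y') + (e x b t + e x' b' t') + (e y t c + e y' t' c'))"
    using rho_pos by (intro mult_left_mono) auto
  then have "?l + ?u \<le> e a b c + e a' b' c'"
    using m m' unfolding refined_def by (simp add: algebra_simps)
  then have "?l = e a b c"
    using refined_ge[of a b c "min x x'" "min y y'" "min t t'"]
      refined_ge[of a' b' c' "max x x'" "max y y'" "max t t'"] by linarith
  then have "min x x' = x \<and> min y y' = y \<and> min t t' = t" by (rule minimizer_unique[OF _ m])
  then show ?thesis by (auto simp: min_def split: if_splits)
qed

lemma minimizer_const: "minimizer a a a a a a"
  by (simp add: refined_def)

lemma minimizer_swap23: "minimizer a b c x y t \<Longrightarrow> minimizer a c b y x t"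
proof -
  assume "minimizer a b c x y t"
  moreover have "e a y x = e a x y" "e y c t = e y t c" "e x t b = e x b t" "e a c b = e a b c"
    by (rule swap23)+
  ultimately show ?thesis by (simp add: refined_def algebra_simps)
qed

text \<open>
  If \<open>y < x\<close>, then exchanging \<open>x\<close> and \<open>y\<close> does not raise the energy: this is polarization with
  respect to the axis of the first vertex.
\<close>

lemma minimizer_polarized:
  assumes m: "minimizer a b c x y t" and bc: "b \<le> c"
  shows "x \<le> y"
proof (rule ccontr)
  assume "\<not> ?thesis"
  then have xy: "y < x" by simp
  have "e y b t + e x c t \<le> e x b t + e y c t"
    using submodular[of x y b c t t] xy bc by (simp add: min_def max_def split: if_splits)
  moreover have "e x t c = e x c t" "e y t c = e y c t" by (rule swap23)+
  moreover have "e a y x = e a x y" by (rule swap23)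
  ultimately have "e a y x + e y b t + e x t c \<le> e a x y + e x b t + e y t c" by simp
  then have "refined \<rho> e a b c y x t \<le> refined \<rho> e a b c x y t"
    unfolding refined_def using rho_pos by (intro mult_left_mono) auto
  then have "minimizer a b c y x t" using m refined_ge[of a b c y x t] by linarith
  then show False using minimizer_unique[OF m] xy by blast
qed

text \<open>
  The identity for \<open>\<rho>\<close> comes from moving the value at the first vertex: the function equal to
  \<open>r, r, s\<close> at the midpoints stays admissible, and to first order both sides must agree.
\<close>

lemma unit_minimizer:
  obtains r s where "minimizer 0 1 1 r r s" "0 < r" "r \<le> 1" "r \<le> s" "\<rho> * r powr p = r"
    "\<And>\<tau>. e r 1 s \<le> e r 1 \<tau>"
proof -
  obtain r r' s where m': "minimizer 0 1 1 r r' s" using minimizer_exists by blast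
  have "r = r'" using minimizer_unique[OF m' minimizer_swap23[OF m']] by blast
  with m' have m: "minimizer 0 1 1 r r s" by simp
  have r01: "0 \<le> r" "r \<le> 1"
    using minimizer_mono[OF minimizer_const[of 0] m] minimizer_mono[OF m minimizer_const[of 1]] by simp_all
  have rs: "r \<le> s"
  proof -
    have "e r 1 (max r s) \<le> e r 1 s"
    proof -
      have "max r (min (max 1 s) r) = r" "max r (min (max 1 s) 1) = 1" "max r (min (max 1 s) s) = max r s"
        using r01 by auto
      then show ?thesis using clip[of r "max 1 s" r 1 s] r01 by simp
    qed
    moreover have "e r (max r s) 1 = e r 1 (max r s)" "e r s 1 = e r 1 s" by (rule swap23)+
    ultimately have "refined \<rho> e 0 1 1 r r (max r s) \<le> refined \<rho> e 0 1 1 r r s"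
      unfolding refined_def using rho_pos by (intro mult_left_mono) auto
    then have "minimizer 0 1 1 r r (max r s)" using m refined_ge[of 0 1 1 r r "max r s"] by linarith
    then have "s = max r s" using minimizer_unique[OF m] by blast
    then show ?thesis by (metis max.cobounded1)
  qed
  define k where "k = e 0 1 1"
  have k: "0 < k" unfolding k_def by (rule pos) simp
  have cmp: "(1 + \<epsilon>) powr p - 1 \<le> \<rho> * ((r + \<epsilon>) powr p - r powr p)" if "- 1 < \<epsilon>" "- r \<le> \<epsilon>" for \<epsilon>
  proof -
    have 1: "e (- \<epsilon>) 1 1 = (1 + \<epsilon>) powr p * k"
      using affine[of "1 + \<epsilon>" 0 "- \<epsilon>" 1 1] that by (simp add: k_def)
    have 2: "e (- \<epsilon>) r r = (r + \<epsilon>) powr p * k"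
      using affine[of "r + \<epsilon>" 0 "- \<epsilon>" 1 1] that by (simp add: k_def)
    have 3: "e 0 r r = r powr p * k"
      using scale[of r 0 1 1] r01 by (simp add: k_def)
    have "(1 + \<epsilon>) powr p * k \<le> \<rho> * ((r + \<epsilon>) powr p * k + e r 1 s + e r s 1)"
      using refined_ge[of "- \<epsilon>" 1 1 r r s] unfolding refined_def 1 2 .
    moreover have "k = \<rho> * (r powr p * k + e r 1 s + e r s 1)"
      using m unfolding refined_def 3 by (simp add: k_def)
    ultimately have "k * ((1 + \<epsilon>) powr p - 1) \<le> k * (\<rho> * ((r + \<epsilon>) powr p - r powr p))"
      by (simp add: algebra_simps)
    then show ?thesis using k by simp
  qed
  have r0: "0 < r"
  proof (rule ccontr)
    assume "\<not> 0 < r"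
    then have r: "r = 0" using r01 by simp
    define \<epsilon> where "\<epsilon> = (p / (2 * \<rho>)) powr (1 / (p - 1))"
    have \<epsilon>: "0 < \<epsilon>" "\<epsilon> powr (p - 1) = p / (2 * \<rho>)"
      using p_gt_1 rho_pos by (auto simp: \<epsilon>_def powr_powr)
    have "p * \<epsilon> \<le> (1 + \<epsilon>) powr p - 1" using powr_ge_tangent[of "1 + \<epsilon>" p] \<epsilon> p_gt_1 by simp
    also have "\<dots> \<le> \<rho> * \<epsilon> powr p" using cmp[of \<epsilon>] \<epsilon> r p_pos by simp
    also have "\<epsilon> powr p = \<epsilon> * \<epsilon> powr (p - 1)" using powr_mult_base[of \<epsilon> "p - 1"] \<epsilon>(1) by simp
    also have "\<rho> * (\<epsilon> * \<epsilon> powr (p - 1)) = (p / 2) * \<epsilon>"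
      unfolding \<epsilon>(2) using rho_pos by simp
    finally have "p * \<epsilon> \<le> (p / 2) * \<epsilon>" .
    then show False using \<epsilon>(1) p_pos by simp
  qed
  define \<phi> where "\<phi> = (\<lambda>\<epsilon>. \<rho> * ((r + \<epsilon>) powr p - r powr p) - ((1 + \<epsilon>) powr p - 1))"
  have D: "(\<phi> has_real_derivative \<rho> * (p * r powr (p - 1)) - p) (at 0)"
    unfolding \<phi>_def using r0 by (auto intro!: derivative_eq_intros)
  have "\<rho> * (p * r powr (p - 1)) - p = 0"
    using r0 r01 cmp by (intro DERIV_local_min[OF D r0]) (auto simp: \<phi>_def)
  then have "p * (\<rho> * r powr (p - 1)) = p * 1" by simp
  then have "\<rho> * r powr (p - 1) = 1" using p_pos by (simp only: mult_cancel_left) simp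
  then have "\<rho> * (r * r powr (p - 1)) = r" by (metis mult.left_commute mult.right_neutral)
  then have rr: "\<rho> * r powr p = r" using powr_mult_base[of r "p - 1"] r0 by simp
  have "e r 1 s \<le> e r 1 \<tau>" for \<tau>
  proof -
    have "refined \<rho> e 0 1 1 r r s \<le> refined \<rho> e 0 1 1 r r \<tau>" using m refined_ge by simp
    moreover have "e r s 1 = e r 1 s" "e r \<tau> 1 = e r 1 \<tau>" by (rule swap23)+
    ultimately show ?thesis unfolding refined_def using rho_pos by simp
  qed
  then show thesis using that m r0 r01 rs rr by blast
qed

lemma convex_slice:
  "convex_on UNIV (\<lambda>\<tau>. e (a + a' * \<tau>) (b + b' * \<tau>) (c + c' * \<tau>))"
proof
  fix t x y :: real assume t: "0 < t" "t < 1"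
  have *: "z + z' * ((1 - t) * x + t * y) = (1 - t) * (z + z' * x) + t * (z + z' * y)" for z z' :: real
    by algebra
  show "e (a + a' * ((1 - t) *\<^sub>R x + t *\<^sub>R y)) (b + b' * ((1 - t) *\<^sub>R x + t *\<^sub>R y)) (c + c' * ((1 - t) *\<^sub>R x + t *\<^sub>R y))
    \<le> (1 - t) * e (a + a' * x) (b + b' * x) (c + c' * x) + t * e (a + a' * y) (b + b' * y) (c + c' * y)"
    unfolding real_scaleR_def * using t by (intro convex) auto
qed simp

lemma slice_min_unique:
  assumes "\<And>\<tau>. e a b s \<le> e a b \<tau>" "\<And>\<tau>. e a b s' \<le> e a b \<tau>"
  shows "s = s'"
proof -
  have "(e a b s + e a b s') / 2 \<le> e ((a + a) / 2) ((b + b) / 2) ((s + s') / 2)"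
    using assms(1)[of "(s + s') / 2"] assms(2)[of "(s + s') / 2"] by simp
  then have "e 0 0 ((s - s') / 2) = 0" using strict[of a b s a b s'] by simp
  then show ?thesis using definite[of 0 0 "(s - s') / 2"] by simp
qed

lemma indicator_sum_eq: "e 0 1 1 = e 0 0 1"
proof -
  have "e 0 1 1 = e 1 0 0" using affine[of "-1" 0 1 1 1] by simp
  also have "\<dots> = e 0 0 1" by (rule swap13)
  finally show ?thesis .
qed

text \<open>
  The strictly convex function \<open>\<epsilon> \<mapsto> e 0 \<epsilon> 1\<close> takes equal values at \<open>0\<close> and \<open>1\<close>, so it
  decreases linearly at \<open>0\<close>; the case of general \<open>y\<close> follows by scaling.
\<close>

lemma slope_at_zero:
  obtains \<delta> where "0 < \<delta>"
    "\<And>y \<epsilon>. 0 < \<epsilon> \<Longrightarrow> \<epsilon> \<le> y / 2 \<Longrightarrow> e 0 \<epsilon> y - e 0 0 y \<le> - (\<delta> * y powr (p - 1) * \<epsilon>)"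
proof -
  define f where "f = (\<lambda>\<epsilon>. e 0 \<epsilon> 1)"
  have cf: "convex_on UNIV f"
    using convex_slice[of 0 0 0 1 1 0] by (simp add: f_def)
  define \<delta> where "\<delta> = 2 * (f 0 - f (1/2))"
  have \<delta>: "0 < \<delta>"
  proof (rule ccontr)
    assume "\<not> ?thesis"
    then have "(f 0 + f 1) / 2 \<le> e ((0 + 0) / 2) ((0 + 1) / 2) ((1 + 1) / 2)"
      using indicator_sum_eq by (simp add: f_def \<delta>_def)
    then have "e ((0 - 0) / 2) ((0 - 1) / 2) ((1 - 1) / 2) = 0"
      unfolding f_def by (rule strict)
    then show False using definite[of 0 "-(1/2)" 0] by simp
  qed
  have lin: "f \<epsilon> - f 0 \<le> - (\<delta> * \<epsilon>)" if "0 \<le> \<epsilon>" "\<epsilon> \<le> 1/2" for \<epsilon>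
    using convex_onD[OF cf, of "2 * \<epsilon>" 0 "1/2"] that by (simp add: \<delta>_def algebra_simps)
  have "e 0 \<epsilon> y - e 0 0 y \<le> - (\<delta> * y powr (p - 1) * \<epsilon>)" if \<epsilon>: "0 < \<epsilon>" "\<epsilon> \<le> y / 2" for y \<epsilon>
  proof -
    have y: "0 < y" using \<epsilon> by simp
    have s: "e 0 z y = y powr p * f (z / y)" for z
      using scale[of y 0 "z / y" 1] y by (simp add: f_def)
    have "e 0 \<epsilon> y - e 0 0 y = y powr p * (f (\<epsilon> / y) - f 0)"
      unfolding s[of \<epsilon>] s[of 0] by (simp add: right_diff_distrib)
    also have "\<dots> \<le> y powr p * (- (\<delta> * (\<epsilon> / y)))"
      using \<epsilon> y by (intro mult_left_mono lin) (auto simp: field_simps)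
    also have "y powr p = y * y powr (p - 1)" using powr_mult_base[of y "p - 1"] y by simp
    also have "y * y powr (p - 1) * (- (\<delta> * (\<epsilon> / y))) = - (\<delta> * y powr (p - 1) * \<epsilon>)"
      using y by simp
    finally show ?thesis .
  qed
  then show thesis using that \<delta> by blast
qed

lemma linear_powr_contradiction:
  assumes "0 < c" "0 < y" "0 \<le> C" and le: "\<And>\<epsilon>. 0 < \<epsilon> \<Longrightarrow> \<epsilon> \<le> y \<Longrightarrow> c * \<epsilon> \<le> C * \<epsilon> powr p"
  shows False
proof -
  define \<epsilon> where "\<epsilon> = min y ((c / (2 * (C + 1))) powr (1 / (p - 1)))"
  have \<epsilon>: "0 < \<epsilon>" "\<epsilon> \<le> y" using assms by (auto simp: \<epsilon>_def)
  have "\<epsilon> powr (p - 1) \<le> ((c / (2 * (C + 1))) powr (1 / (p - 1))) powr (p - 1)"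
    using \<epsilon>(1) p_gt_1 by - (rule powr_mono2, auto simp: \<epsilon>_def)
  also have "\<dots> = c / (2 * (C + 1))" using assms p_gt_1 by (simp add: powr_powr)
  finally have 1: "\<epsilon> powr (p - 1) \<le> c / (2 * (C + 1))" .
  have "c * \<epsilon> \<le> C * (\<epsilon> * \<epsilon> powr (p - 1))"
    using le[OF \<epsilon>] powr_mult_base[of \<epsilon> "p - 1"] \<epsilon> by simp
  then have "\<epsilon> * c \<le> \<epsilon> * (C * \<epsilon> powr (p - 1))" by (simp add: ac_simps)
  then have "c \<le> C * \<epsilon> powr (p - 1)" using \<epsilon>(1) by (simp only: mult_le_cancel_left_pos)
  also have "\<dots> \<le> C * (c / (2 * (C + 1)))" using 1 assms by (intro mult_left_mono) auto
  also have "\<dots> < c"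
  proof -
    have "C * c < c * (2 * (C + 1))"
    proof -
      have "C * c = c * C" by simp
      also have "\<dots> < c * (2 * (C + 1))" using assms by (intro mult_strict_left_mono) auto
      finally show ?thesis .
    qed
    then show ?thesis using assms by (simp add: pos_divide_less_eq)
  qed
  finally show False by simp
qed

lemma minimizer_improves_zero:
  assumes b: "0 < b" and m: "minimizer 0 0 b x y t"
  shows "0 < x"
proof (rule ccontr)
  assume "\<not> ?thesis"
  moreover have nn: "0 \<le> x" "0 \<le> y" "0 \<le> t"
    using minimizer_mono[OF minimizer_const[of 0] m] b by auto
  ultimately have x: "x = 0" by simp
  obtain \<delta> where \<delta>: "0 < \<delta>"
    and sl: "\<And>y \<epsilon>. 0 < \<epsilon> \<Longrightarrow> \<epsilon> \<le> y / 2 \<Longrightarrow> e 0 \<epsilon> y - e 0 0 y \<le> - (\<delta> * y powr (p - 1) * \<epsilon>)"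
    using slope_at_zero by blast
  define C where "C = e 0 1 0"
  have C: "0 \<le> C" unfolding C_def by (rule nonneg)
  have C0: "e 0 \<epsilon> 0 = C * \<epsilon> powr p" if "0 < \<epsilon>" for \<epsilon>
    using scale[of \<epsilon> 0 1 0] that by (simp add: C_def)
  have half: "e 0 \<epsilon> z - e 0 0 z \<le> C * \<epsilon> powr p" if "0 < \<epsilon>" "0 < z \<longrightarrow> \<epsilon> \<le> z / 2" "0 \<le> z" for z \<epsilon>
  proof (cases "z = 0")
    case True
    then show ?thesis using C0 that by simp
  next
    case False
    have "0 \<le> \<delta> * z powr (p - 1) * \<epsilon>" "0 \<le> C * \<epsilon> powr p" using \<delta> C that by simp_all
    then show ?thesis using sl[of \<epsilon> z] that False by force
  qed
  consider "0 < y" | "y = 0" "0 < t" | "y = 0" "t = 0" using nn by linarith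
  then show False
  proof cases
    case 1
    define z where "z = (if 0 < t then min y t else y)"
    have z: "0 < z" "z \<le> y" "0 < t \<longrightarrow> z \<le> t" using 1 by (auto simp: z_def)
    show False
    proof (rule linear_powr_contradiction[of "\<delta> * y powr (p - 1)" "z / 2" C])
      fix \<epsilon> assume \<epsilon>: "0 < \<epsilon>" "\<epsilon> \<le> z / 2"
      have "refined \<rho> e 0 0 b 0 y t \<le> refined \<rho> e 0 0 b \<epsilon> y t"
        using m refined_ge x by simp
      then have "e 0 0 y + e 0 0 t \<le> e 0 \<epsilon> y + e \<epsilon> 0 t"
        unfolding refined_def using rho_pos by simp
      moreover have "e \<epsilon> 0 t = e 0 \<epsilon> t" by (rule swap12)
      moreover have "e 0 \<epsilon> y - e 0 0 y \<le> - (\<delta> * y powr (p - 1) * \<epsilon>)" using \<epsilon> z by (intro sl) auto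
      moreover have "e 0 \<epsilon> t - e 0 0 t \<le> C * \<epsilon> powr p" using \<epsilon> z nn by (intro half) auto
      ultimately show "\<delta> * y powr (p - 1) * \<epsilon> \<le> C * \<epsilon> powr p" by linarith
    qed (use 1 z \<delta> C in auto)
  next
    case 2
    show False
    proof (rule linear_powr_contradiction[of "\<delta> * t powr (p - 1)" "t / 2" C])
      fix \<epsilon> assume \<epsilon>: "0 < \<epsilon>" "\<epsilon> \<le> t / 2"
      have "refined \<rho> e 0 0 b 0 0 t \<le> refined \<rho> e 0 0 b \<epsilon> 0 t"
        using m refined_ge x 2 by simp
      then have "e 0 0 t \<le> e 0 \<epsilon> 0 + e \<epsilon> 0 t"
        unfolding refined_def using rho_pos by simp
      moreover have "e \<epsilon> 0 t = e 0 \<epsilon> t" by (rule swap12)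
      moreover have "e 0 \<epsilon> t - e 0 0 t \<le> - (\<delta> * t powr (p - 1) * \<epsilon>)" using \<epsilon> by (intro sl) auto
      moreover note C0[OF \<epsilon>(1)]
      ultimately show "\<delta> * t powr (p - 1) * \<epsilon> \<le> C * \<epsilon> powr p" by linarith
    qed (use 2 \<delta> C in auto)
  next
    case 3
    show False
    proof (rule linear_powr_contradiction[of "\<delta> * b powr (p - 1)" "b / 2" C])
      fix \<epsilon> assume \<epsilon>: "0 < \<epsilon>" "\<epsilon> \<le> b / 2"
      have "refined \<rho> e 0 0 b 0 0 0 \<le> refined \<rho> e 0 0 b 0 \<epsilon> 0"
        using m refined_ge x 3 by simp
      then have "e 0 0 b \<le> e 0 0 \<epsilon> + e \<epsilon> 0 b"
        unfolding refined_def using rho_pos by simp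
      moreover have "e \<epsilon> 0 b = e 0 \<epsilon> b" "e 0 0 \<epsilon> = e 0 \<epsilon> 0" by (rule swap12, rule swap23)
      moreover have "e 0 \<epsilon> b - e 0 0 b \<le> - (\<delta> * b powr (p - 1) * \<epsilon>)" using \<epsilon> by (intro sl) auto
      moreover note C0[OF \<epsilon>(1)]
      ultimately show "\<delta> * b powr (p - 1) * \<epsilon> \<le> C * \<epsilon> powr p" by linarith
    qed (use b \<delta> C in auto)
  qed
qed

text \<open>
  Passing to the cell at the first vertex brings the other two values strictly closer to each
  other. If it did not, the cell would carry a multiple of the original function, and moving the
  second (or third) value would force \<open>t = a * s = b * s\<close>.
\<close>

lemma minimizer_improves:
  assumes ab: "0 \<le> a" "a < b" and m: "minimizer 0 a b x y t"
  shows "0 < x \<and> x \<le> y \<and> a * y < x * b"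
proof -
  have xy: "x \<le> y" using minimizer_polarized[OF m] ab by simp
  show ?thesis
  proof (cases "a = 0")
    case True
    then show ?thesis using minimizer_improves_zero[of b x y t] m ab xy by simp
  next
    case False
    then have a: "0 < a" and b: "0 < b" using ab by auto
    obtain r s where m1: "minimizer 0 1 1 r r s" and r: "0 < r" "r \<le> 1" and rs: "r \<le> s"
      and rr: "\<rho> * r powr p = r" and smin: "\<And>\<tau>. e r 1 s \<le> e r 1 \<tau>"
      using unit_minimizer by blast
    have ma: "minimizer 0 a a (a * r) (a * r) (a * s)" for a
      using minimizer_affine[OF m1, of a 0] by simp
    have ge: "a * r \<le> x" "a * r \<le> y"
      using minimizer_mono[OF ma[of a] m] ab by auto
    have le: "x \<le> b * r" "y \<le> b * r"
      using minimizer_mono[OF m ma[of b]] ab by auto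
    have x0: "0 < x" using ge a r by (smt (verit) mult_pos_pos)
    have "a * y < x * b"
    proof (rule ccontr)
      assume "\<not> ?thesis"
      then have *: "x * b \<le> a * y" by simp
      also have "\<dots> \<le> a * (b * r)" using a le by (intro mult_left_mono) auto
      finally have "b * x \<le> b * (a * r)" by (simp add: ac_simps)
      then have x: "x = a * r" using b ge by simp
      have "a * (b * r) \<le> a * y" using * x by (simp add: ac_simps)
      then have y: "y = b * r" using a le by simp
      have cell: "e 0 (z * r) (w * r) = r powr p * e 0 z w" for z w
        using scale[of r 0 z w] r by (simp add: ac_simps)
      have mm: "e 0 a b = \<rho> * (r powr p * e 0 a b + e (a * r) a t + e (b * r) t b)"
        using m unfolding refined_def x y cell by simp
      have dist: "\<rho> * (r powr p * z + w) = r * z + \<rho> * w" for z w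
        using rr by (simp add: distrib_left mult.assoc[symmetric])
      have t1: "t = a * s"
      proof -
        define f where "f = (\<lambda>\<epsilon>. e 0 (a + \<epsilon>) b)"
        define g where "g = (\<lambda>\<epsilon>. e (a * r) a (t - \<epsilon>))"
        have "f \<epsilon> - f 0 \<le> r * (f (\<epsilon> / r) - f 0) + \<rho> * (g \<epsilon> - g 0)" for \<epsilon>
        proof -
          have "e (a * r + \<epsilon>) (a + \<epsilon>) t = g \<epsilon>"
            using translate[of "a * r" \<epsilon> a "t - \<epsilon>"] by (simp add: g_def)
          moreover have "e 0 (a * r + \<epsilon>) (b * r) = r powr p * f (\<epsilon> / r)"
            using cell[of "a + \<epsilon> / r" b] r by (simp add: f_def distrib_right)
          moreover have "f \<epsilon> \<le> refined \<rho> e 0 (a + \<epsilon>) b (a * r + \<epsilon>) (b * r) t"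
            unfolding f_def by (rule refined_ge)
          ultimately have "f \<epsilon> \<le> \<rho> * (r powr p * f (\<epsilon> / r) + (g \<epsilon> + e (b * r) t b))"
            by (simp add: refined_def add.assoc)
          moreover have "f 0 = \<rho> * (r powr p * f 0 + (g 0 + e (b * r) t b))"
            using mm by (simp add: f_def g_def add.assoc)
          ultimately show ?thesis unfolding dist by (simp add: algebra_simps)
        qed
        moreover have "convex_on UNIV f" using convex_slice[of 0 0 a 1 b 0] by (simp add: f_def)
        moreover have "convex_on UNIV g"
          using convex_slice[of "a * r" 0 a 0 t "-1"] by (simp add: g_def)
        ultimately have gm: "g 0 \<le> g \<epsilon>" for \<epsilon>
          using convex_slope_min[of f g r \<rho> \<epsilon>] r rho_pos by blast
        have "e (a * r) a t \<le> e (a * r) a \<tau>" for \<tau>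
          using gm[of "t - \<tau>"] by (simp add: g_def)
        moreover have "e (a * r) a (a * s) \<le> e (a * r) a \<tau>" for \<tau>
        proof -
          have "e (a * r) a (a * s) = \<bar>a\<bar> powr p * e r 1 s" using scale[of a r 1 s] by simp
          also have "\<dots> \<le> \<bar>a\<bar> powr p * e r 1 (\<tau> / a)" by (intro mult_left_mono smin) simp
          also have "\<dots> = e (a * r) a \<tau>" using scale[of a r 1 "\<tau> / a"] a by simp
          finally show ?thesis .
        qed
        ultimately show ?thesis by (rule slice_min_unique)
      qed
      have t2: "t = b * s"
      proof -
        define f where "f = (\<lambda>\<epsilon>. e 0 a (b + \<epsilon>))"
        define g where "g = (\<lambda>\<epsilon>. e (b * r) (t - \<epsilon>) b)"
        have "f \<epsilon> - f 0 \<le> r * (f (\<epsilon> / r) - f 0) + \<rho> * (g \<epsilon> - g 0)" for \<epsilon>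
        proof -
          have "e (b * r + \<epsilon>) t (b + \<epsilon>) = g \<epsilon>"
            using translate[of "b * r" \<epsilon> "t - \<epsilon>" b] by (simp add: g_def)
          moreover have "e 0 (a * r) (b * r + \<epsilon>) = r powr p * f (\<epsilon> / r)"
            using cell[of a "b + \<epsilon> / r"] r by (simp add: f_def distrib_right)
          moreover have "f \<epsilon> \<le> refined \<rho> e 0 a (b + \<epsilon>) (a * r) (b * r + \<epsilon>) t"
            unfolding f_def by (rule refined_ge)
          ultimately have "f \<epsilon> \<le> \<rho> * (r powr p * f (\<epsilon> / r) + (g \<epsilon> + e (a * r) a t))"
            by (simp add: refined_def ac_simps)
          moreover have "f 0 = \<rho> * (r powr p * f 0 + (g 0 + e (a * r) a t))"
            using mm by (simp add: f_def g_def ac_simps)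
          ultimately show ?thesis unfolding dist by (simp add: algebra_simps)
        qed
        moreover have "convex_on UNIV f" using convex_slice[of 0 0 a 0 b 1] by (simp add: f_def)
        moreover have "convex_on UNIV g"
          using convex_slice[of "b * r" 0 t "-1" b 0] by (simp add: g_def)
        ultimately have gm: "g 0 \<le> g \<epsilon>" for \<epsilon>
          using convex_slope_min[of f g r \<rho> \<epsilon>] r rho_pos by blast
        have "e (b * r) b t \<le> e (b * r) b \<tau>" for \<tau>
          using gm[of "t - \<tau>"] swap23[of "b * r" b] by (simp add: g_def)
        moreover have "e (b * r) b (b * s) \<le> e (b * r) b \<tau>" for \<tau>
        proof -
          have "e (b * r) b (b * s) = \<bar>b\<bar> powr p * e r 1 s" using scale[of b r 1 s] by simp
          also have "\<dots> \<le> \<bar>b\<bar> powr p * e r 1 (\<tau> / b)" by (intro mult_left_mono smin) simp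
          also have "\<dots> = e (b * r) b \<tau>" using scale[of b r 1 "\<tau> / b"] b by simp
          finally show ?thesis .
        qed
        ultimately show ?thesis by (rule slice_min_unique)
      qed
      have "0 < s" using r rs by linarith
      then show False using t1 t2 ab by simp
    qed
    then show ?thesis using x0 xy by simp
  qed
qed

definition cell_invariant :: "(real \<Rightarrow> real \<Rightarrow> real \<Rightarrow> bool) \<Rightarrow> bool" where
  "cell_invariant A \<longleftrightarrow>
    (\<forall>a b c s r. A a b c \<longrightarrow> A (s * a + r) (s * b + r) (s * c + r)) \<and>
    closed {z. A (fst z) (fst (snd z)) (snd (snd z))} \<and>
    (\<forall>a b c x y t. A a b c \<longrightarrow> minimizer a b c x y t \<longrightarrow> A a x y \<and> A x b t \<and> A y t c)"

lemma cell_invariant_affine: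
  "cell_invariant A \<Longrightarrow> A a b c \<Longrightarrow> A (s * a + r) (s * b + r) (s * c + r)"
  unfolding cell_invariant_def by blast

lemma cell_invariant_closed:
  "cell_invariant A \<Longrightarrow> closed {z. A (fst z) (fst (snd z)) (snd (snd z))}"
  unfolding cell_invariant_def by blast

lemma cell_invariant_cells:
  "cell_invariant A \<Longrightarrow> A a b c \<Longrightarrow> minimizer a b c x y t \<Longrightarrow> A a x y \<and> A x b t \<and> A y t c"
  unfolding cell_invariant_def by blast

lemma cell_invariant_swap12: "cell_invariant A \<Longrightarrow> cell_invariant (\<lambda>a b c. A b a c)"
proof -
  assume A: "cell_invariant A"
  have "closed ((\<lambda>z. (fst (snd z), fst z, snd (snd z))) -` {z. A (fst z) (fst (snd z)) (snd (snd z))})"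
    by (intro closed_vimage continuous_intros cell_invariant_closed[OF A])
  then have "closed {z. A (fst (snd z)) (fst z) (snd (snd z))}" by (simp add: vimage_def)
  moreover have "A x a y \<and> A b x t \<and> A t y c" if "A b a c" "minimizer a b c x y t" for a b c x y t
  proof -
    have "e x b t = e b x t" "e a x y = e x a y" "e y t c = e t y c" "e a b c = e b a c" by (rule swap12)+
    then have "minimizer b a c x t y" using that(2) by (simp add: refined_def ac_simps)
    then show ?thesis using cell_invariant_cells[OF A that(1)] by blast
  qed
  moreover have "A (s * b + r) (s * a + r) (s * c + r)" if "A b a c" for a b c s r
    by (rule cell_invariant_affine[OF A that])
  ultimately show ?thesis unfolding cell_invariant_def by blast
qed

lemma cell_invariant_swap13: "cell_invariant A \<Longrightarrow> cell_invariant (\<lambda>a b c. A c b a)"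
proof -
  assume A: "cell_invariant A"
  have "closed ((\<lambda>z. (snd (snd z), fst (snd z), fst z)) -` {z. A (fst z) (fst (snd z)) (snd (snd z))})"
    by (intro closed_vimage continuous_intros cell_invariant_closed[OF A])
  then have "closed {z. A (snd (snd z)) (fst (snd z)) (fst z)}" by (simp add: vimage_def)
  moreover have "A y x a \<and> A t b x \<and> A c t y" if "A c b a" "minimizer a b c x y t" for a b c x y t
  proof -
    have "e x b t = e t b x" "e a x y = e y x a" "e y t c = e c t y" "e a b c = e c b a" by (rule swap13)+
    then have "minimizer c b a t y x" using that(2) by (simp add: refined_def ac_simps)
    then show ?thesis using cell_invariant_cells[OF A that(1)] by blast
  qed
  moreover have "A (s * c + r) (s * b + r) (s * a + r)" if "A c b a" for a b c s r
    by (rule cell_invariant_affine[OF A that])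
  ultimately show ?thesis unfolding cell_invariant_def by blast
qed

text \<open>
  Among the functions \<open>0, \<alpha>, \<beta>\<close> in \<open>A\<close> with maximum \<open>1\<close> there is one that maximizes the minimum
  of \<open>\<alpha>\<close> and \<open>\<beta>\<close>, and the strict improvement on the first cell leaves only \<open>\<alpha> = \<beta> = 1\<close>.
\<close>

lemma cell_invariant_corner:
  assumes A: "cell_invariant A" and Aab: "A 0 a b" and ab: "0 \<le> a" "0 \<le> b" "a \<noteq> 0 \<or> b \<noteq> 0"
  shows "A 0 1 1"
proof -
  have cone: "A 0 (s * a) (s * b)" if "A 0 a b" for a b s
    using cell_invariant_affine[OF A that, of s 0] by simp
  have cell: "A a x y" if "A a b c" "minimizer a b c x y t" for a b c x y t
    using cell_invariant_cells[OF A that] by blast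
  define C where "C = ({0..1} \<times> {0..1}) \<inter> ((\<lambda>z::real \<times> real. max (fst z) (snd z)) -` {1}
    \<inter> (\<lambda>z. (0, fst z, snd z)) -` {z. A (fst z) (fst (snd z)) (snd (snd z))})"
  have C_iff: "(\<alpha>, \<beta>) \<in> C \<longleftrightarrow> 0 \<le> \<alpha> \<and> \<alpha> \<le> 1 \<and> 0 \<le> \<beta> \<and> \<beta> \<le> 1 \<and> max \<alpha> \<beta> = 1 \<and> A 0 \<alpha> \<beta>" for \<alpha> \<beta>
    by (auto simp: C_def)
  have norm: "(\<alpha> / m, \<beta> / m) \<in> C" if "A 0 \<alpha> \<beta>" "0 \<le> \<alpha>" "0 \<le> \<beta>" "0 < m" "m = max \<alpha> \<beta>" for \<alpha> \<beta> m
    using that cone[OF that(1), of "1 / m"]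
    by (auto simp: C_iff max_def field_simps split: if_splits)
  have "compact C" unfolding C_def
    by (intro compact_Int_closed compact_Times compact_Icc closed_Int closed_vimage continuous_intros
      cell_invariant_closed[OF A] closed_singleton)
  moreover have "0 < max a b" using ab by (auto simp: less_max_iff_disj)
  then have "C \<noteq> {}" using norm[OF Aab ab(1,2) _ refl] by blast
  moreover have "continuous_on C (\<lambda>z. min (fst z) (snd z))" by (intro continuous_intros)
  ultimately obtain z where z: "z \<in> C" "\<And>w. w \<in> C \<Longrightarrow> min (fst w) (snd w) \<le> min (fst z) (snd z)"
    using continuous_attains_sup[of C "\<lambda>z. min (fst z) (snd z)"] by blast
  obtain \<alpha> \<beta> where zab: "z = (\<alpha>, \<beta>)" by (cases z)
  have in_C: "0 \<le> \<alpha>" "\<alpha> \<le> 1" "0 \<le> \<beta>" "\<beta> \<le> 1" "max \<alpha> \<beta> = 1" "A 0 \<alpha> \<beta>"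
    using z(1) by (simp_all add: zab C_iff)
  have max: "min \<alpha>' \<beta>' \<le> min \<alpha> \<beta>" if "(\<alpha>', \<beta>') \<in> C" for \<alpha>' \<beta>'
    using z(2)[OF that] by (simp add: zab)
  obtain x y t where m: "minimizer 0 \<alpha> \<beta> x y t" using minimizer_exists by blast
  have Axy: "A 0 x y" using cell[OF in_C(6) m] .
  consider "\<alpha> < \<beta>" "\<beta> = 1" | "\<beta> < \<alpha>" "\<alpha> = 1" | "\<alpha> = 1" "\<beta> = 1"
  proof -
    have "\<alpha> = 1 \<or> \<beta> = 1" using in_C(5) by (auto simp: max_def split: if_splits)
    then show thesis using that in_C(2,4) by (metis less_eq_real_def)
  qed
  then show ?thesis
  proof cases
    case 1
    have i: "0 < x" "x \<le> y" "\<alpha> * y < x"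
      using minimizer_improves[OF in_C(1) 1(1) m] 1(2) by simp_all
    have "(x / y, y / y) \<in> C" using i by (intro norm[OF Axy]) auto
    then have "min (x / y) 1 \<le> \<alpha>" using max[of "x / y" 1] i 1 by simp
    moreover have "\<alpha> < x / y" using i by (simp add: field_simps)
    ultimately show ?thesis using 1 by simp
  next
    case 2
    have i: "0 < y" "y \<le> x" "\<beta> * x < y"
      using minimizer_improves[OF in_C(3) 2(1) minimizer_swap23[OF m]] 2(2) by simp_all
    have "(x / x, y / x) \<in> C" using i by (intro norm[OF Axy]) auto
    then have "min 1 (y / x) \<le> \<beta>" using max[of 1 "y / x"] i 2 by simp
    moreover have "\<beta> < y / x" using i by (simp add: field_simps)
    ultimately show ?thesis using 2 by simp
  next
    case 3
    then show ?thesis using in_C by simp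
  qed
qed

lemma cell_invariant_extremal_corner:
  assumes A: "cell_invariant A" and Aabc: "A a b c"
    and ext: "a \<le> b \<and> a \<le> c \<or> b \<le> a \<and> c \<le> a" and nc: "\<not> (a = b \<and> b = c)"
  shows "A 1 0 0"
proof -
  note aff = cell_invariant_affine[OF A]
  have "A 0 1 1"
  proof (cases "a \<le> b \<and> a \<le> c")
    case True
    then show ?thesis
      using cell_invariant_corner[OF A, of "b - a" "c - a"] aff[OF Aabc, of 1 "- a"] nc by auto
  next
    case False
    then show ?thesis
      using cell_invariant_corner[OF A, of "a - b" "a - c"] aff[OF Aabc, of "-1" a] nc ext by auto
  qed
  then show ?thesis using aff[of 0 1 1 "-1" 1] by simp
qed

lemma cell_invariant_two_corners:
  assumes A: "cell_invariant A" and Aabc: "A a b c" and nc: "\<not> (a = b \<and> b = c)"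
  shows "A 1 0 0 \<and> A 0 1 0 \<or> A 1 0 0 \<and> A 0 0 1 \<or> A 0 1 0 \<and> A 0 0 1"
proof -
  have 1: "A 1 0 0" if "a \<le> b \<and> a \<le> c \<or> b \<le> a \<and> c \<le> a"
    using cell_invariant_extremal_corner[OF A Aabc that nc] .
  have 2: "A 0 1 0" if "b \<le> a \<and> b \<le> c \<or> a \<le> b \<and> c \<le> b"
    using cell_invariant_extremal_corner[OF cell_invariant_swap12[OF A], where a = b and b = a and c = c] Aabc that nc by auto
  have 3: "A 0 0 1" if "c \<le> b \<and> c \<le> a \<or> b \<le> c \<and> a \<le> c"
    using cell_invariant_extremal_corner[OF cell_invariant_swap13[OF A], where a = c and b = b and c = a] Aabc that nc by auto
  show ?thesis using 1 2 3 by linarith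
qed

theorem eigen_form_unique:
  assumes "eigen_form p d \<rho>"
  obtains k where "0 < k" "\<And>a b c. d a b c = k * e a b c"
proof -
  interpret d: eigen_form p d \<rho> by fact
  define Q where "Q = ({-1..1} \<times> {-1..1}) \<inter> (\<lambda>z::real \<times> real. max \<bar>fst z\<bar> \<bar>snd z\<bar>) -` {1}"
  define f where "f = (\<lambda>z. d 0 (fst z) (snd z) / e 0 (fst z) (snd z))"
  have epos: "0 < e 0 (fst z) (snd z)" if "z \<in> Q" for z
    using that by (intro pos) (auto simp: Q_def)
  have "compact Q" unfolding Q_def
    by (intro compact_Int_closed compact_Times compact_Icc closed_vimage continuous_intros closed_singleton)
  moreover have "(1, 1) \<in> Q" by (simp add: Q_def)
  then have "Q \<noteq> {}" by blast
  moreover have "continuous_on Q f"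
    unfolding f_def using epos by (intro continuous_intros) force
  ultimately obtain zm zM where zm: "zm \<in> Q" "\<And>z. z \<in> Q \<Longrightarrow> f zm \<le> f z"
    and zM: "zM \<in> Q" "\<And>z. z \<in> Q \<Longrightarrow> f z \<le> f zM"
    using continuous_attains_inf[of Q f] continuous_attains_sup[of Q f] by blast
  define l L where "l = f zm" and "L = f zM"
  have bounds: "l * e a b c \<le> d a b c \<and> d a b c \<le> L * e a b c" for a b c
  proof (cases "a = b \<and> b = c")
    case False
    define m where "m = max \<bar>b - a\<bar> \<bar>c - a\<bar>"
    have m: "0 < m" using False by (auto simp: m_def)
    define z where "z = ((b - a) / m, (c - a) / m)"
    have "\<bar>b - a\<bar> \<le> m" "\<bar>c - a\<bar> \<le> m" "\<bar>b - a\<bar> = m \<or> \<bar>c - a\<bar> = m" by (auto simp: m_def max_def)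
    then have "\<bar>(b - a) / m\<bar> \<le> 1" "\<bar>(c - a) / m\<bar> \<le> 1" "max \<bar>(b - a) / m\<bar> \<bar>(c - a) / m\<bar> = 1"
      using m by (auto simp: max_def)
    then have "z \<in> Q" unfolding Q_def z_def by (auto simp del: abs_divide simp: abs_le_iff)
    then have "l \<le> f z" "f z \<le> L" "0 < e 0 (fst z) (snd z)"
      using zm zM epos by (auto simp: l_def L_def)
    then have *: "l * e 0 (fst z) (snd z) \<le> d 0 (fst z) (snd z)" "d 0 (fst z) (snd z) \<le> L * e 0 (fst z) (snd z)"
      by (simp_all add: f_def field_simps)
    have "e a b c = m powr p * e 0 (fst z) (snd z)" "d a b c = m powr p * d 0 (fst z) (snd z)"
      using affine[of m 0 a "fst z" "snd z"] d.affine[of m 0 a "fst z" "snd z"] m by (simp_all add: z_def)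
    then show ?thesis
      using mult_left_mono[OF *(1), of "m powr p"] mult_left_mono[OF *(2), of "m powr p"]
      by (simp add: ac_simps)
  next
    case True
    then have "b = a" "c = a" by auto
    then show ?thesis by (simp only: const d.const) simp
  qed
  have cone: "d (s * a + r) (s * b + r) (s * c + r) = k * e (s * a + r) (s * b + r) (s * c + r)"
    if "d a b c = k * e a b c" for a b c s r k
    unfolding affine d.affine that by (simp only: ac_simps)
  have closed: "closed {z. d (fst z) (fst (snd z)) (snd (snd z)) = k * e (fst z) (fst (snd z)) (snd (snd z))}" for k
    by (intro closed_Collect_eq continuous_intros)
  have L_inv: "cell_invariant (\<lambda>a b c. d a b c = L * e a b c)"
    unfolding cell_invariant_def
  proof (intro conjI allI impI; (rule cone closed)?; assumption?)
    fix a b c x y t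
    assume abc: "d a b c = L * e a b c" and m: "minimizer a b c x y t"
    have "\<rho> * (L * e a x y + L * e x b t + L * e y t c) = L * refined \<rho> e a b c x y t"
      unfolding refined_def by (simp add: algebra_simps)
    also have "\<dots> = d a b c" using m abc by simp
    also have "\<dots> \<le> \<rho> * (d a x y + d x b t + d y t c)"
      using d.refined_ge[of a b c x y t] unfolding refined_def .
    finally have "L * e a x y + L * e x b t + L * e y t c \<le> d a x y + d x b t + d y t c"
      using rho_pos by simp
    then show "d a x y = L * e a x y" "d x b t = L * e x b t" "d y t c = L * e y t c"
      using bounds[of a x y] bounds[of x b t] bounds[of y t c] by linarith+
  qed
  have l_inv: "cell_invariant (\<lambda>a b c. d a b c = l * e a b c)"
    unfolding cell_invariant_def
  proof (intro conjI allI impI; (rule cone closed)?; assumption?)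
    fix a b c x y t
    assume abc: "d a b c = l * e a b c" and m: "minimizer a b c x y t"
    obtain x' y' t' where m': "d.minimizer a b c x' y' t'" using d.minimizer_exists by blast
    have l0: "0 < l" unfolding l_def f_def using epos[OF zm(1)] zm(1)
      by (intro divide_pos_pos d.pos) (auto simp: Q_def)
    have "\<rho> * (d a x' y' + d x' b t' + d y' t' c) = l * e a b c"
      using m' abc unfolding refined_def by simp
    also have "\<dots> \<le> l * refined \<rho> e a b c x' y' t'"
      using l0 by (intro mult_left_mono refined_ge) simp
    also have "\<dots> = \<rho> * (l * e a x' y' + l * e x' b t' + l * e y' t' c)"
      unfolding refined_def by (simp add: algebra_simps)
    finally have le: "d a x' y' + d x' b t' + d y' t' c \<le> l * e a x' y' + l * e x' b t' + l * e y' t' c"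
      using rho_pos by simp
    then have eq: "d a x' y' = l * e a x' y'" "d x' b t' = l * e x' b t'" "d y' t' c = l * e y' t' c"
      using bounds[of a x' y'] bounds[of x' b t'] bounds[of y' t' c] by linarith+
    have "l * refined \<rho> e a b c x' y' t' = refined \<rho> d a b c x' y' t'"
      unfolding refined_def eq by (simp add: algebra_simps)
    also have "\<dots> = l * e a b c" using m' abc by simp
    finally have "minimizer a b c x' y' t'" using l0 by simp
    then have "x' = x" "y' = y" "t' = t" using minimizer_unique[OF m] by auto
    then show "d a x y = l * e a x y" "d x b t = l * e x b t" "d y t c = l * e y t c" using eq by simp_all
  qed
  have z_eq: "d 0 (fst z) (snd z) = f z * e 0 (fst z) (snd z)" if "z \<in> Q" for z
    using epos[OF that] by (simp add: f_def)
  have nc: "\<not> (0 = fst z \<and> fst z = snd z)" if "z \<in> Q" for z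
    using that by (auto simp: Q_def)
  note LL = cell_invariant_two_corners[OF L_inv z_eq[OF zM(1), folded L_def] nc[OF zM(1)]]
  note ll = cell_invariant_two_corners[OF l_inv z_eq[OF zm(1), folded l_def] nc[OF zm(1)]]
  have "l = L"
  proof -
    have "0 < e 1 0 0" "0 < e 0 1 0" "0 < e 0 0 1" by (rule pos, simp)+
    then show ?thesis using LL ll by auto
  qed
  then have "d a b c = l * e a b c" for a b c using bounds[of a b c] by simp
  moreover have "0 < l" unfolding l_def f_def using epos[OF zm(1)] zm(1)
      by (intro divide_pos_pos d.pos) (auto simp: Q_def)
  ultimately show thesis using that by blast
qed

end

section \<open>Geometry of the gasket\<close>

lemma sg_map_eq: "sg_map q i x = (1 / 2) *\<^sub>R (q i + x)"
proof -
  have "q i + (1 / 2) *\<^sub>R (x - q i) = (1 - 1 / 2) *\<^sub>R q i + (1 / 2) *\<^sub>R x"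
    by (simp only: scaleR_diff_right scaleR_diff_left scaleR_one) simp
  then show ?thesis by (simp add: sg_map_def scaleR_add_right)
qed

lemma finite_S: "finite S" and S_nonempty: "S \<noteq> {}"
  by (simp_all add: S_def)

lemma dist_sg_map: "dist (sg_map q i x) (sg_map q i y) = dist x y / 2"
  by (simp add: sg_map_def dist_norm flip: scaleR_right_diff_distrib)

lemma continuous_sg_map: "continuous_on A (sg_map q i)"
  unfolding sg_map_def by (intro continuous_intros)

lemma gasket_subset:
  assumes K: "is_gasket q K" and L: "is_gasket q L"
  shows "K \<subseteq> L"
proof -
  have "K \<noteq> {}" "compact K" "L \<noteq> {}" "closed L"
    using K L by (auto simp: is_gasket_def compact_imp_closed)
  moreover have "continuous_on K (\<lambda>x. infdist x L)" by (intro continuous_intros)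
  ultimately obtain x where x: "x \<in> K" "\<And>y. y \<in> K \<Longrightarrow> infdist y L \<le> infdist x L"
    using continuous_attains_sup[of K "\<lambda>x. infdist x L"] by blast
  obtain i y where iy: "i \<in> S" "y \<in> K" "x = sg_map q i y"
    using x(1) K unfolding is_gasket_def by blast
  have "infdist x L \<le> infdist y L / 2"
  proof -
    obtain z where z: "z \<in> L" "infdist y L = dist y z"
      using infdist_attains_inf[OF \<open>closed L\<close> \<open>L \<noteq> {}\<close>] by blast
    have "sg_map q i z \<in> L" using L iy z unfolding is_gasket_def by blast
    then have "infdist x L \<le> dist x (sg_map q i z)" by (rule infdist_le)
    then show ?thesis using z iy by (simp add: dist_sg_map)
  qed
  also have "\<dots> \<le> infdist x L / 2" using x(2)[OF iy(2)] by simp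
  finally have "infdist x L \<le> 0" by simp
  then have "infdist y L = 0" if "y \<in> K" for y
    using x(2)[OF that] infdist_nonneg[of y L] by linarith
  then show ?thesis
    using in_closed_iff_infdist_zero[OF \<open>closed L\<close> \<open>L \<noteq> {}\<close>] by blast
qed

lemma gasket_unique: "is_gasket q K \<Longrightarrow> is_gasket q L \<Longrightarrow> K = L"
  by (intro antisym gasket_subset)

locale gasket =
  fixes q :: "nat \<Rightarrow> real ^ 2" and K :: "(real ^ 2) set"
  assumes equi: "equilateral q" and gasket: "is_gasket q K"
begin

abbreviation f :: "nat \<Rightarrow> real ^ 2 \<Rightarrow> real ^ 2" where "f \<equiv> sg_map q"

lemma K_nonempty: "K \<noteq> {}" and K_compact: "compact K" and K_eq: "K = (\<Union>i\<in>S. f i ` K)"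
  using gasket by (simp_all add: is_gasket_def)

lemma f_mem: "i \<in> S \<Longrightarrow> x \<in> K \<Longrightarrow> f i x \<in> K"
  using K_eq by blast

lemma K_cases:
  assumes "x \<in> K"
  obtains i y where "i \<in> S" "y \<in> K" "x = f i y"
  using assms K_eq by blast

definition side :: real where "side = dist (q 1) (q 2)"

lemma dist_q: "i \<in> S \<Longrightarrow> j \<in> S \<Longrightarrow> i \<noteq> j \<Longrightarrow> dist (q i) (q j) = side"
  and side_pos: "0 < side"
proof -
  obtain d where d: "0 < d" "\<And>i j. i \<in> S \<Longrightarrow> j \<in> S \<Longrightarrow> i \<noteq> j \<Longrightarrow> dist (q i) (q j) = d"
    using equi unfolding equilateral_def by blast
  then have "side = d" by (simp add: side_def S_def)
  with d show "i \<in> S \<Longrightarrow> j \<in> S \<Longrightarrow> i \<noteq> j \<Longrightarrow> dist (q i) (q j) = side" "0 < side" by simp_all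
qed

lemma q_inj: "i \<in> S \<Longrightarrow> j \<in> S \<Longrightarrow> q i = q j \<longleftrightarrow> i = j"
  using dist_q[of i j] side_pos by force

lemma q_mem: "i \<in> S \<Longrightarrow> q i \<in> K"
proof -
  assume i: "i \<in> S"
  obtain x where x: "x \<in> K" "\<And>y. y \<in> K \<Longrightarrow> dist (q i) x \<le> dist (q i) y"
    using distance_attains_inf[OF compact_imp_closed[OF K_compact] K_nonempty] by blast
  have fq: "f i (q i) = q i" by (simp add: sg_map_def)
  have "dist (q i) x \<le> dist (q i) (f i x)" using x f_mem[OF i x(1)] by blast
  also have "\<dots> = dist (q i) x / 2" using dist_sg_map[of q i "q i" x] by (simp add: fq)
  finally have "q i = x" by simp
  then show ?thesis using x by simp
qed

lemma inner_edges:
  assumes "i \<in> S" "j \<in> S" "k \<in> S" "i \<noteq> j" "i \<noteq> k" "j \<noteq> k"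
  shows "(q j - q i) \<bullet> (q k - q i) = side\<^sup>2 / 2"
proof -
  have "(norm ((q j - q i) - (q k - q i)))\<^sup>2 = (norm (q j - q i))\<^sup>2 + (norm (q k - q i))\<^sup>2 - 2 * ((q j - q i) \<bullet> (q k - q i))"
    by (simp add: power2_norm_eq_inner inner_diff inner_commute)
  then show ?thesis
    using dist_q[of j k] dist_q[of j i] dist_q[of k i] assms by (simp add: dist_norm)
qed

text \<open>The barycentric coordinate with respect to the \<open>i\<close>-th vertex.\<close>

definition height :: "nat \<Rightarrow> real ^ 2 \<Rightarrow> real" where
  "height i x = 1 + (2 / (3 * side\<^sup>2)) * ((x - q i) \<bullet> (\<Sum>j\<in>S. q i - q j))"

lemma height_affine: "height i (f j x) = (height i x + height i (q j)) / 2"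
proof -
  have "f j x - q i = (1 / 2) *\<^sub>R ((x - q i) + (q j - q i))"
    by (simp add: vec_eq_iff sg_map_eq field_simps)
  note e = this
  have "1 + c * ((1 / 2) * (A + B)) = (1 + c * A + (1 + c * B)) / 2" for A B c :: real
    by (simp add: field_simps)
  then show ?thesis unfolding height_def e inner_scaleR_left inner_add_left .
qed

lemma height_vertex: "i \<in> S \<Longrightarrow> j \<in> S \<Longrightarrow> height i (q j) = (if i = j then 1 else 0)"
proof (cases "i = j")
  case False
  assume ij: "i \<in> S" "j \<in> S"
  then obtain k where k: "k \<in> S" "k \<noteq> i" "k \<noteq> j" "S = {i, j, k}"
    using False unfolding S_def by force
  have "(q j - q i) \<bullet> (\<Sum>l\<in>S. q i - q l) = - ((q j - q i) \<bullet> (q j - q i)) - (q j - q i) \<bullet> (q k - q i)"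
  proof -
    have "(\<Sum>l\<in>S. q i - q l) = - (q j - q i) - (q k - q i)"
      unfolding k(4) using k(2,3) False by simp
    then show ?thesis by (simp only: inner_diff_right inner_minus_right)
  qed
  also have "(q j - q i) \<bullet> (q j - q i) = side\<^sup>2"
    using dist_q[of j i] ij False by (simp add: dist_norm flip: power2_norm_eq_inner)
  also have "(q j - q i) \<bullet> (q k - q i) = side\<^sup>2 / 2"
    using inner_edges k ij False by simp
  finally show ?thesis using False side_pos by (simp add: height_def field_simps)
qed (simp add: height_def)

lemma continuous_height: "continuous_on A (height i)"
  unfolding height_def by (intro continuous_intros)

lemma height_bounds:
  assumes i: "i \<in> S" and x: "x \<in> K"
  shows "0 \<le> height i x" "height i x \<le> 1"
proof -
  obtain y where y: "y \<in> K" "\<And>z. z \<in> K \<Longrightarrow> height i z \<le> height i y"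
    using continuous_attains_sup[OF K_compact K_nonempty continuous_height] by blast
  obtain j z where jz: "j \<in> S" "z \<in> K" "y = f j z" using K_cases[OF y(1)] .
  have "height i y \<le> (height i y + 1) / 2"
    using y(2)[OF jz(2)] height_vertex[OF i jz(1)] by (simp add: jz(3) height_affine split: if_splits)
  then show "height i x \<le> 1" using y(2)[OF x] by simp
  obtain y where y: "y \<in> K" "\<And>z. z \<in> K \<Longrightarrow> height i y \<le> height i z"
    using continuous_attains_inf[OF K_compact K_nonempty continuous_height] by blast
  obtain j z where jz: "j \<in> S" "z \<in> K" "y = f j z" using K_cases[OF y(1)] .
  have "height i y / 2 \<le> height i y"
    using y(2)[OF jz(2)] height_vertex[OF i jz(1)] by (simp add: jz(3) height_affine split: if_splits)
  then show "0 \<le> height i x" using y(2)[OF x] by simp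
qed

lemma height_eq_1:
  assumes i: "i \<in> S" and x: "x \<in> K" and h: "height i x = 1"
  shows "x = q i"
proof -
  define C where "C = K \<inter> height i -` {1}"
  have "compact C" unfolding C_def
    by (intro compact_Int_closed K_compact closed_vimage continuous_height closed_singleton)
  moreover have "C \<noteq> {}" using x h by (auto simp: C_def)
  moreover have "continuous_on C (\<lambda>y. dist y (q i))" by (intro continuous_intros)
  ultimately obtain y where y: "y \<in> C" "\<And>z. z \<in> C \<Longrightarrow> dist z (q i) \<le> dist y (q i)"
    using continuous_attains_sup[of C "\<lambda>y. dist y (q i)"] by blast
  then obtain j z where jz: "j \<in> S" "z \<in> K" "y = f j z" using K_cases[of y] by (auto simp: C_def)
  have "(height i z + height i (q j)) / 2 = 1" using y(1) by (simp add: C_def jz(3) height_affine)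
  then have "height i z = 1 \<and> j = i"
    using height_bounds[OF i jz(2)] height_vertex[OF i jz(1)] by (auto split: if_splits)
  then have "z \<in> C" "y = f i z" using jz by (simp_all add: C_def)
  moreover have "f i (q i) = q i" by (simp add: sg_map_def)
  ultimately have "dist y (q i) = dist z (q i) / 2" using dist_sg_map[of q i z "q i"] by simp
  with y(2)[OF \<open>z \<in> C\<close>] have "dist y (q i) \<le> 0" using zero_le_dist[of z "q i"] by linarith
  then show ?thesis using y(2)[of x] x h zero_le_dist[of x "q i"] by (simp add: C_def)
qed

lemma midpoint_swap: "f i (q j) = f j (q i)"
  by (simp add: sg_map_eq add.commute)

lemma cells_meet:
  assumes i: "i \<in> S" and j: "j \<in> S" and ij: "i \<noteq> j" and x: "x \<in> K" and y: "y \<in> K"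
    and eq: "f i x = f j y"
  shows "x = q j \<and> y = q i"
proof -
  have *: "y = q i" if "i \<in> S" "j \<in> S" "i \<noteq> j" "x \<in> K" "y \<in> K" "f i x = f j y" for i j x y
  proof -
    have "(height i x + 1) / 2 = height i y / 2"
      using arg_cong[OF that(6), of "height i"] that(3) height_vertex[OF that(1,1)] height_vertex[OF that(1,2)]
      by (simp add: height_affine)
    then have "height i y = 1"
      using height_bounds[OF that(1,4)] height_bounds[OF that(1,5)] by simp
    then show ?thesis using height_eq_1[OF that(1,5)] by simp
  qed
  show ?thesis using *[OF i j ij x y eq] *[OF j i ij[symmetric] y x eq[symmetric]] by simp
qed

lemma reflection:
  assumes i: "i \<in> S" and j: "j \<in> S" and ij: "i \<noteq> j"
  obtains g where "g \<in> isometries K" "g (q i) = q j" "g (q j) = q i"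
    "\<And>k. k \<in> S \<Longrightarrow> k \<noteq> i \<Longrightarrow> k \<noteq> j \<Longrightarrow> g (q k) = q k"
proof -
  define n where "n = q i - q j"
  have nn: "n \<bullet> n = side\<^sup>2"
    using dist_q[OF i j ij] by (simp add: n_def dist_norm flip: power2_norm_eq_inner)
  define c where "c = 2 / side\<^sup>2"
  have cn: "c * (n \<bullet> n) = 2" using side_pos by (simp add: c_def nn)
  define l where "l = (\<lambda>z. z - (c * (z \<bullet> n)) *\<^sub>R n)"
  define m where "m = (1/2) *\<^sub>R (q i + q j)"
  define g where "g = (\<lambda>x. m + l (x - m))"
  have l_diff: "l x - l y = l (x - y)" for x y by (simp add: l_def algebra_simps inner_diff_left)
  have l_scale: "l (a *\<^sub>R x) = a *\<^sub>R l x" for a x by (simp add: l_def algebra_simps)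
  have l_add: "l x + l y = l (x + y)" for x y by (simp add: l_def algebra_simps inner_add_left)
  have l_norm: "norm (l z) = norm z" for z
  proof -
    have "(norm (l z))\<^sup>2 = z \<bullet> z - 2 * (c * (z \<bullet> n)) * (z \<bullet> n) + (c * (z \<bullet> n)) * (z \<bullet> n) * (c * (n \<bullet> n))"
      unfolding power2_norm_eq_inner l_def by (simp add: inner_diff inner_commute algebra_simps)
    also have "\<dots> = (norm z)\<^sup>2" unfolding cn power2_norm_eq_inner by simp
    finally show ?thesis by simp
  qed
  have l_invol: "l (l z) = z" for z
  proof -
    have "l (l z) = z - (2 * (c * (z \<bullet> n))) *\<^sub>R n + (c * (z \<bullet> n) * (c * (n \<bullet> n))) *\<^sub>R n"
      unfolding l_def inner_diff_left inner_scaleR_left by (simp add: vec_eq_iff algebra_simps)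
    then show ?thesis by (simp only: cn) (simp add: algebra_simps)
  qed
  have g_dist: "dist (g x) (g y) = dist x y" for x y
    by (simp add: g_def dist_norm l_diff l_norm)
  have g_invol: "g (g x) = x" for x by (simp add: g_def l_invol)
  have ln: "l n = - n" unfolding l_def using cn by (simp add: scaleR_2)
  have "q i - m = (1/2) *\<^sub>R n" "q j - m = (-(1/2)) *\<^sub>R n"
    by (simp_all add: m_def n_def algebra_simps flip: scaleR_left_distrib)
  then have "g (q i) = m + (- (1/2)) *\<^sub>R n" "g (q j) = m + (1/2) *\<^sub>R n"
    by (simp_all only: g_def l_scale ln) simp_all
  then have gi: "g (q i) = q j" and gj: "g (q j) = q i"
    by (simp_all add: m_def n_def algebra_simps flip: scaleR_left_distrib)
  have gk: "g (q k) = q k" if k: "k \<in> S" "k \<noteq> i" "k \<noteq> j" for k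
  proof -
    have "(q k - m) \<bullet> n = ((q k - q j) \<bullet> (q k - q j) - (q k - q i) \<bullet> (q k - q i)) / 2"
      by (simp add: m_def n_def inner_diff inner_add_left inner_add_right inner_commute field_simps)
    also have "\<dots> = 0"
      using dist_q[of k j] dist_q[of k i] k i j by (simp add: dist_norm flip: power2_norm_eq_inner)
    finally show ?thesis by (simp add: g_def l_def)
  qed
  define \<sigma> where "\<sigma> = (\<lambda>k. if k = i then j else if k = j then i else k)"
  have \<sigma>: "\<sigma> ` S = S" using i j by (auto simp: \<sigma>_def image_iff)
  have g_q: "g (q k) = q (\<sigma> k)" if "k \<in> S" for k using gi gj gk that by (auto simp: \<sigma>_def)
  have g_f: "g (f k x) = f (\<sigma> k) (g x)" if "k \<in> S" for k x
  proof -
    have "l (f k x - m) = (1/2) *\<^sub>R (l (q k - m) + l (x - m))"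
      unfolding l_scale[symmetric] l_add by (rule arg_cong[of _ _ l],
        unfold sg_map_eq vec_eq_iff vector_add_component vector_minus_component vector_scaleR_component,
        simp add: field_simps)
    then have "g (f k x) = (1/2) *\<^sub>R (g (q k) + g x)"
      unfolding g_def vec_eq_iff vector_add_component vector_scaleR_component
      by (simp add: field_simps)
    then show ?thesis using g_q[OF that] by (simp add: sg_map_eq)
  qed
  have g_cont: "continuous_on K g" unfolding g_def l_def by (intro continuous_intros)
  have "g ` K = (\<Union>k\<in>S. g ` f k ` K)" by (subst K_eq) (simp add: image_UN)
  also have "\<dots> = (\<Union>k\<in>S. f (\<sigma> k) ` g ` K)"
    using g_f by (intro SUP_cong refl) (simp add: image_image)
  also have "\<dots> = (\<Union>k\<in>\<sigma> ` S. f k ` g ` K)" by simp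
  finally have "g ` K = (\<Union>k\<in>S. f k ` g ` K)" unfolding \<sigma> .
  then have "is_gasket q (g ` K)"
    using K_nonempty compact_continuous_image[OF g_cont K_compact] by (simp add: is_gasket_def)
  then have "g ` K = K" using gasket_unique gasket by blast
  moreover have "inj_on g K" by (metis g_invol inj_onI)
  ultimately have "g \<in> isometries K" by (simp add: isometries_def bij_betw_def g_dist)
  then show thesis using that gi gj gk by blast
qed

lemma V0_subset: "V0 q \<subseteq> K"
  using q_mem by (auto simp: V0_def)

lemma words_0: "words 0 = {[]}"
  by (auto simp: words_def)

lemma words_Suc: "words (Suc n) = (\<Union>i\<in>S. (#) i ` words n)"
  by (auto simp: words_def length_Suc_conv image_iff)

lemma finite_words: "finite (words n)"
  by (induction n) (simp_all add: words_0 words_Suc finite_S)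

lemma word_map_Cons: "word_map q (i # w) x = f i (word_map q w x)"
  by (simp add: word_map_def)

lemma V_0: "V q 0 = V0 q"
  by (simp add: V_def words_0 word_map_def)

lemma V_Suc: "V q (Suc n) = (\<Union>i\<in>S. f i ` V q n)"
proof -
  have "V q (Suc n) = (\<Union>i\<in>S. \<Union>w\<in>words n. word_map q (i # w) ` V0 q)"
    by (simp add: V_def words_Suc)
  also have "\<dots> = (\<Union>i\<in>S. f i ` V q n)"
    by (simp add: V_def image_UN image_image word_map_Cons)
  finally show ?thesis .
qed

lemma V_subset_K: "V q n \<subseteq> K"
proof (induction n)
  case (Suc n)
  then show ?case using f_mem by (auto simp: V_Suc)
qed (use V0_subset V_0 in auto)

lemma V_mono_Suc: "V q n \<subseteq> V q (Suc n)"
proof (induction n)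
  case 0
  have *: "q i \<in> f i ` V0 q" if "i \<in> S" for i
    using that by (intro image_eqI[of _ _ "q i"]) (auto simp: V0_def sg_map_def)
  show ?case
  proof
    fix x assume "x \<in> V q 0"
    then obtain i where "i \<in> S" "x = q i" by (auto simp: V_0 V0_def)
    then show "x \<in> V q (Suc 0)" using * unfolding V_Suc V_0 by blast
  qed
next
  case (Suc n)
  have "(\<Union>i\<in>S. f i ` V q n) \<subseteq> (\<Union>i\<in>S. f i ` V q (Suc n))"
    by (intro UN_mono image_mono Suc order_refl)
  then show ?case unfolding V_Suc[of n] V_Suc[of "Suc n"] .
qed

lemma V_mono: "m \<le> n \<Longrightarrow> V q m \<subseteq> V q n"
  by (rule lift_Suc_mono_le[of "V q"]) (rule V_mono_Suc)

lemma vertex_mem_V: "i \<in> S \<Longrightarrow> q i \<in> V q n"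
  using V_mono[of 0 n] by (auto simp: V_0 V0_def)

lemma word_map_mem_V: "w \<in> words n \<Longrightarrow> x \<in> V0 q \<Longrightarrow> word_map q w x \<in> V q n"
  by (auto simp: V_def)

lemma renorm_0: "renorm q \<rho> 0 E u = E (restrict u (V0 q))"
  by (simp add: renorm_def words_0 word_map_def)

lemma renorm_Suc: "renorm q \<rho> (Suc n) E u = (\<Sum>i\<in>S. \<rho> * renorm q \<rho> n E (u \<circ> f i))"
proof -
  have "renorm q \<rho> (Suc n) E u = (\<Sum>i\<in>S. \<Sum>w\<in>(#) i ` words n.
      \<rho> ^ Suc n * E (restrict (u \<circ> word_map q w) (V0 q)))"
    unfolding renorm_def words_Suc
    by (rule sum.UNION_disjoint) (auto simp: finite_S finite_words)
  also have "\<dots> = (\<Sum>i\<in>S. \<Sum>w\<in>words n. \<rho> ^ Suc n * E (restrict (u \<circ> word_map q (i # w)) (V0 q)))"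
    by (rule sum.cong[OF refl], subst sum.reindex) (auto simp: inj_on_def)
  also have "\<dots> = (\<Sum>i\<in>S. \<rho> * renorm q \<rho> n E (u \<circ> f i))"
    by (simp add: renorm_def sum_distrib_left mult.assoc word_map_Cons comp_def)
  finally show ?thesis .
qed

lemma renorm_cong:
  assumes "\<And>x. x \<in> V q n \<Longrightarrow> u x = v x"
  shows "renorm q \<rho> n E u = renorm q \<rho> n E v"
  unfolding renorm_def
proof (intro sum.cong refl)
  fix w assume w: "w \<in> words n"
  have "restrict (u \<circ> word_map q w) (V0 q) = restrict (v \<circ> word_map q w) (V0 q)"
    using assms word_map_mem_V[OF w] by auto
  then show "\<rho> ^ n * E (restrict (u \<circ> word_map q w) (V0 q)) = \<rho> ^ n * E (restrict (v \<circ> word_map q w) (V0 q))"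
    by simp
qed

lemma renorm_restrict: "renorm q \<rho> n E (restrict u (V q n)) = renorm q \<rho> n E u"
  by (rule renorm_cong) simp

end

section \<open>The trace on three points\<close>

locale three_point_trace = resistance_form_gt_1 +
  fixes z1 z2 z3 :: 'a
  assumes z_mem: "z1 \<in> X" "z2 \<in> X" "z3 \<in> X"
    and z_distinct: "z1 \<noteq> z2" "z1 \<noteq> z3" "z2 \<noteq> z3"
begin

lemma separating_function:
  assumes "x \<in> X" "y \<in> X" "x \<noteq> y"
  obtains u where "u \<in> F" "u x = 0" "u y = 1" "\<And>z. z \<in> X \<Longrightarrow> 0 \<le> u z \<and> u z \<le> 1"
proof -
  obtain v where v: "v \<in> F" "v x \<noteq> v y" using RF3 assms by blast
  define w where "w = (\<lambda>z\<in>X. (1 / (v y - v x)) * v z + (- v x / (v y - v x)))"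
  have w: "w \<in> F" unfolding w_def by (rule affine_mem[OF v(1)])
  have wxy: "w x = 0" "w y = 1"
    using v(2) assms by (simp_all add: w_def flip: add_divide_distrib diff_divide_distrib)
  show thesis
    by (rule that[of "\<lambda>z\<in>X. max 0 (min 1 (w z))"]) (use clip_mem[OF w] assms wxy in auto)
qed

lemma indicator_function:
  assumes "x \<in> X" "y \<in> X" "z \<in> X" "x \<noteq> y" "x \<noteq> z"
  obtains u where "u \<in> F" "u x = 1" "u y = 0" "u z = 0"
proof -
  obtain v where v: "v \<in> F" "v x = 0" "v y = 1" "\<And>z. z \<in> X \<Longrightarrow> 0 \<le> v z \<and> v z \<le> 1"
    using separating_function[of x y] assms by blast
  obtain w where w: "w \<in> F" "w x = 0" "w z = 1" "\<And>z. z \<in> X \<Longrightarrow> 0 \<le> w z \<and> w z \<le> 1"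
    using separating_function[of x z] assms by blast
  have m: "(\<lambda>a\<in>X. (-1) * (\<lambda>a\<in>X. max (v a) (w a)) a + 1) \<in> F"
    by (intro affine_mem max_mem v w)
  show thesis
  proof (rule that[OF m])
    have "w y \<le> 1" "v z \<le> 1" using v w assms by blast+
    then have "max (v y) (w y) = 1" "max (v z) (w z) = 1" "max (v x) (w x) = 0"
      using v(2,3) w(2,3) by (simp_all add: max_absorb1 max_absorb2)
    then show "(\<lambda>a\<in>X. (-1) * (\<lambda>a\<in>X. max (v a) (w a)) a + 1) x = 1"
      "(\<lambda>a\<in>X. (-1) * (\<lambda>a\<in>X. max (v a) (w a)) a + 1) y = 0"
      "(\<lambda>a\<in>X. (-1) * (\<lambda>a\<in>X. max (v a) (w a)) a + 1) z = 0"
      using assms by simp_all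
  qed
qed

lemma extension_exists: "\<exists>v\<in>F. v z1 = a \<and> v z2 = b \<and> v z3 = c"
proof -
  obtain u1 where u1: "u1 \<in> F" "u1 z1 = 1" "u1 z2 = 0" "u1 z3 = 0"
    using indicator_function[of z1 z2 z3] z_mem z_distinct by blast
  obtain u2 where u2: "u2 \<in> F" "u2 z2 = 1" "u2 z1 = 0" "u2 z3 = 0"
    using indicator_function[of z2 z1 z3] z_mem z_distinct by blast
  obtain u3 where u3: "u3 \<in> F" "u3 z3 = 1" "u3 z1 = 0" "u3 z2 = 0"
    using indicator_function[of z3 z1 z2] z_mem z_distinct by blast
  let ?w = "\<lambda>x\<in>X. a * u1 x + b * u2 x + 0"
  have "(\<lambda>x\<in>X. 1 * ?w x + c * u3 x + 0) \<in> F"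
    by (intro lincomb_mem u1 u2 u3)
  then show ?thesis using u1 u2 u3 z_mem by (intro bexI) auto
qed

definition tr :: "real \<Rightarrow> real \<Rightarrow> real \<Rightarrow> real" where
  "tr a b c = Inf {E v | v. v \<in> F \<and> v z1 = a \<and> v z2 = b \<and> v z3 = c}"

lemma tr_le: "v \<in> F \<Longrightarrow> tr (v z1) (v z2) (v z3) \<le> E v"
  unfolding tr_def by (rule cInf_lower) (auto intro!: bdd_belowI[of _ 0] nonneg)

lemma tr_nonneg: "0 \<le> tr a b c"
  unfolding tr_def using extension_exists[of a b c] by (intro cInf_greatest) (auto intro: nonneg)

lemma tr_approx:
  assumes "0 < \<epsilon>"
  obtains v where "v \<in> F" "v z1 = a" "v z2 = b" "v z3 = c" "E v < tr a b c + \<epsilon>"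
proof -
  let ?A = "{E v | v. v \<in> F \<and> v z1 = a \<and> v z2 = b \<and> v z3 = c}"
  have "Inf ?A < tr a b c + \<epsilon>"
    using assms by (simp add: tr_def)
  moreover have "?A \<noteq> {}"
    using extension_exists[of a b c] by auto
  ultimately obtain e where "e \<in> ?A" "e < tr a b c + \<epsilon>"
    using cInf_lessD[of ?A] by meson
  then show thesis using that by auto
qed

lemma resistance_bound:
  assumes "x \<in> X" "y \<in> X"
  shows "\<exists>C\<ge>0. \<forall>u\<in>F. \<bar>u x - u y\<bar> powr p \<le> C * E u"
proof -
  obtain C where C: "\<And>u. u \<in> F - const_funs X \<Longrightarrow> \<bar>u x - u y\<bar> powr p / E u \<le> C"
    using RF4[OF assms] unfolding bdd_above_def by blast
  have "\<bar>u x - u y\<bar> powr p \<le> max C 0 * E u" if u: "u \<in> F" for u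
  proof (cases "E u = 0")
    case True
    then show ?thesis using E_zero_const[OF u True assms] p_pos by simp
  next
    case False
    then have pos: "0 < E u" using nonneg[OF u] by simp
    have "\<bar>u x - u y\<bar> powr p / E u \<le> max C 0"
      using C[of u] u False E_zero_iff[OF u] by (simp add: le_max_iff_disj)
    then show ?thesis using pos by (simp add: pos_divide_le_eq)
  qed
  then show ?thesis by (intro exI[of _ "max C 0"]) simp
qed

lemma tr_eq_0:
  assumes "tr a b c = 0"
  shows "a = b \<and> b = c"
proof -
  have *: "w x = w y" if xy: "x \<in> X" "y \<in> X" and w: "\<And>v. v \<in> F \<Longrightarrow> v z1 = a \<Longrightarrow> v z2 = b \<Longrightarrow> v z3 = c
      \<Longrightarrow> v x = w x \<and> v y = w y" for x y :: 'a and w :: "'a \<Rightarrow> real"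
  proof -
    obtain C where C: "0 \<le> C" "\<forall>u\<in>F. \<bar>u x - u y\<bar> powr p \<le> C * E u"
      using resistance_bound[OF xy] by blast
    have "\<bar>w x - w y\<bar> powr p \<le> 0"
    proof (rule field_le_epsilon)
      fix \<epsilon> :: real assume \<epsilon>: "0 < \<epsilon>"
      then have "0 < \<epsilon> / (C + 1)" using C by simp
      then obtain v where v: "v \<in> F" "v z1 = a" "v z2 = b" "v z3 = c" "E v < tr a b c + \<epsilon> / (C + 1)"
        by (rule tr_approx)
      have "\<bar>w x - w y\<bar> powr p \<le> C * E v" using bspec[OF C(2) v(1)] w[OF v(1-4)] by simp
      also have "\<dots> \<le> C * (\<epsilon> / (C + 1))" using v(5) assms C by (intro mult_left_mono) auto
      also have "\<dots> \<le> 0 + \<epsilon>" using C \<epsilon> by (simp add: pos_divide_le_eq algebra_simps)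
      finally show "\<bar>w x - w y\<bar> powr p \<le> 0 + \<epsilon>" .
    qed
    then have "\<bar>w x - w y\<bar> powr p = 0" by (intro antisym) auto
    then show ?thesis by simp
  qed
  have "a = b"
    using *[of z1 z2 "\<lambda>x. if x = z1 then a else b"] z_mem z_distinct by auto
  moreover have "b = c"
    using *[of z2 z3 "\<lambda>x. if x = z2 then b else c"] z_mem z_distinct by auto
  ultimately show ?thesis by simp
qed

lemma tr_affine: "tr (s * a + r) (s * b + r) (s * c + r) = \<bar>s\<bar> powr p * tr a b c"
proof -
  have le: "tr (s * a + r) (s * b + r) (s * c + r) \<le> \<bar>s\<bar> powr p * tr a b c" for s a b c r
  proof (rule field_le_epsilon)
    fix \<epsilon> :: real assume \<epsilon>: "0 < \<epsilon>"
    define k where "k = \<bar>s\<bar> powr p"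
    have k: "0 \<le> k" by (simp add: k_def)
    have "0 < \<epsilon> / (k + 1)" using \<epsilon> k by simp
    then obtain v where v: "v \<in> F" "v z1 = a" "v z2 = b" "v z3 = c" "E v < tr a b c + \<epsilon> / (k + 1)"
      by (rule tr_approx)
    have "tr (s * a + r) (s * b + r) (s * c + r) \<le> E (\<lambda>x\<in>X. s * v x + r)"
      using tr_le[OF affine_mem[OF v(1), of s r]] v z_mem by simp
    also have "\<dots> = k * E v" using E_affine[OF v(1)] by (simp add: k_def)
    also have "\<dots> \<le> k * (tr a b c + \<epsilon> / (k + 1))" using v k by (intro mult_left_mono) auto
    also have "\<dots> = k * tr a b c + k * (\<epsilon> / (k + 1))" by (rule distrib_left)
    also have "k * (\<epsilon> / (k + 1)) \<le> \<epsilon>" using k \<epsilon> by (simp add: pos_divide_le_eq algebra_simps)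
    finally show "tr (s * a + r) (s * b + r) (s * c + r) \<le> \<bar>s\<bar> powr p * tr a b c + \<epsilon>"
      by (simp add: k_def)
  qed
  show ?thesis
  proof (cases "s = 0")
    case True
    then show ?thesis
      using le[of s a r b c] tr_nonneg[of r r r] p_pos by simp
  next
    case False
    have inv: "(1 / s) * (s * x + r) + (- (r / s)) = x" for x
      using False by (simp add: field_simps)
    have "tr a b c \<le> \<bar>1 / s\<bar> powr p * tr (s * a + r) (s * b + r) (s * c + r)"
      using le[of "1 / s" "s * a + r" "- (r / s)" "s * b + r" "s * c + r"] unfolding inv .
    then have "\<bar>s\<bar> powr p * tr a b c
        \<le> \<bar>s\<bar> powr p * (\<bar>1 / s\<bar> powr p * tr (s * a + r) (s * b + r) (s * c + r))"
      by (rule mult_left_mono) simp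
    also have "\<bar>s\<bar> powr p * (\<bar>1 / s\<bar> powr p * tr (s * a + r) (s * b + r) (s * c + r))
        = tr (s * a + r) (s * b + r) (s * c + r)"
      using False by (simp add: powr_divide)
    finally show ?thesis using le[of s a r b c] by simp
  qed
qed

lemma tr_triangle:
  "tr (a + a') (b + b') (c + c') powr (1 / p) \<le> tr a b c powr (1 / p) + tr a' b' c' powr (1 / p)"
proof -
  let ?T = "tr (a + a') (b + b') (c + c') powr (1 / p)"
  have le: "?T \<le> (tr a b c + \<epsilon>) powr (1 / p) + (tr a' b' c' + \<epsilon>) powr (1 / p)" if \<epsilon>: "0 < \<epsilon>" for \<epsilon>
  proof -
    obtain v where v: "v \<in> F" "v z1 = a" "v z2 = b" "v z3 = c" "E v < tr a b c + \<epsilon>"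
      by (rule tr_approx[OF \<epsilon>])
    obtain w where w: "w \<in> F" "w z1 = a'" "w z2 = b'" "w z3 = c'" "E w < tr a' b' c' + \<epsilon>"
      by (rule tr_approx[OF \<epsilon>])
    have "tr (a + a') (b + b') (c + c') \<le> E (\<lambda>x\<in>X. v x + w x)"
      using tr_le[OF add_mem[OF v(1) w(1)]] v w z_mem by simp
    then have "?T \<le> E (\<lambda>x\<in>X. v x + w x) powr (1 / p)"
      using tr_nonneg p_pos by - (rule powr_mono2, auto)
    also have "\<dots> \<le> E v powr (1 / p) + E w powr (1 / p)" by (rule RF1_triangle[OF v(1) w(1)])
    also have "\<dots> \<le> (tr a b c + \<epsilon>) powr (1 / p) + (tr a' b' c' + \<epsilon>) powr (1 / p)"
      using v w nonneg p_pos by (intro add_mono powr_mono2) auto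
    finally show ?thesis .
  qed
  have lim: "((\<lambda>\<epsilon>. (t + \<epsilon>) powr (1 / p)) \<longlongrightarrow> (t + 0) powr (1 / p)) (at_right 0)" if "0 \<le> t" for t :: real
  proof (rule tendsto_powr')
    show "t + 0 \<noteq> 0 \<or> 0 < 1 / p \<and> (\<forall>\<^sub>F x in at_right 0. 0 \<le> t + x)"
      using that p_pos by (auto simp: eventually_at_filter)
  qed (intro tendsto_intros)+
  have "((\<lambda>\<epsilon>. (tr a b c + \<epsilon>) powr (1 / p) + (tr a' b' c' + \<epsilon>) powr (1 / p))
      \<longlongrightarrow> (tr a b c + 0) powr (1 / p) + (tr a' b' c' + 0) powr (1 / p)) (at_right 0)"
    by (intro tendsto_add lim tr_nonneg)
  moreover have "\<forall>\<^sub>F \<epsilon> in at_right 0. ?T \<le> (tr a b c + \<epsilon>) powr (1 / p) + (tr a' b' c' + \<epsilon>) powr (1 / p)"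
    using le by (auto simp: eventually_at_filter)
  ultimately show ?thesis using tendsto_lowerbound by fastforce
qed

lemma tr_clip:
  assumes lh: "l \<le> h"
  shows "tr (max l (min h a)) (max l (min h b)) (max l (min h c)) \<le> tr a b c"
proof (rule field_le_epsilon)
  fix \<epsilon> :: real assume "0 < \<epsilon>"
  then obtain v where v: "v \<in> F" "v z1 = a" "v z2 = b" "v z3 = c" "E v < tr a b c + \<epsilon>"
    by (rule tr_approx)
  have "tr (max l (min h a)) (max l (min h b)) (max l (min h c)) \<le> E (\<lambda>x\<in>X. max l (min h (v x)))"
    using tr_le[OF clip_mem[OF v(1) lh]] v z_mem by simp
  also have "\<dots> \<le> E v" by (rule E_clip[OF v(1) lh])
  finally show "tr (max l (min h a)) (max l (min h b)) (max l (min h c)) \<le> tr a b c + \<epsilon>"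
    using v by simp
qed

lemma tr_three_point_form: "three_point_form p tr"
  by unfold_locales (rule p_gt_1 tr_nonneg tr_affine tr_eq_0 tr_triangle tr_clip; assumption)+

end

section \<open>Gluing functions on the gasket\<close>

declare One_nat_def [simp del]

context gasket
begin

lemma f_fixed: "f i (q i) = q i"
  by (simp add: sg_map_def)

lemma f_inj: "f i x = f i y \<longleftrightarrow> x = y"
  by (simp add: sg_map_def)

lemma S_mem: "1 \<in> S" "2 \<in> S" "3 \<in> S"
  by (simp_all add: S_def)

lemma sum_S: "(\<Sum>i\<in>S. g i) = g 1 + g 2 + (g 3 :: real)"
  by (simp add: S_def)

lemma vertex_distinct: "q 1 \<noteq> q 2" "q 1 \<noteq> q 3" "q 2 \<noteq> q 3"
  using q_inj S_mem by simp_all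

lemma glue_exists:
  assumes compat: "\<And>i j. i \<in> S \<Longrightarrow> j \<in> S \<Longrightarrow> i \<noteq> j \<Longrightarrow> u i (q j) = u j (q i)"
  shows "\<exists>v :: real ^ 2 \<Rightarrow> real. v \<in> extensional K \<and> (\<forall>i\<in>S. \<forall>y\<in>K. v (f i y) = u i y)"
proof -
  define P where "P = (\<lambda>x. SOME z. fst z \<in> S \<and> snd z \<in> K \<and> x = f (fst z) (snd z))"
  define v where "v = (\<lambda>x\<in>K. u (fst (P x)) (snd (P x)))"
  have "v (f i y) = u i y" if iy: "i \<in> S" "y \<in> K" for i y
  proof -
    have "\<exists>z. fst z \<in> S \<and> snd z \<in> K \<and> f i y = f (fst z) (snd z)"
      using iy by (intro exI[of _ "(i, y)"]) simp
    then have P: "fst (P (f i y)) \<in> S \<and> snd (P (f i y)) \<in> K \<and> f i y = f (fst (P (f i y))) (snd (P (f i y)))"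
      unfolding P_def by (rule someI_ex)
    obtain j z where jz: "P (f i y) = (j, z)" by (cases "P (f i y)")
    then have 1: "j \<in> S" "z \<in> K" "f i y = f j z" using P by simp_all
    have "u j z = u i y"
    proof (cases "i = j")
      case True
      then show ?thesis using 1(3) by (simp add: f_inj)
    next
      case False
      then show ?thesis using cells_meet[OF iy(1) 1(1) False iy(2) 1(2,3)] compat[OF iy(1) 1(1)] by simp
    qed
    then show ?thesis using f_mem[OF iy] by (simp add: v_def jz)
  qed
  moreover have "v \<in> extensional K" by (simp add: v_def)
  ultimately show ?thesis by blast
qed

lemma glue_continuous:
  assumes v: "\<And>i y. i \<in> S \<Longrightarrow> y \<in> K \<Longrightarrow> v (f i y) = u i y"
    and u: "\<And>i. i \<in> S \<Longrightarrow> continuous_on K (u i)"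
  shows "continuous_on K (v :: real ^ 2 \<Rightarrow> real)"
proof -
  have "continuous_on (\<Union>i\<in>S. f i ` K) v"
  proof (rule continuous_on_closed_Union[OF finite_S])
    fix i assume i: "i \<in> S"
    show "closed (f i ` K)"
      by (intro compact_imp_closed compact_continuous_image continuous_sg_map K_compact)
    have inv: "2 *\<^sub>R f i y - q i = y" for y by (simp add: sg_map_eq)
    have "continuous_on (f i ` K) (\<lambda>x. u i (2 *\<^sub>R x - q i))"
      by (rule continuous_on_compose2[OF u[OF i]]) (auto intro!: continuous_intros simp: inv)
    then show "continuous_on (f i ` K) v"
      by (rule continuous_on_eq) (auto simp: inv v[OF i])
  qed
  then show ?thesis by (simp flip: K_eq)
qed

definition mid :: "nat \<Rightarrow> nat \<Rightarrow> real ^ 2" where "mid i j = f i (q j)"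

lemma refined_eq_sum:
  "refined \<rho> e (v (q 1)) (v (q 2)) (v (q 3)) (v (mid 1 2)) (v (mid 1 3)) (v (mid 2 3))
    = (\<Sum>i\<in>S. \<rho> * e (v (f i (q 1))) (v (f i (q 2))) (v (f i (q 3))))"
proof -
  have "f 2 (q 1) = f 1 (q 2)" "f 3 (q 1) = f 1 (q 3)" "f 3 (q 2) = f 2 (q 3)" by (rule midpoint_swap)+
  then show ?thesis by (simp add: refined_def sum_S mid_def f_fixed distrib_left)
qed

definition vertex_fun :: "real \<Rightarrow> real \<Rightarrow> real \<Rightarrow> real ^ 2 \<Rightarrow> real" where
  "vertex_fun a b c z = (if z = q 1 then a else if z = q 2 then b else c)"

lemma vertex_fun_simps [simp]:
  "vertex_fun a b c (q 1) = a" "vertex_fun a b c (q 2) = b" "vertex_fun a b c (q 3) = c"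
  using vertex_distinct by (auto simp: vertex_fun_def)

lemma six_values:
  "\<exists>v :: real ^ 2 \<Rightarrow> real. v (q 1) = a \<and> v (q 2) = b \<and> v (q 3) = c \<and>
    v (mid 1 2) = x \<and> v (mid 1 3) = y \<and> v (mid 2 3) = t"
proof -
  define u where "u = (\<lambda>i::nat. if i = 1 then vertex_fun a x y else if i = 2 then vertex_fun x b t else vertex_fun y t c)"
  have "u i (q j) = u j (q i)" if "i \<in> S" "j \<in> S" "i \<noteq> j" for i j
    using that unfolding S_def by (auto simp: u_def)
  then have "\<exists>v. v \<in> extensional K \<and> (\<forall>i\<in>S. \<forall>y\<in>K. v (f i y) = u i y)"
    by (rule glue_exists)
  then obtain v where v: "\<forall>i\<in>S. \<forall>y\<in>K. v (f i y) = u i y" by blast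
  have "v (f i (q j)) = u i (q j)" if "i \<in> S" "j \<in> S" for i j
    using v that q_mem by blast
  note w = this[OF S_mem(1) S_mem(1)] this[OF S_mem(2) S_mem(2)] this[OF S_mem(3) S_mem(3)]
    this[OF S_mem(1) S_mem(2)] this[OF S_mem(1) S_mem(3)] this[OF S_mem(2) S_mem(3)]
  show ?thesis
    by (rule exI[of _ v]) (use w in \<open>simp add: f_fixed mid_def u_def\<close>)
qed

end

section \<open>The eigenform on the vertices\<close>

locale gasket_eigenform = gasket +
  fixes p \<rho> :: real and E0 :: "(real ^ 2 \<Rightarrow> real) \<Rightarrow> real"
  assumes p_gt_1: "1 < p" and rho_pos: "0 < \<rho>" and eigen: "sym_eigenform p q K \<rho> E0"
begin

sublocale E0: three_point_trace p "V0 q" E0 "extensional (V0 q)" "q 1" "q 2" "q 3"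
proof -
  interpret resistance_form p "V0 q" E0 "extensional (V0 q)"
    using eigen by (simp add: sym_eigenform_def)
  show "three_point_trace p (V0 q) E0 (extensional (V0 q)) (q 1) (q 2) (q 3)"
    by unfold_locales (use p_gt_1 S_mem vertex_distinct in \<open>auto simp: V0_def\<close>)
qed

abbreviation e :: "real \<Rightarrow> real \<Rightarrow> real \<Rightarrow> real" where "e \<equiv> E0.tr"

lemma V0_eq: "V0 q = {q 1, q 2, q 3}"
  by (simp add: V0_def S_def)

lemma E0_eq: "u \<in> extensional (V0 q) \<Longrightarrow> E0 u = e (u (q 1)) (u (q 2)) (u (q 3))"
proof -
  assume u: "u \<in> extensional (V0 q)"
  have "v = u" if "v \<in> extensional (V0 q)" "v (q 1) = u (q 1)" "v (q 2) = u (q 2)" "v (q 3) = u (q 3)" for v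
    using that u by (intro extensionalityI[of v "V0 q" u]) (auto simp: V0_eq)
  then have "{E0 v |v. v \<in> extensional (V0 q) \<and> v (q 1) = u (q 1) \<and> v (q 2) = u (q 2) \<and> v (q 3) = u (q 3)} = {E0 u}"
    using u by blast
  then show ?thesis by (simp add: E0.tr_def)
qed

lemma E0_restrict: "E0 (restrict u (V0 q)) = e (u (q 1)) (u (q 2)) (u (q 3))"
  by (subst E0_eq) (auto simp: V0_eq)

lemma renorm_1:
  "renorm q \<rho> 1 E0 v = refined \<rho> e (v (q 1)) (v (q 2)) (v (q 3)) (v (mid 1 2)) (v (mid 1 3)) (v (mid 2 3))"
  using renorm_Suc[of \<rho> 0 E0 v] unfolding refined_eq_sum
  by (simp add: renorm_0 E0_restrict flip: One_nat_def)

lemma e_eigen_form: "eigen_form p e \<rho>"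
proof -
  interpret three_point_form p e by (rule E0.tr_three_point_form)
  let ?A = "\<lambda>u. {renorm q \<rho> 1 E0 v | v. v \<in> extensional (V q 1) \<and> restrict v (V0 q) = u}"
  have Inf: "Inf (?A u) = E0 u" if "u \<in> extensional (V0 q)" for u
    using eigen that unfolding sym_eigenform_def trace_form_def by blast
  have V0_V1: "V0 q \<subseteq> V q 1" using V_mono_Suc[of 0] by (simp add: V_0 flip: One_nat_def)
  have nn: "0 \<le> renorm q \<rho> 1 E0 v" for v
    unfolding renorm_1 refined_def using rho_pos nonneg by simp
  show ?thesis
  proof
    show "0 < \<rho>" by (rule rho_pos)
  next
    fix a b c x y t :: real
    obtain v where v: "v (q 1) = a" "v (q 2) = b" "v (q 3) = c"
      "v (mid 1 2) = x" "v (mid 1 3) = y" "v (mid 2 3) = t"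
      using six_values[of a b c x y t] by blast
    have "restrict (restrict v (V q 1)) (V0 q) = restrict v (V0 q)"
      using V0_V1 by (simp add: inf.absorb2)
    then have "renorm q \<rho> 1 E0 (restrict v (V q 1)) \<in> ?A (restrict v (V0 q))" by auto
    then have "Inf (?A (restrict v (V0 q))) \<le> renorm q \<rho> 1 E0 (restrict v (V q 1))"
      by (rule cInf_lower) (auto intro!: bdd_belowI[of _ 0] nn)
    then show "e a b c \<le> refined \<rho> e a b c x y t"
      using Inf[of "restrict v (V0 q)"] v unfolding renorm_restrict renorm_1 by (simp add: E0_restrict)
  next
    fix a b c \<epsilon> :: real assume \<epsilon>: "0 < \<epsilon>"
    let ?u = "restrict (vertex_fun a b c) (V0 q)"
    have "Inf (?A ?u) < e a b c + \<epsilon>" using Inf[of ?u] \<epsilon> by (simp add: E0_restrict)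
    moreover have "?A ?u \<noteq> {}"
    proof -
      have "restrict (restrict (vertex_fun a b c) (V q 1)) (V0 q) = ?u"
        using V0_V1 by (simp add: inf.absorb2)
      then have "renorm q \<rho> 1 E0 (restrict (vertex_fun a b c) (V q 1)) \<in> ?A ?u" by auto
      then show ?thesis by blast
    qed
    ultimately obtain r where "r \<in> ?A ?u" "r < e a b c + \<epsilon>" using cInf_lessD[of "?A ?u"] by meson
    then obtain v where v: "restrict v (V0 q) = ?u" "renorm q \<rho> 1 E0 v < e a b c + \<epsilon>" by auto
    have "v z = vertex_fun a b c z" if "z \<in> V0 q" for z using v(1) that by (metis restrict_apply')
    then have "v (q 1) = a" "v (q 2) = b" "v (q 3) = c" by (simp_all add: V0_eq)
    then show "\<exists>x y t. refined \<rho> e a b c x y t < e a b c + \<epsilon>"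
      using v(2) unfolding renorm_1 by blast
  qed
qed

lemma e_permute:
  assumes "i \<in> S" "j \<in> S" "i \<noteq> j"
  shows "\<exists>g. (\<forall>u. e (u (q 1)) (u (q 2)) (u (q 3)) = e (u (g (q 1))) (u (g (q 2))) (u (g (q 3)))) \<and>
    g (q i) = q j \<and> g (q j) = q i \<and> (\<forall>k\<in>S - {i, j}. g (q k) = q k)"
proof -
  obtain g where g: "g \<in> isometries K" "g (q i) = q j" "g (q j) = q i"
    "\<And>k. k \<in> S \<Longrightarrow> k \<noteq> i \<Longrightarrow> k \<noteq> j \<Longrightarrow> g (q k) = q k"
    using reflection[OF assms] by blast
  have gV: "g z \<in> V0 q" if "z \<in> V0 q" for z
    using that g(2-4) assms unfolding V0_def by (metis imageE imageI)
  have "e (u (q 1)) (u (q 2)) (u (q 3)) = e (u (g (q 1))) (u (g (q 2))) (u (g (q 3)))" for u :: "real ^ 2 \<Rightarrow> real"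
  proof -
    have "E0 (restrict (restrict u (V0 q) \<circ> g) (V0 q)) = E0 (restrict u (V0 q))"
      using eigen g(1) unfolding sym_eigenform_def by auto
    moreover have "restrict (restrict u (V0 q) \<circ> g) (V0 q) = restrict (u \<circ> g) (V0 q)"
      using gV by auto
    ultimately show ?thesis by (simp add: E0_restrict)
  qed
  then show ?thesis using g by blast
qed

sublocale e: symmetric_eigen_form p e \<rho>
proof -
  interpret eigen_form p e \<rho> by (rule e_eigen_form)
  have ext: "restrict (vertex_fun a b c) (V0 q) \<in> extensional (V0 q)" for a b c by simp
  have one_neq_two: "(1::nat) \<noteq> 2" and two_neq_three: "(2::nat) \<noteq> 3" by simp_all
  show "symmetric_eigen_form p e \<rho>"
  proof
    fix a b c :: real
    obtain g where g: "\<forall>u. e (u (q 1)) (u (q 2)) (u (q 3)) = e (u (g (q 1))) (u (g (q 2))) (u (g (q 3)))"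
      "g (q 1) = q 2" "g (q 2) = q 1" "\<forall>k\<in>S - {1, 2}. g (q k) = q k"
      using e_permute[OF S_mem(1,2) one_neq_two] by (elim exE conjE)
    have "g (q 3) = q 3" using g(4) S_mem by simp
    then show "e a b c = e b a c" using spec[OF g(1), of "vertex_fun a b c"] by (simp add: g(2,3))
  next
    fix a b c :: real
    obtain g where g: "\<forall>u. e (u (q 1)) (u (q 2)) (u (q 3)) = e (u (g (q 1))) (u (g (q 2))) (u (g (q 3)))"
      "g (q 2) = q 3" "g (q 3) = q 2" "\<forall>k\<in>S - {2, 3}. g (q k) = q k"
      using e_permute[OF S_mem(2,3) two_neq_three] by (elim exE conjE)
    have "g (q 1) = q 1" using g(4) S_mem by simp
    then show "e a b c = e a c b" using spec[OF g(1), of "vertex_fun a b c"] by (simp add: g(2,3))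
  next
    fix a b c a' b' c' :: real
    have "(\<lambda>x\<in>V0 q. h (restrict (vertex_fun a b c) (V0 q) x) (restrict (vertex_fun a' b' c') (V0 q) x))
      = restrict (\<lambda>x. h (vertex_fun a b c x) (vertex_fun a' b' c' x)) (V0 q)" for h :: "real \<Rightarrow> real \<Rightarrow> real"
      by auto
    note h = this
    show "e (min a a') (min b b') (min c c') + e (max a a') (max b b') (max c c') \<le> e a b c + e a' b' c'"
      using E0.E_submodular[OF ext[of a b c] ext[of a' b' c']] unfolding h by (simp add: E0_restrict)
    assume "(e a b c + e a' b' c') / 2 \<le> e ((a + a') / 2) ((b + b') / 2) ((c + c') / 2)"
    then show "e ((a - a') / 2) ((b - b') / 2) ((c - c') / 2) = 0"
      using E0.E_midpoint_strict[OF ext[of a b c] ext[of a' b' c']]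
      unfolding h[of "\<lambda>x y. (x + y) / 2"] h[of "\<lambda>x y. (x - y) / 2"] by (simp add: E0_restrict)
  qed
qed

end

section \<open>Self-similar forms on the gasket\<close>

locale gasket_selfsimilar = gasket_eigenform +
  fixes E' :: "(real ^ 2 \<Rightarrow> real) \<Rightarrow> real" and F' :: "(real ^ 2 \<Rightarrow> real) set"
  assumes resistance: "resistance_form p K E' F'"
    and SSE1: "F' = {u \<in> cont_funs K. \<forall>i\<in>S. restrict (u \<circ> f i) K \<in> F'}"
    and SSE2: "\<forall>u\<in>F'. E' u = (\<Sum>i\<in>S. \<rho> * E' (restrict (u \<circ> f i) K))"
begin

sublocale T: three_point_trace p K E' F' "q 1" "q 2" "q 3"
proof -
  interpret resistance_form p K E' F' by (rule resistance)
  show "three_point_trace p K E' F' (q 1) (q 2) (q 3)"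
    by unfold_locales (rule p_gt_1 q_mem[OF S_mem(1)] q_mem[OF S_mem(2)] q_mem[OF S_mem(3)] vertex_distinct)+
qed

lemma cell_mem: "u \<in> F' \<Longrightarrow> i \<in> S \<Longrightarrow> restrict (u \<circ> f i) K \<in> F'"
  and F_continuous: "u \<in> F' \<Longrightarrow> continuous_on K u"
  and F_cont_funs: "u \<in> F' \<Longrightarrow> u \<in> cont_funs K"
proof -
  assume u: "u \<in> F'"
  have *: "u \<in> cont_funs K \<and> (\<forall>i\<in>S. restrict (u \<circ> f i) K \<in> F')" using u by (subst (asm) SSE1) blast
  show "continuous_on K u" "u \<in> cont_funs K" using * by (auto simp: cont_funs_def)
  assume "i \<in> S"
  then show "restrict (u \<circ> f i) K \<in> F'" using * by blast
qed

lemma glue_mem: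
  assumes u: "\<And>i. i \<in> S \<Longrightarrow> u i \<in> F'"
    and compat: "\<And>i j. i \<in> S \<Longrightarrow> j \<in> S \<Longrightarrow> i \<noteq> j \<Longrightarrow> u i (q j) = u j (q i)"
  shows "\<exists>v\<in>F'. (\<forall>i\<in>S. \<forall>y\<in>K. v (f i y) = u i y) \<and> E' v = (\<Sum>i\<in>S. \<rho> * E' (u i))"
proof -
  have "\<exists>v. v \<in> extensional K \<and> (\<forall>i\<in>S. \<forall>y\<in>K. v (f i y) = u i y)"
    using compat by (rule glue_exists)
  then obtain v where v: "v \<in> extensional K" "\<forall>i\<in>S. \<forall>y\<in>K. v (f i y) = u i y" by blast
  have "continuous_on K v"
    by (rule glue_continuous[of v u]) (use v(2) F_continuous[OF u] in blast)+
  then have "v \<in> cont_funs K" using v(1) by (simp add: cont_funs_def)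
  moreover have cell: "restrict (v \<circ> f i) K = u i" if "i \<in> S" for i
  proof (rule extensionalityI[of _ K])
    show "u i \<in> extensional K" by (rule T.mem_extensional[OF u[OF that]])
  qed (use v(2) that in auto)
  ultimately have vF: "v \<in> F'" using u by (subst SSE1) auto
  moreover have "E' v = (\<Sum>i\<in>S. \<rho> * E' (u i))"
    using SSE2 vF cell by simp
  ultimately show ?thesis using v(2) by blast
qed

lemma trace_eigen_form: "eigen_form p T.tr \<rho>"
proof -
  interpret three_point_form p T.tr by (rule T.tr_three_point_form)
  show ?thesis
  proof
    show "0 < \<rho>" by (rule rho_pos)
  next
    fix a b c x y t :: real
    obtain v :: "real ^ 2 \<Rightarrow> real" where v: "v (q 1) = a" "v (q 2) = b" "v (q 3) = c"
      "v (mid 1 2) = x" "v (mid 1 3) = y" "v (mid 2 3) = t"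
      using six_values[of a b c x y t] by blast
    show "T.tr a b c \<le> refined \<rho> T.tr a b c x y t"
    proof (rule field_le_epsilon)
      fix \<epsilon> :: real assume \<epsilon>: "0 < \<epsilon>"
      define \<delta> where "\<delta> = \<epsilon> / (3 * \<rho>)"
      have \<delta>: "0 < \<delta>" using \<epsilon> rho_pos by (simp add: \<delta>_def)
      have "\<exists>w. w \<in> F' \<and> (\<forall>j\<in>S. w (q j) = v (f i (q j))) \<and>
          E' w < T.tr (v (f i (q 1))) (v (f i (q 2))) (v (f i (q 3))) + \<delta>" for i
      proof -
        obtain w where "w \<in> F'" "w (q 1) = v (f i (q 1))" "w (q 2) = v (f i (q 2))" "w (q 3) = v (f i (q 3))"
          "E' w < T.tr (v (f i (q 1))) (v (f i (q 2))) (v (f i (q 3))) + \<delta>"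
          by (rule T.tr_approx[OF \<delta>])
        then show ?thesis by (intro exI[of _ w]) (simp add: S_def)
      qed
      then obtain u where u: "\<And>i. u i \<in> F'" "\<And>i j. j \<in> S \<Longrightarrow> u i (q j) = v (f i (q j))"
        "\<And>i. E' (u i) < T.tr (v (f i (q 1))) (v (f i (q 2))) (v (f i (q 3))) + \<delta>"
        by metis
      have "u i (q j) = u j (q i)" if "i \<in> S" "j \<in> S" "i \<noteq> j" for i j
        using u(2) that midpoint_swap[of i j] by simp
      then obtain w where w: "w \<in> F'" "\<forall>i\<in>S. \<forall>y\<in>K. w (f i y) = u i y" "E' w = (\<Sum>i\<in>S. \<rho> * E' (u i))"
        using glue_mem[of u] u(1) by blast
      have "w (q i) = v (q i)" if "i \<in> S" for i
        using w(2) that q_mem[OF that] u(2)[OF that, of i] by (metis f_fixed)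
      then have "T.tr a b c \<le> E' w" using T.tr_le[OF w(1)] v S_mem by simp
      also have "\<dots> \<le> (\<Sum>i\<in>S. \<rho> * (T.tr (v (f i (q 1))) (v (f i (q 2))) (v (f i (q 3))) + \<delta>))"
        unfolding w(3) using u(3) rho_pos by (intro sum_mono mult_left_mono less_imp_le) auto
      also have "\<dots> = (\<Sum>i\<in>S. \<rho> * T.tr (v (f i (q 1))) (v (f i (q 2))) (v (f i (q 3)))) + 3 * (\<rho> * \<delta>)"
        by (simp add: sum_S distrib_left)
      also have "3 * (\<rho> * \<delta>) = \<epsilon>" using rho_pos by (simp add: \<delta>_def)
      finally show "T.tr a b c \<le> refined \<rho> T.tr a b c x y t + \<epsilon>"
        unfolding refined_eq_sum[symmetric] v .
    qed
  next
    fix a b c \<epsilon> :: real assume "0 < \<epsilon>"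
    then obtain w where w: "w \<in> F'" "w (q 1) = a" "w (q 2) = b" "w (q 3) = c" "E' w < T.tr a b c + \<epsilon>"
      by (rule T.tr_approx)
    have "refined \<rho> T.tr (w (q 1)) (w (q 2)) (w (q 3)) (w (mid 1 2)) (w (mid 1 3)) (w (mid 2 3)) \<le> E' w"
      unfolding refined_eq_sum bspec[OF SSE2 w(1)]
    proof (intro sum_mono mult_left_mono)
      fix i assume i: "i \<in> S"
      show "T.tr (w (f i (q 1))) (w (f i (q 2))) (w (f i (q 3))) \<le> E' (restrict (w \<circ> f i) K)"
        using T.tr_le[OF cell_mem[OF w(1) i]] by (simp add: q_mem S_mem)
    qed (use rho_pos in simp)
    then have "refined \<rho> T.tr a b c (w (mid 1 2)) (w (mid 1 3)) (w (mid 2 3)) < T.tr a b c + \<epsilon>"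
      using w(5) unfolding w(2-4) by simp
    then show "\<exists>x y t. refined \<rho> T.tr a b c x y t < T.tr a b c + \<epsilon>" by blast
  qed
qed

lemma trace_proportional: "\<exists>k>0. \<forall>a b c. T.tr a b c = k * e a b c"
  by (rule e.eigen_form_unique[OF trace_eigen_form]) blast

lemma renorm_nonneg: "0 \<le> renorm q \<rho> n E0 u"
  unfolding renorm_def using rho_pos
  by (intro sum_nonneg mult_nonneg_nonneg) (auto simp: E0_restrict E0.tr_nonneg)

lemma renorm_le_Suc: "renorm q \<rho> n E0 u \<le> renorm q \<rho> (Suc n) E0 u"
proof (induction n arbitrary: u)
  case 0
  show ?case
    using e.refined_ge[of "u (q 1)" "u (q 2)" "u (q 3)"] renorm_1[of u]
    by (simp add: renorm_0 E0_restrict One_nat_def)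
next
  case (Suc n)
  show ?case unfolding renorm_Suc[of \<rho> "Suc n"] renorm_Suc[of \<rho> n E0 u]
    using rho_pos by (intro sum_mono mult_left_mono Suc) simp
qed

lemma renorm_incseq: "incseq (\<lambda>n. renorm q \<rho> n E0 u)"
  by (rule incseq_SucI) (rule renorm_le_Suc)

lemma energy_lim_eq: "energy_lim q \<rho> E0 u = (SUP n. ereal (renorm q \<rho> n E0 u))"
proof -
  have "incseq (\<lambda>n. ereal (renorm q \<rho> n E0 u))"
    using renorm_incseq[of u] by (simp add: incseq_def)
  then show ?thesis unfolding energy_lim_def renorm_restrict by (intro limI LIMSEQ_SUP)
qed

lemma sg_domain_iff:
  "u \<in> sg_domain q K \<rho> E0 \<longleftrightarrow> u \<in> cont_funs K \<and> (\<exists>L. \<forall>n. renorm q \<rho> n E0 u \<le> L)"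
proof -
  have "energy_lim q \<rho> E0 u < \<infinity> \<longleftrightarrow> (\<exists>L. \<forall>n. renorm q \<rho> n E0 u \<le> L)"
  proof
    assume "energy_lim q \<rho> E0 u < \<infinity>"
    moreover have "ereal (renorm q \<rho> n E0 u) \<le> energy_lim q \<rho> E0 u" for n
      unfolding energy_lim_eq by (rule SUP_upper) simp
    ultimately show "\<exists>L. \<forall>n. renorm q \<rho> n E0 u \<le> L"
      by (cases "energy_lim q \<rho> E0 u") auto
  next
    assume "\<exists>L. \<forall>n. renorm q \<rho> n E0 u \<le> L"
    then obtain L where "\<forall>n. renorm q \<rho> n E0 u \<le> L" by blast
    then have "energy_lim q \<rho> E0 u \<le> ereal L" unfolding energy_lim_eq by (intro SUP_least) simp
    then show "energy_lim q \<rho> E0 u < \<infinity>" by (rule le_less_trans) simp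
  qed
  then show ?thesis by (simp add: sg_domain_def)
qed

lemma sg_energy_LIMSEQ:
  assumes "u \<in> sg_domain q K \<rho> E0"
  shows "(\<lambda>n. renorm q \<rho> n E0 u) \<longlonglongrightarrow> sg_energy q \<rho> E0 u"
proof -
  have "incseq (\<lambda>n. ereal (renorm q \<rho> n E0 u))"
    using renorm_incseq[of u] by (simp add: incseq_def)
  then have lim: "(\<lambda>n. ereal (renorm q \<rho> n E0 u)) \<longlonglongrightarrow> energy_lim q \<rho> E0 u"
    unfolding energy_lim_eq by (rule LIMSEQ_SUP)
  have "ereal (renorm q \<rho> 0 E0 u) \<le> energy_lim q \<rho> E0 u"
    unfolding energy_lim_eq by (rule SUP_upper) simp
  moreover have "energy_lim q \<rho> E0 u < \<infinity>" using assms by (simp add: sg_domain_def)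
  ultimately obtain L where "energy_lim q \<rho> E0 u = ereal L"
    by (cases "energy_lim q \<rho> E0 u") auto
  then show ?thesis using lim by (simp add: sg_energy_def)
qed

text \<open>
  The bounds on \<open>v\<close> in terms of nearby values of \<open>u\<close> make the approximants converge pointwise
  to a continuous \<open>u\<close>.
\<close>

lemma approximant:
  assumes k: "0 < k" "\<And>a b c. T.tr a b c = k * e a b c" and \<epsilon>: "0 < \<epsilon>"
  shows "\<exists>v\<in>F'. (\<forall>x\<in>V q n. v x = u x) \<and> E' v < k * renorm q \<rho> n E0 u + \<epsilon> \<and>
    (\<forall>x\<in>K. \<exists>y\<in>K. \<exists>z\<in>K. u y \<le> v x \<and> v x \<le> u z \<and>
      dist x y \<le> diameter K / 2 ^ n \<and> dist x z \<le> diameter K / 2 ^ n)"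
  using \<epsilon>
proof (induction n arbitrary: u \<epsilon>)
  case 0
  obtain w where w: "w \<in> F'" "w (q 1) = u (q 1)" "w (q 2) = u (q 2)" "w (q 3) = u (q 3)"
    "E' w < T.tr (u (q 1)) (u (q 2)) (u (q 3)) + \<epsilon>"
    by (rule T.tr_approx[OF 0])
  have wq: "w (q i) = u (q i)" if "i \<in> S" for i using that w(2-4) by (auto simp: S_def)
  define l h where "l = Min (u ` V0 q)" and "h = Max (u ` V0 q)"
  have fin: "finite (u ` V0 q)" "u ` V0 q \<noteq> {}" by (simp_all add: V0_eq)
  have lu: "l \<le> u z \<and> u z \<le> h" if "z \<in> V0 q" for z using fin that by (simp add: l_def h_def)
  then have lh: "l \<le> h" using V0_eq by fastforce
  define v where "v = (\<lambda>x\<in>K. max l (min h (w x)))"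
  have vF: "v \<in> F'" "E' v \<le> E' w" unfolding v_def by (rule T.clip_mem[OF w(1) lh], rule T.E_clip[OF w(1) lh])
  have "v x = u x" if x: "x \<in> V q 0" for x
  proof -
    have "x \<in> V0 q" using x by (simp add: V_0)
    moreover then obtain i where "i \<in> S" "x = q i" by (auto simp: V0_def)
    ultimately show ?thesis using lu[of x] wq[of i] q_mem[of i] by (simp add: v_def)
  qed
  moreover have "E' v < k * renorm q \<rho> 0 E0 u + \<epsilon>"
    using vF w(5) k(2) by (simp add: renorm_0 E0_restrict)
  moreover have "\<exists>y\<in>K. \<exists>z\<in>K. u y \<le> v x \<and> v x \<le> u z \<and>
      dist x y \<le> diameter K / 2 ^ 0 \<and> dist x z \<le> diameter K / 2 ^ 0" if x: "x \<in> K" for x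
  proof -
    obtain y where y: "y \<in> V0 q" "u y = l" using Min_in[OF fin] unfolding l_def by auto
    obtain z where z: "z \<in> V0 q" "u z = h" using Max_in[OF fin] unfolding h_def by auto
    have "y \<in> K" "z \<in> K" using y z V0_subset by auto
    moreover have "dist x y \<le> diameter K" "dist x z \<le> diameter K"
      using x \<open>y \<in> K\<close> \<open>z \<in> K\<close> by (intro diameter_bounded_bound compact_imp_bounded K_compact; simp)+
    moreover have "l \<le> v x" "v x \<le> h" using x lh by (simp_all add: v_def)
    ultimately show ?thesis using y z by auto
  qed
  ultimately show ?case using vF(1) by blast
next
  case (Suc n)
  define \<delta> where "\<delta> = \<epsilon> / (3 * \<rho>)"
  have \<delta>: "0 < \<delta>" using Suc.prems rho_pos by (simp add: \<delta>_def)
  have "\<forall>i. \<exists>w. w \<in> F' \<and> (\<forall>x\<in>V q n. w x = (u \<circ> f i) x) \<and> E' w < k * renorm q \<rho> n E0 (u \<circ> f i) + \<delta> \<and>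
    (\<forall>x\<in>K. \<exists>y\<in>K. \<exists>z\<in>K. (u \<circ> f i) y \<le> w x \<and> w x \<le> (u \<circ> f i) z \<and>
      dist x y \<le> diameter K / 2 ^ n \<and> dist x z \<le> diameter K / 2 ^ n)"
    using Suc.IH[OF \<delta>] by blast
  from choice[OF this] obtain w where w: "\<And>i. w i \<in> F'" "\<And>i. \<forall>x\<in>V q n. w i x = (u \<circ> f i) x"
    "\<And>i. E' (w i) < k * renorm q \<rho> n E0 (u \<circ> f i) + \<delta>"
    "\<And>i. \<forall>x\<in>K. \<exists>y\<in>K. \<exists>z\<in>K. (u \<circ> f i) y \<le> w i x \<and> w i x \<le> (u \<circ> f i) z \<and>
      dist x y \<le> diameter K / 2 ^ n \<and> dist x z \<le> diameter K / 2 ^ n"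
    by blast
  have "w i (q j) = w j (q i)" if "i \<in> S" "j \<in> S" "i \<noteq> j" for i j
    using w(2) vertex_mem_V[OF that(1)] vertex_mem_V[OF that(2)] midpoint_swap[of i j] by simp
  then obtain v where v: "v \<in> F'" "\<forall>i\<in>S. \<forall>y\<in>K. v (f i y) = w i y" "E' v = (\<Sum>i\<in>S. \<rho> * E' (w i))"
    using glue_mem[of w] w(1) by blast
  have "v x = u x" if x: "x \<in> V q (Suc n)" for x
  proof -
    obtain i y where "i \<in> S" "y \<in> V q n" "x = f i y" using x unfolding V_Suc by blast
    then show ?thesis using v(2) w(2)[of i] V_subset_K[of n] by auto
  qed
  moreover have "E' v < k * renorm q \<rho> (Suc n) E0 u + \<epsilon>"
  proof -
    have "E' v < (\<Sum>i\<in>S. \<rho> * (k * renorm q \<rho> n E0 (u \<circ> f i) + \<delta>))"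
      unfolding v(3) using w(3) rho_pos finite_S S_nonempty by (intro sum_strict_mono mult_strict_left_mono) auto
    also have "\<dots> = k * renorm q \<rho> (Suc n) E0 u + 3 * (\<rho> * \<delta>)"
      unfolding renorm_Suc sum_S by (simp add: algebra_simps)
    also have "3 * (\<rho> * \<delta>) = \<epsilon>" using rho_pos by (simp add: \<delta>_def)
    finally show ?thesis .
  qed
  moreover have "\<exists>y\<in>K. \<exists>z\<in>K. u y \<le> v x \<and> v x \<le> u z \<and>
      dist x y \<le> diameter K / 2 ^ Suc n \<and> dist x z \<le> diameter K / 2 ^ Suc n" if x: "x \<in> K" for x
  proof -
    obtain i x' where i: "i \<in> S" "x' \<in> K" "x = f i x'" using K_cases[OF x] .
    obtain y z where yz: "y \<in> K" "z \<in> K" "(u \<circ> f i) y \<le> w i x'" "w i x' \<le> (u \<circ> f i) z"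
      "dist x' y \<le> diameter K / 2 ^ n" "dist x' z \<le> diameter K / 2 ^ n"
      using bspec[OF w(4) i(2)] by blast
    have "u (f i y) \<le> v x" "v x \<le> u (f i z)" using yz v(2) i by simp_all
    moreover have "dist x (f i y) \<le> diameter K / 2 ^ Suc n" "dist x (f i z) \<le> diameter K / 2 ^ Suc n"
      using yz(5,6) by (simp_all add: i(3) dist_sg_map)
    moreover have "f i y \<in> K" "f i z \<in> K" using f_mem i yz by auto
    ultimately show ?thesis by blast
  qed
  ultimately show ?case using v(1) by blast
qed

lemma energy_ge_renorm:
  assumes k: "\<And>a b c. T.tr a b c = k * e a b c" and u: "u \<in> F'"
  shows "k * renorm q \<rho> n E0 u \<le> E' u"
  using u
proof (induction n arbitrary: u)
  case 0
  then show ?case using T.tr_le[OF 0] k by (simp add: renorm_0 E0_restrict)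
next
  case (Suc n)
  have "k * renorm q \<rho> (Suc n) E0 u = (\<Sum>i\<in>S. \<rho> * (k * renorm q \<rho> n E0 (restrict (u \<circ> f i) K)))"
  proof -
    have "renorm q \<rho> n E0 (u \<circ> f i) = renorm q \<rho> n E0 (restrict (u \<circ> f i) K)" for i
      using V_subset_K[of n] by (intro renorm_cong) auto
    then show ?thesis unfolding renorm_Suc by (simp add: sum_distrib_left mult.left_commute)
  qed
  also have "\<dots> \<le> (\<Sum>i\<in>S. \<rho> * E' (restrict (u \<circ> f i) K))"
    using rho_pos by (intro sum_mono mult_left_mono Suc.IH cell_mem[OF Suc.prems]) auto
  also have "\<dots> = E' u" using SSE2 Suc.prems by simp
  finally show ?case .
qed

lemma approximants_converge:
  fixes v :: "nat \<Rightarrow> real"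
  assumes u: "continuous_on K u" and x: "x \<in> K"
    and v: "\<And>n. \<exists>y\<in>K. \<exists>z\<in>K. u y \<le> v n \<and> v n \<le> u z \<and>
      dist x y \<le> diameter K / 2 ^ n \<and> dist x z \<le> diameter K / 2 ^ n"
  shows "v \<longlonglongrightarrow> u x"
proof -
  have "\<forall>n. \<exists>y z. y \<in> K \<and> z \<in> K \<and> u y \<le> v n \<and> v n \<le> u z \<and>
      dist x y \<le> diameter K / 2 ^ n \<and> dist x z \<le> diameter K / 2 ^ n"
    using v by blast
  then obtain y z where yz: "\<And>n. y n \<in> K" "\<And>n. z n \<in> K" "\<And>n. u (y n) \<le> v n" "\<And>n. v n \<le> u (z n)"
    "\<And>n. dist x (y n) \<le> diameter K / 2 ^ n" "\<And>n. dist x (z n) \<le> diameter K / 2 ^ n"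
    by metis
  have lim: "(\<lambda>n. diameter K / 2 ^ n) \<longlonglongrightarrow> 0" by (rule LIMSEQ_divide_realpow_zero) simp
  have u_lim: "(\<lambda>n. u (s n)) \<longlonglongrightarrow> u x"
    if s: "\<And>n. s n \<in> K" "\<And>n. dist x (s n) \<le> diameter K / 2 ^ n" for s
  proof (rule continuous_on_tendsto_compose[OF u _ x])
    have "(\<lambda>n. dist (s n) x) \<longlonglongrightarrow> 0"
      by (rule real_tendsto_sandwich[OF _ _ tendsto_const lim])
        (use s(2) in \<open>auto simp: dist_commute intro!: always_eventually\<close>)
    then show "s \<longlonglongrightarrow> x" by (rule tendsto_dist_iff[THEN iffD2])
  qed (use s(1) in simp)
  show ?thesis
    by (rule real_tendsto_sandwich[OF _ _ u_lim[OF yz(1,5)] u_lim[OF yz(2,6)]])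
      (use yz in \<open>auto intro!: always_eventually\<close>)
qed

lemma approximants_cauchy:
  assumes k: "0 < k" "\<And>a b c. T.tr a b c = k * e a b c"
    and lim: "(\<lambda>n. renorm q \<rho> n E0 u) \<longlonglongrightarrow> L" and L0: "0 \<le> L"
    and v: "\<And>n. v n \<in> F'" "\<And>n x. x \<in> V q n \<Longrightarrow> v n x = u x"
      "\<And>n. E' (v n) \<le> k * L + inverse (real (Suc n))"
    and \<epsilon>: "0 < \<epsilon>"
  shows "\<exists>N. \<forall>m\<ge>N. \<forall>n\<ge>N. E' (\<lambda>x\<in>K. v m x - v n x) < \<epsilon>"
proof -
  define \<epsilon>' where "\<epsilon>' = \<epsilon> / (2 * 2 powr p)"
  have \<epsilon>': "0 < \<epsilon>'" "2 powr p * \<epsilon>' < \<epsilon>" using \<epsilon> by (simp_all add: \<epsilon>'_def)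
  have "0 \<le> k * L" using k(1) L0 by simp
  then obtain \<delta> where \<delta>: "0 < \<delta>" and uc: "\<forall>u\<in>F'. \<forall>v\<in>F'. (E' u + E' v) / 2 \<le> k * L + \<delta>
    \<longrightarrow> k * L - \<delta> \<le> E' (\<lambda>x\<in>K. (u x + v x) / 2) \<longrightarrow> E' (\<lambda>x\<in>K. (u x - v x) / 2) \<le> \<epsilon>'"
    using T.E_uniformly_convex[OF _ \<epsilon>'(1)] by blast
  have "L - \<delta> / k < L" using \<delta> k(1) by simp
  then have "\<forall>\<^sub>F n in sequentially. L - \<delta> / k < renorm q \<rho> n E0 u"
    by (rule order_tendstoD(1)[OF lim])
  then obtain N1 where N1: "\<And>n. N1 \<le> n \<Longrightarrow> L - \<delta> / k < renorm q \<rho> n E0 u"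
    unfolding eventually_sequentially by blast
  obtain N2 where N2: "inverse (real (Suc N2)) < \<delta>" using reals_Archimedean[OF \<delta>] by blast
  define N where "N = max N1 N2"
  have inv: "inverse (real (Suc n)) \<le> \<delta>" if "N \<le> n" for n
  proof -
    have "inverse (real (Suc n)) \<le> inverse (real (Suc N2))"
      using that by (intro le_imp_inverse_le) (auto simp: N_def)
    then show ?thesis using N2 by linarith
  qed
  have "E' (\<lambda>x\<in>K. v m x - v n x) < \<epsilon>" if mn: "N \<le> m" "N \<le> n" for m n
  proof -
    have "(E' (v m) + E' (v n)) / 2 \<le> k * L + \<delta>"
      using v(3)[of m] v(3)[of n] inv[OF mn(1)] inv[OF mn(2)] by simp
    moreover have "k * L - \<delta> \<le> E' (\<lambda>x\<in>K. (v m x + v n x) / 2)"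
    proof -
      have mid: "(\<lambda>x\<in>K. (v m x + v n x) / 2) \<in> F'"
        using T.lincomb_mem[OF v(1)[of m] v(1)[of n], of "1/2" "1/2" 0]
        by (simp add: field_simps cong: restrict_cong)
      have "renorm q \<rho> N E0 (\<lambda>x\<in>K. (v m x + v n x) / 2) = renorm q \<rho> N E0 u"
      proof (rule renorm_cong)
        fix x assume x: "x \<in> V q N"
        then have "x \<in> V q m" "x \<in> V q n" "x \<in> K"
          using V_mono[OF mn(1)] V_mono[OF mn(2)] V_subset_K[of N] by auto
        then show "(\<lambda>x\<in>K. (v m x + v n x) / 2) x = u x" by (simp add: v(2))
      qed
      then have "k * renorm q \<rho> N E0 u \<le> E' (\<lambda>x\<in>K. (v m x + v n x) / 2)"
        using energy_ge_renorm[OF k(2) mid, of N] by simp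
      moreover have "k * (L - \<delta> / k) \<le> k * renorm q \<rho> N E0 u"
        using N1[of N] k(1) by (intro mult_left_mono) (auto simp: N_def)
      ultimately show ?thesis using k(1) by (simp add: right_diff_distrib)
    qed
    ultimately have le: "E' (\<lambda>x\<in>K. (v m x - v n x) / 2) \<le> \<epsilon>'"
      using uc v(1) by blast
    have half: "(\<lambda>x\<in>K. (v m x - v n x) / 2) \<in> F'"
      using T.lincomb_mem[OF v(1)[of m] v(1)[of n], of "1/2" "-1/2" 0]
      by (simp add: field_simps cong: restrict_cong)
    have "(\<lambda>x\<in>K. v m x - v n x) = (\<lambda>x\<in>K. 2 * (\<lambda>x\<in>K. (v m x - v n x) / 2) x)" by auto
    then have "E' (\<lambda>x\<in>K. v m x - v n x) = 2 powr p * E' (\<lambda>x\<in>K. (v m x - v n x) / 2)"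
      using T.E_scale[OF half, of 2] by simp
    also have "\<dots> \<le> 2 powr p * \<epsilon>'" using le by (intro mult_left_mono) auto
    finally show ?thesis using \<epsilon>'(2) by simp
  qed
  then show ?thesis by blast
qed

lemma finite_energy_mem:
  assumes k: "0 < k" "\<And>a b c. T.tr a b c = k * e a b c"
    and u: "u \<in> cont_funs K" and lim: "(\<lambda>n. renorm q \<rho> n E0 u) \<longlonglongrightarrow> L"
  shows "u \<in> F' \<and> E' u \<le> k * L"
proof -
  have u': "u \<in> extensional K" "continuous_on K u" using u by (auto simp: cont_funs_def)
  have le_L: "renorm q \<rho> n E0 u \<le> L" for n by (rule incseq_le[OF renorm_incseq lim])
  have L0: "0 \<le> L" using renorm_nonneg[of 0 u] le_L[of 0] by linarith
  have "\<forall>n. \<exists>v. v \<in> F' \<and> (\<forall>x\<in>V q n. v x = u x) \<and> E' v < k * renorm q \<rho> n E0 u + inverse (real (Suc n)) \<and>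
    (\<forall>x\<in>K. \<exists>y\<in>K. \<exists>z\<in>K. u y \<le> v x \<and> v x \<le> u z \<and>
      dist x y \<le> diameter K / 2 ^ n \<and> dist x z \<le> diameter K / 2 ^ n)"
  proof
    fix n
    have "0 < inverse (real (Suc n))" by simp
    from approximant[OF k this, of n u] show "\<exists>v. v \<in> F' \<and> (\<forall>x\<in>V q n. v x = u x)
      \<and> E' v < k * renorm q \<rho> n E0 u + inverse (real (Suc n)) \<and>
      (\<forall>x\<in>K. \<exists>y\<in>K. \<exists>z\<in>K. u y \<le> v x \<and> v x \<le> u z \<and>
      dist x y \<le> diameter K / 2 ^ n \<and> dist x z \<le> diameter K / 2 ^ n)" by blast
  qed
  from choice[OF this] obtain v where v: "\<And>n. v n \<in> F'" "\<And>n x. x \<in> V q n \<Longrightarrow> v n x = u x"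
    "\<And>n. E' (v n) < k * renorm q \<rho> n E0 u + inverse (real (Suc n))"
    "\<And>n. \<forall>x\<in>K. \<exists>y\<in>K. \<exists>z\<in>K. u y \<le> v n x \<and> v n x \<le> u z \<and>
      dist x y \<le> diameter K / 2 ^ n \<and> dist x z \<le> diameter K / 2 ^ n"
    by blast
  have v_le: "E' (v n) \<le> k * L + inverse (real (Suc n))" for n
  proof -
    have "k * renorm q \<rho> n E0 u \<le> k * L" using k(1) le_L[of n] by simp
    then show ?thesis using v(3)[of n] by linarith
  qed
  have v_lim: "(\<lambda>n. v n x) \<longlonglongrightarrow> u x" if "x \<in> K" for x
    by (rule approximants_converge[OF u'(2) that]) (use v(4) that in blast)
  obtain w where w: "w \<in> F'" "(\<lambda>n. E' (\<lambda>x\<in>K. v n x - w x)) \<longlonglongrightarrow> 0"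
    using T.E_complete[of v, OF v(1) approximants_cauchy[OF k lim L0 v(1,2) v_le]] by blast
  have const: "u x - w x = u y - w y" if xy: "x \<in> K" "y \<in> K" for x y
  proof -
    obtain C where C: "0 \<le> C" "\<forall>g\<in>F'. \<bar>g x - g y\<bar> powr p \<le> C * E' g"
      using T.resistance_bound[OF xy] by blast
    have "(\<lambda>n. \<bar>(v n x - w x) - (v n y - w y)\<bar>) \<longlonglongrightarrow> \<bar>(u x - w x) - (u y - w y)\<bar>"
      by (intro tendsto_intros v_lim xy)
    then have "(\<lambda>n. \<bar>(v n x - w x) - (v n y - w y)\<bar> powr p) \<longlonglongrightarrow> \<bar>(u x - w x) - (u y - w y)\<bar> powr p"
      using T.p_pos by - (rule tendsto_powr', assumption, rule tendsto_const, simp)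
    moreover have "(\<lambda>n. C * E' (\<lambda>x\<in>K. v n x - w x)) \<longlonglongrightarrow> C * 0"
      by (intro tendsto_mult_left w(2))
    moreover have "\<bar>(v n x - w x) - (v n y - w y)\<bar> powr p \<le> C * E' (\<lambda>x\<in>K. v n x - w x)" for n
      using bspec[OF C(2) T.diff_mem[OF v(1) w(1)]] xy by simp
    ultimately have "\<bar>(u x - w x) - (u y - w y)\<bar> powr p \<le> C * 0"
      by (intro LIMSEQ_le) auto
    then have "\<bar>(u x - w x) - (u y - w y)\<bar> powr p = 0" by (intro antisym) auto
    then show ?thesis by simp
  qed
  define c where "c = u (q 1) - w (q 1)"
  have "u x = 1 * w x + c" if "x \<in> K" for x
    using const[OF that q_mem[OF S_mem(1)]] by (simp add: c_def)
  then have u_eq: "u = (\<lambda>x\<in>K. 1 * w x + c)"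
    by (intro extensionalityI[OF u'(1)]) auto
  have uF: "u \<in> F'" unfolding u_eq by (rule T.affine_mem[OF w(1)])
  have Eu: "E' u = E' w" unfolding u_eq T.E_affine[OF w(1)] by simp
  have "E' w powr (1 / p) \<le> (k * L + 0) powr (1 / p) + 0 powr (1 / p)"
  proof (rule LIMSEQ_le[OF tendsto_const])
    show "(\<lambda>n. (k * L + inverse (real (Suc n))) powr (1 / p) + E' (\<lambda>x\<in>K. v n x - w x) powr (1 / p))
        \<longlonglongrightarrow> (k * L + 0) powr (1 / p) + 0 powr (1 / p)"
    proof (rule tendsto_add)
      show "(\<lambda>n. (k * L + inverse (real (Suc n))) powr (1 / p)) \<longlonglongrightarrow> (k * L + 0) powr (1 / p)"
      proof (rule tendsto_powr')
        show "(\<lambda>n. k * L + inverse (real (Suc n))) \<longlonglongrightarrow> k * L + 0"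
          by (intro tendsto_add tendsto_const LIMSEQ_inverse_real_of_nat)
        show "k * L + 0 \<noteq> 0 \<or> 0 < 1 / p \<and> (\<forall>\<^sub>F n in sequentially. 0 \<le> k * L + inverse (real (Suc n)))"
          using k(1) L0 T.p_pos by (intro disjI2 conjI always_eventually) auto
      qed (rule tendsto_const)
      show "(\<lambda>n. E' (\<lambda>x\<in>K. v n x - w x) powr (1 / p)) \<longlonglongrightarrow> 0 powr (1 / p)"
      proof (rule tendsto_powr'[OF w(2) tendsto_const])
        show "(0::real) \<noteq> 0 \<or> 0 < 1 / p \<and> (\<forall>\<^sub>F n in sequentially. 0 \<le> E' (\<lambda>x\<in>K. v n x - w x))"
          using T.p_pos T.nonneg[OF T.diff_mem[OF v(1) w(1)]]
          by (intro disjI2 conjI always_eventually allI) auto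
      qed
    qed
    show "\<exists>N. \<forall>n\<ge>N. E' w powr (1 / p)
        \<le> (k * L + inverse (real (Suc n))) powr (1 / p) + E' (\<lambda>x\<in>K. v n x - w x) powr (1 / p)"
    proof (intro exI allI impI)
      fix n :: nat
      have "(\<lambda>x\<in>K. v n x + (\<lambda>x\<in>K. w x - v n x) x) = restrict w K" by auto
      also have "\<dots> = w" by (rule extensional_restrict[OF T.mem_extensional[OF w(1)]])
      finally have "E' w powr (1 / p) \<le> E' (v n) powr (1 / p) + E' (\<lambda>x\<in>K. w x - v n x) powr (1 / p)"
        using T.RF1_triangle[OF v(1)[of n] T.diff_mem[OF w(1) v(1)[of n]]] by simp
      then have tri: "E' w powr (1 / p) \<le> E' (v n) powr (1 / p) + E' (\<lambda>x\<in>K. v n x - w x) powr (1 / p)"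
        unfolding T.E_diff_commute[OF w(1) v(1)] .
      have "E' (v n) powr (1 / p) \<le> (k * L + inverse (real (Suc n))) powr (1 / p)"
        using v_le T.nonneg[OF v(1)] T.p_pos by (intro powr_mono2) auto
      then show "E' w powr (1 / p)
        \<le> (k * L + inverse (real (Suc n))) powr (1 / p) + E' (\<lambda>x\<in>K. v n x - w x) powr (1 / p)"
        by (rule order_trans[OF tri add_right_mono])
    qed
  qed
  then have "E' w powr (1 / p) \<le> (k * L) powr (1 / p)" using T.p_pos by simp
  then have "(E' w powr (1 / p)) powr p \<le> ((k * L) powr (1 / p)) powr p"
    using T.p_pos by - (rule powr_mono2, auto)
  then have "E' w \<le> k * L"
    using T.powr_p_inverse[OF T.nonneg[OF w(1)]] T.powr_p_inverse[of "k * L"] k(1) L0 by simp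
  then show ?thesis using uF Eu by simp
qed

theorem selfsimilar_form_unique:
  "F' = sg_domain q K \<rho> E0 \<and> (\<exists>c>0. \<forall>u\<in>F'. E' u = c * sg_energy q \<rho> E0 u)"
proof -
  obtain k where k: "0 < k" "\<And>a b c. T.tr a b c = k * e a b c" using trace_proportional by blast
  have dom: "u \<in> sg_domain q K \<rho> E0" if u: "u \<in> F'" for u
  proof -
    have "renorm q \<rho> n E0 u \<le> E' u / k" for n
      using energy_ge_renorm[OF k(2) u, of n] k(1) by (simp add: field_simps)
    then show ?thesis using F_cont_funs[OF u] by (auto simp: sg_domain_iff)
  qed
  have mem: "u \<in> F' \<and> E' u \<le> k * sg_energy q \<rho> E0 u" if u: "u \<in> sg_domain q K \<rho> E0" for u
    using u by (intro finite_energy_mem[OF k _ sg_energy_LIMSEQ[OF u]]) (simp add: sg_domain_def)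
  have ge: "k * sg_energy q \<rho> E0 u \<le> E' u" if u: "u \<in> F'" for u
  proof (rule LIMSEQ_le_const2)
    show "(\<lambda>n. k * renorm q \<rho> n E0 u) \<longlonglongrightarrow> k * sg_energy q \<rho> E0 u"
      by (intro tendsto_mult_left sg_energy_LIMSEQ dom u)
    show "\<exists>N. \<forall>n\<ge>N. k * renorm q \<rho> n E0 u \<le> E' u"
      using energy_ge_renorm[OF k(2) u] by blast
  qed
  have "F' = sg_domain q K \<rho> E0" using dom mem by blast
  moreover have "E' u = k * sg_energy q \<rho> E0 u" if u: "u \<in> F'" for u
    using mem[OF dom[OF u]] ge[OF u] by simp
  ultimately show ?thesis using k(1) by blast
qed

end

theorem theorem3p23:
  fixes p \<rho> :: real and q :: "nat \<Rightarrow> real ^ 2" and K :: "(real ^ 2) set"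
    and E0 E' :: "(real ^ 2 \<Rightarrow> real) \<Rightarrow> real" and F' :: "(real ^ 2 \<Rightarrow> real) set"
  assumes "1 < p"
    and "equilateral q"
    and "is_gasket q K"
    and "0 < \<rho>"
    and "sym_eigenform p q K \<rho> E0"
    and "resistance_form p K E' F'"
    and SSE1: "F' = {u \<in> cont_funs K. \<forall>i\<in>S. restrict (u \<circ> sg_map q i) K \<in> F'}"
    and SSE2: "\<forall>u\<in>F'. E' u = (\<Sum>i\<in>S. \<rho> * E' (restrict (u \<circ> sg_map q i) K))"
  shows "F' = sg_domain q K \<rho> E0 \<and>
         (\<exists>c>0. \<forall>u\<in>F'. E' u = c * sg_energy q \<rho> E0 u)"
proof -
  interpret gasket_selfsimilar q K p \<rho> E0 E' F'
    by (intro gasket_selfsimilar.intro gasket_eigenform.intro gasket.intro gasket_eigenform_axioms.intro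
      gasket_selfsimilar_axioms.intro) (rule assms)+
  show ?thesis by (rule selfsimilar_form_unique)
qed

end
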